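(* Let $\mathscr{A},\mathscr{B}$ be Hom-finite finite-length abelian categories with enough projectives and finitely many simples. Let $t,t'$ be bounded t-structures with finite-length heart on $D^b(\mathscr{A})$ and $D^b(\mathscr{B})$, respectively, and let $w,w'$ be the bounded weight structures on $K^b(\mathrm{Proj}(\mathscr{A}))$ and $K^b(\mathrm{Proj}(\mathscr{B}))$ corresponding to $t$ and $t'$. Let $F\colon K^b(\mathrm{Proj}(\mathscr{B}))\to K^b(\mathrm{Proj}(\mathscr{A}))$ and let $G\colon D^b(\mathscr{A})\to D^b(\mathscr{B})$ be the functor corresponding to $F$, i.e. its right pseudo-adjoint. Then $G$ is t-exact (from $t$ to $t'$) if and only if $F$ is weight exact (from $w'$ to $w$).
   Context: All categories are linear over a fixed field; $F,G$ are triangulated functors. $\mathrm{Proj}(\mathscr{A})$ is the category of projective objects of $\mathscr{A}$, and $K^b(\mathrm{Proj}(\mathscr{A}))$ is regarded as a full subcategory of $D^b(\mathscr{A})$. t-structures $t=(\mathscr{D}^{t\le0},\mathscr{D}^{t\ge0})$ use the cohomological convention ($\mathscr{D}^{t\le0}[1]\subseteq\mathscr{D}^{t\le0}$); $\mathscr{D}^{t<0}=\mathscr{D}^{t\le0}[1]$, $\mathscr{D}^{t>0}=\mathscr{D}^{t\ge0}[-1]$. $t$ is bounded if $\mathscr{D}$ is generated as a triangulated category by the heart $\mathscr{D}^{t\le0}\cap\mathscr{D}^{t\ge0}$. A weight structure on $\mathscr{C}$ is a pair $w=(\mathscr{C}_{w\le0},\mathscr{C}_{w\ge0})$ of Karoubi-closed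 full subcategories with $\mathscr{C}_{w\le0}[1]\subseteq\mathscr{C}_{w\le0}$, $\mathscr{C}_{w\ge0}[-1]\subseteq\mathscr{C}_{w\ge0}$, $\mathrm{Hom}(\mathscr{C}_{w\ge0}[-1],\mathscr{C}_{w\le0})=0$, and every $X$ sits in a triangle $w_{>0}X\to X\to w_{\le0}X\to w_{>0}X[1]$ with $w_{>0}X\in\mathscr{C}_{w\ge0}[-1]$, $w_{\le0}X\in\mathscr{C}_{w\le0}$. It is bounded if $\mathscr{C}$ is the thick subcategory generated by $\mathscr{C}_{w\le0}\cap\mathscr{C}_{w\ge0}$. Correspondence of $t$ and $w$: there is a bijection between bounded t-structures with finite-length heart on $\mathscr{D}=D^b(\mathscr{A})$ and bounded weight structures on $\mathscr{C}=K^b(\mathrm{Proj}(\mathscr{A}))$, given by $\mathscr{C}_{w\le0}=\{X\in\mathscr{C}\mid\mathrm{Hom}_{\mathscr{D}}(X,\mathscr{D}^{t>0})=0\}$, $\mathscr{C}_{w\ge0}=\{X\in\mathscr{C}\mid\mathrm{Hom}_{\mathscr{D}}(X,\mathscr{D}^{t<0})=0\}$, with inverse $\mathscr{D}^{t\le0}=\{Y\in\mathscr{D}\mid\mathrm{Hom}_{\mathscr{D}}(\mathscr{C}_{w\ge 0}[-1],Y)=0\}$, $\mathscr{D}^{t\ge0}=\{Y\in\mathscr{D}\mid\mathrm{Hom}_{\mathscr{D}}(\mathscr{C}_{w\le 0}[1],Y)=0\}$. Right pseudo-adjoint: every $F\colon K^b(\mathrm{Proj}(\mathscr{B}))\to K^b(\mathrm{Proj}(\mathscr{A}))$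 has a right pseudo-adjoint $F^\vee\colon D^b(\mathscr{A})\to D^b(\mathscr{B})$, defined by natural isomorphisms $\mathrm{Hom}_{D^b(\mathscr{A})}(F(X),Y)\cong\mathrm{Hom}_{D^b(\mathscr{B})}(X,F^\vee(Y))$ for $X\in K^b(\mathrm{Proj}(\mathscr{B}))$, $Y\in D^b(\mathscr{A})$; sending $F$ to $F^\vee$ gives an equivalence (Chen) from the 2-category with such abelian categories as objects and functors $K^b(\mathrm{Proj}(\mathscr{A}))\to K^b(\mathrm{Proj}(\mathscr{B}))$ as 1-morphisms to the bidual (1- and 2-morphisms reversed) of the analogous 2-category with functors $D^b(\mathscr{A})\to D^b(\mathscr{B})$. The hypothesis is $G\cong F^\vee$. $F$ is weight exact if it maps the $\le0$ part of $w'$ into that of $w$ and the $\ge0$ part of $w'$ into that of $w$; $G$ is t-exact if it maps the $\le0$ and $\ge0$ parts of $t$ into those of $t'$. *)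

theory Defs
  imports Main
begin

section \<open>Categories linear over a field\<close>

text \<open>
  \<open>Comp C g f\<close>, written \<open>g \<cdot>\<^bsub>C\<^esub> f\<close>, is the composite of \<open>f\<close> followed by \<open>g\<close>.
  Only the values of the fields on objects and morphisms of the category matter.
\<close>

record ('o, 'm, 'k) lincat =
  Ob :: "'o set"
  Hom :: "'o \<Rightarrow> 'o \<Rightarrow> 'm set"
  Id :: "'o \<Rightarrow> 'm"
  Comp :: "'m \<Rightarrow> 'm \<Rightarrow> 'm"  (infixr "\<cdot>\<index>" 75)
  Zero :: "'o \<Rightarrow> 'o \<Rightarrow> 'm"
  Plus :: "'m \<Rightarrow> 'm \<Rightarrow> 'm"  (infixl "\<oplus>\<index>" 65)
  Scale :: "'k \<Rightarrow> 'm \<Rightarrow> 'm"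

locale linear_category =
  fixes C :: "('o, 'm, 'k::field, 'z) lincat_scheme" (structure)
  assumes Id_hom: "X \<in> Ob C \<Longrightarrow> Id C X \<in> Hom C X X"
    and Comp_hom: "\<lbrakk>X \<in> Ob C; Y \<in> Ob C; Z \<in> Ob C; f \<in> Hom C X Y; g \<in> Hom C Y Z\<rbrakk>
      \<Longrightarrow> g \<cdot> f \<in> Hom C X Z"
    and Comp_Id: "\<lbrakk>X \<in> Ob C; Y \<in> Ob C; f \<in> Hom C X Y\<rbrakk> \<Longrightarrow> f \<cdot> Id C X = f"
    and Id_Comp: "\<lbrakk>X \<in> Ob C; Y \<in> Ob C; f \<in> Hom C X Y\<rbrakk> \<Longrightarrow> Id C Y \<cdot> f = f"
    and Comp_assoc: "\<lbrakk>X \<in> Ob C; Y \<in> Ob C; Z \<in> Ob C; V \<in> Ob C;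
        f \<in> Hom C X Y; g \<in> Hom C Y Z; h \<in> Hom C Z V\<rbrakk> \<Longrightarrow> (h \<cdot> g) \<cdot> f = h \<cdot> (g \<cdot> f)"
    and Hom_disjoint: "\<lbrakk>X \<in> Ob C; Y \<in> Ob C; X' \<in> Ob C; Y' \<in> Ob C;
        f \<in> Hom C X Y; f \<in> Hom C X' Y'\<rbrakk> \<Longrightarrow> X = X' \<and> Y = Y'"
    and Zero_hom: "\<lbrakk>X \<in> Ob C; Y \<in> Ob C\<rbrakk> \<Longrightarrow> Zero C X Y \<in> Hom C X Y"
    and Plus_hom: "\<lbrakk>X \<in> Ob C; Y \<in> Ob C; f \<in> Hom C X Y; g \<in> Hom C X Y\<rbrakk> \<Longrightarrow> f \<oplus> g \<in> Hom C X Y"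
    and Scale_hom: "\<lbrakk>X \<in> Ob C; Y \<in> Ob C; f \<in> Hom C X Y\<rbrakk> \<Longrightarrow> Scale C c f \<in> Hom C X Y"
    and Plus_assoc: "\<lbrakk>X \<in> Ob C; Y \<in> Ob C; f \<in> Hom C X Y; g \<in> Hom C X Y; h \<in> Hom C X Y\<rbrakk>
      \<Longrightarrow> (f \<oplus> g) \<oplus> h = f \<oplus> (g \<oplus> h)"
    and Plus_comm: "\<lbrakk>X \<in> Ob C; Y \<in> Ob C; f \<in> Hom C X Y; g \<in> Hom C X Y\<rbrakk> \<Longrightarrow> f \<oplus> g = g \<oplus> f"
    and Plus_Zero: "\<lbrakk>X \<in> Ob C; Y \<in> Ob C; f \<in> Hom C X Y\<rbrakk> \<Longrightarrow> f \<oplus> Zero C X Y = f"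
    and Plus_inverse: "\<lbrakk>X \<in> Ob C; Y \<in> Ob C; f \<in> Hom C X Y\<rbrakk>
      \<Longrightarrow> \<exists>g \<in> Hom C X Y. f \<oplus> g = Zero C X Y"
    and Scale_Plus: "\<lbrakk>X \<in> Ob C; Y \<in> Ob C; f \<in> Hom C X Y; g \<in> Hom C X Y\<rbrakk>
      \<Longrightarrow> Scale C c (f \<oplus> g) = Scale C c f \<oplus> Scale C c g"
    and Scale_add: "\<lbrakk>X \<in> Ob C; Y \<in> Ob C; f \<in> Hom C X Y\<rbrakk>
      \<Longrightarrow> Scale C (c + d) f = Scale C c f \<oplus> Scale C d f"
    and Scale_mult: "\<lbrakk>X \<in> Ob C; Y \<in> Ob C; f \<in> Hom C X Y\<rbrakk>
      \<Longrightarrow> Scale C (c * d) f = Scale C c (Scale C d f)"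
    and Scale_one: "\<lbrakk>X \<in> Ob C; Y \<in> Ob C; f \<in> Hom C X Y\<rbrakk> \<Longrightarrow> Scale C 1 f = f"
    and Comp_Plus_left: "\<lbrakk>X \<in> Ob C; Y \<in> Ob C; Z \<in> Ob C;
        f \<in> Hom C X Y; g \<in> Hom C Y Z; g' \<in> Hom C Y Z\<rbrakk> \<Longrightarrow> (g \<oplus> g') \<cdot> f = g \<cdot> f \<oplus> g' \<cdot> f"
    and Comp_Plus_right: "\<lbrakk>X \<in> Ob C; Y \<in> Ob C; Z \<in> Ob C;
        f \<in> Hom C X Y; f' \<in> Hom C X Y; g \<in> Hom C Y Z\<rbrakk> \<Longrightarrow> g \<cdot> (f \<oplus> f') = g \<cdot> f \<oplus> g \<cdot> f'"
    and Comp_Scale_left: "\<lbrakk>X \<in> Ob C; Y \<in> Ob C; Z \<in> Ob C; f \<in> Hom C X Y; g \<in> Hom C Y Z\<rbrakk>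
      \<Longrightarrow> Scale C c g \<cdot> f = Scale C c (g \<cdot> f)"
    and Comp_Scale_right: "\<lbrakk>X \<in> Ob C; Y \<in> Ob C; Z \<in> Ob C; f \<in> Hom C X Y; g \<in> Hom C Y Z\<rbrakk>
      \<Longrightarrow> g \<cdot> Scale C c f = Scale C c (g \<cdot> f)"

definition full_subcat :: "('o, 'm, 'k, 'z) lincat_scheme \<Rightarrow> 'o set \<Rightarrow> ('o, 'm, 'k, 'z) lincat_scheme"
  where "full_subcat C S = C\<lparr>Ob := Ob C \<inter> S\<rparr>"

definition is_iso :: "('o, 'm, 'k, 'z) lincat_scheme \<Rightarrow> 'o \<Rightarrow> 'o \<Rightarrow> 'm \<Rightarrow> bool"
  where "is_iso C X Y f \<longleftrightarrow> f \<in> Hom C X Y \<and>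
    (\<exists>g \<in> Hom C Y X. g \<cdot>\<^bsub>C\<^esub> f = Id C X \<and> f \<cdot>\<^bsub>C\<^esub> g = Id C Y)"

definition isomorphic :: "('o, 'm, 'k, 'z) lincat_scheme \<Rightarrow> 'o \<Rightarrow> 'o \<Rightarrow> bool"
  where "isomorphic C X Y \<longleftrightarrow> (\<exists>f. is_iso C X Y f)"

definition retract_of_obj :: "('o, 'm, 'k, 'z) lincat_scheme \<Rightarrow> 'o \<Rightarrow> 'o \<Rightarrow> bool"
  where "retract_of_obj C X Y \<longleftrightarrow>
    (\<exists>i \<in> Hom C X Y. \<exists>r \<in> Hom C Y X. r \<cdot>\<^bsub>C\<^esub> i = Id C X)"

definition is_zero_obj :: "('o, 'm, 'k, 'z) lincat_scheme \<Rightarrow> 'o \<Rightarrow> bool"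
  where "is_zero_obj C X \<longleftrightarrow> X \<in> Ob C \<and>
    (\<forall>Y \<in> Ob C. Hom C X Y = {Zero C X Y} \<and> Hom C Y X = {Zero C Y X})"

definition is_mono :: "('o, 'm, 'k, 'z) lincat_scheme \<Rightarrow> 'o \<Rightarrow> 'o \<Rightarrow> 'm \<Rightarrow> bool"
  where "is_mono C X Y f \<longleftrightarrow> f \<in> Hom C X Y \<and>
    (\<forall>T \<in> Ob C. \<forall>g \<in> Hom C T X. \<forall>h \<in> Hom C T X. f \<cdot>\<^bsub>C\<^esub> g = f \<cdot>\<^bsub>C\<^esub> h \<longrightarrow> g = h)"

definition is_epi :: "('o, 'm, 'k, 'z) lincat_scheme \<Rightarrow> 'o \<Rightarrow> 'o \<Rightarrow> 'm \<Rightarrow> bool"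
  where "is_epi C X Y f \<longleftrightarrow> f \<in> Hom C X Y \<and>
    (\<forall>T \<in> Ob C. \<forall>g \<in> Hom C Y T. \<forall>h \<in> Hom C Y T. g \<cdot>\<^bsub>C\<^esub> f = h \<cdot>\<^bsub>C\<^esub> f \<longrightarrow> g = h)"

definition is_kernel :: "('o, 'm, 'k, 'z) lincat_scheme \<Rightarrow> 'o \<Rightarrow> 'o \<Rightarrow> 'm \<Rightarrow> 'o \<Rightarrow> 'm \<Rightarrow> bool"
  where "is_kernel C X Y f N j \<longleftrightarrow> f \<in> Hom C X Y \<and> N \<in> Ob C \<and> j \<in> Hom C N X \<and>
    f \<cdot>\<^bsub>C\<^esub> j = Zero C N Y \<and>
    (\<forall>T \<in> Ob C. \<forall>u \<in> Hom C T X. f \<cdot>\<^bsub>C\<^esub> u = Zero C T Y \<longrightarrow>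
      (\<exists>!v. v \<in> Hom C T N \<and> j \<cdot>\<^bsub>C\<^esub> v = u))"

definition is_cokernel :: "('o, 'm, 'k, 'z) lincat_scheme \<Rightarrow> 'o \<Rightarrow> 'o \<Rightarrow> 'm \<Rightarrow> 'o \<Rightarrow> 'm \<Rightarrow> bool"
  where "is_cokernel C X Y f Q p \<longleftrightarrow> f \<in> Hom C X Y \<and> Q \<in> Ob C \<and> p \<in> Hom C Y Q \<and>
    p \<cdot>\<^bsub>C\<^esub> f = Zero C X Q \<and>
    (\<forall>T \<in> Ob C. \<forall>u \<in> Hom C Y T. u \<cdot>\<^bsub>C\<^esub> f = Zero C X T \<longrightarrow>
      (\<exists>!v. v \<in> Hom C Q T \<and> v \<cdot>\<^bsub>C\<^esub> p = u))"

definition is_biproduct ::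
    "('o, 'm, 'k, 'z) lincat_scheme \<Rightarrow> 'o \<Rightarrow> 'o \<Rightarrow> 'o \<Rightarrow> 'm \<Rightarrow> 'm \<Rightarrow> 'm \<Rightarrow> 'm \<Rightarrow> bool"
  where "is_biproduct C X Y S i\<^sub>1 i\<^sub>2 p\<^sub>1 p\<^sub>2 \<longleftrightarrow> S \<in> Ob C \<and>
    i\<^sub>1 \<in> Hom C X S \<and> i\<^sub>2 \<in> Hom C Y S \<and> p\<^sub>1 \<in> Hom C S X \<and> p\<^sub>2 \<in> Hom C S Y \<and>
    p\<^sub>1 \<cdot>\<^bsub>C\<^esub> i\<^sub>1 = Id C X \<and> p\<^sub>2 \<cdot>\<^bsub>C\<^esub> i\<^sub>2 = Id C Y \<and>
    p\<^sub>1 \<cdot>\<^bsub>C\<^esub> i\<^sub>2 = Zero C Y X \<and> p\<^sub>2 \<cdot>\<^bsub>C\<^esub> i\<^sub>1 = Zero C X Y \<and>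
    (i\<^sub>1 \<cdot>\<^bsub>C\<^esub> p\<^sub>1) \<oplus>\<^bsub>C\<^esub> (i\<^sub>2 \<cdot>\<^bsub>C\<^esub> p\<^sub>2) = Id C S"

locale abelian_category = linear_category +
  assumes ex_zero_obj: "\<exists>X. is_zero_obj C X"
    and ex_biproduct: "\<lbrakk>X \<in> Ob C; Y \<in> Ob C\<rbrakk> \<Longrightarrow> \<exists>S i\<^sub>1 i\<^sub>2 p\<^sub>1 p\<^sub>2. is_biproduct C X Y S i\<^sub>1 i\<^sub>2 p\<^sub>1 p\<^sub>2"
    and ex_kernel: "\<lbrakk>X \<in> Ob C; Y \<in> Ob C; f \<in> Hom C X Y\<rbrakk> \<Longrightarrow> \<exists>N j. is_kernel C X Y f N j"
    and ex_cokernel: "\<lbrakk>X \<in> Ob C; Y \<in> Ob C; f \<in> Hom C X Y\<rbrakk> \<Longrightarrow> \<exists>Q p. is_cokernel C X Y f Q p"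
    and mono_is_kernel: "\<lbrakk>X \<in> Ob C; Y \<in> Ob C; is_mono C X Y f\<rbrakk>
      \<Longrightarrow> \<exists>Z \<in> Ob C. \<exists>g. is_kernel C Y Z g X f"
    and epi_is_cokernel: "\<lbrakk>X \<in> Ob C; Y \<in> Ob C; is_epi C X Y f\<rbrakk>
      \<Longrightarrow> \<exists>Z \<in> Ob C. \<exists>g. is_cokernel C Z X g Y f"

subsection \<open>Finiteness conditions and projectives\<close>

inductive_set lin_span :: "('o, 'm, 'k, 'z) lincat_scheme \<Rightarrow> 'o \<Rightarrow> 'o \<Rightarrow> 'm set \<Rightarrow> 'm set"
  for C :: "('o, 'm, 'k, 'z) lincat_scheme" and X Y :: 'o and S :: "'m set"
  where
    base: "f \<in> S \<Longrightarrow> f \<in> lin_span C X Y S"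
  | zero: "Zero C X Y \<in> lin_span C X Y S"
  | plus: "\<lbrakk>f \<in> lin_span C X Y S; g \<in> lin_span C X Y S\<rbrakk> \<Longrightarrow> f \<oplus>\<^bsub>C\<^esub> g \<in> lin_span C X Y S"
  | scale: "f \<in> lin_span C X Y S \<Longrightarrow> Scale C c f \<in> lin_span C X Y S"

definition hom_finite :: "('o, 'm, 'k, 'z) lincat_scheme \<Rightarrow> bool"
  where "hom_finite C \<longleftrightarrow>
    (\<forall>X \<in> Ob C. \<forall>Y \<in> Ob C. \<exists>S. finite S \<and> S \<subseteq> Hom C X Y \<and> Hom C X Y = lin_span C X Y S)"

definition simple_obj :: "('o, 'm, 'k, 'z) lincat_scheme \<Rightarrow> 'o \<Rightarrow> bool"
  where "simple_obj C S \<longleftrightarrow> S \<in> Ob C \<and> \<not> is_zero_obj C S \<and>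
    (\<forall>X \<in> Ob C. \<forall>i. is_mono C X S i \<longrightarrow> is_zero_obj C X \<or> is_iso C X S i)"

definition short_exact :: "('o, 'm, 'k, 'z) lincat_scheme \<Rightarrow> 'o \<Rightarrow> 'o \<Rightarrow> 'o \<Rightarrow> 'm \<Rightarrow> 'm \<Rightarrow> bool"
  where "short_exact C X Y Z i p \<longleftrightarrow> X \<in> Ob C \<and> Y \<in> Ob C \<and> Z \<in> Ob C \<and>
    is_kernel C Y Z p X i \<and> is_cokernel C X Y i Z p"

inductive finite_length_obj :: "('o, 'm, 'k, 'z) lincat_scheme \<Rightarrow> 'o \<Rightarrow> bool"
  for C :: "('o, 'm, 'k, 'z) lincat_scheme"
  where
    zero: "is_zero_obj C X \<Longrightarrow> finite_length_obj C X"
  | extend: "\<lbrakk>finite_length_obj C X; simple_obj C S; short_exact C X Y S i p\<rbrakk>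
      \<Longrightarrow> finite_length_obj C Y"

definition finite_length :: "('o, 'm, 'k, 'z) lincat_scheme \<Rightarrow> bool"
  where "finite_length C \<longleftrightarrow> (\<forall>X \<in> Ob C. finite_length_obj C X)"

definition finitely_many_simples :: "('o, 'm, 'k, 'z) lincat_scheme \<Rightarrow> bool"
  where "finitely_many_simples C \<longleftrightarrow>
    (\<exists>L. finite L \<and> (\<forall>S. simple_obj C S \<longrightarrow> (\<exists>T \<in> L. simple_obj C T \<and> isomorphic C S T)))"

definition projective_obj :: "('o, 'm, 'k, 'z) lincat_scheme \<Rightarrow> 'o \<Rightarrow> bool"
  where "projective_obj C P \<longleftrightarrow> P \<in> Ob C \<and>
    (\<forall>X \<in> Ob C. \<forall>Y \<in> Ob C. \<forall>e. is_epi C X Y e \<longrightarrow>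
      (\<forall>f \<in> Hom C P Y. \<exists>g \<in> Hom C P X. e \<cdot>\<^bsub>C\<^esub> g = f))"

definition enough_projectives :: "('o, 'm, 'k, 'z) lincat_scheme \<Rightarrow> bool"
  where "enough_projectives C \<longleftrightarrow> (\<forall>X \<in> Ob C. \<exists>P e. projective_obj C P \<and> is_epi C P X e)"

definition Proj :: "('o, 'm, 'k, 'z) lincat_scheme \<Rightarrow> ('o, 'm, 'k, 'z) lincat_scheme"
  where "Proj C = full_subcat C {P. projective_obj C P}"


section \<open>Triangulated data, t-structures and weight structures\<close>

text \<open>
  \<open>ShO T n X\<close> and \<open>ShM T n f\<close> are \<open>X[n]\<close> and \<open>f[n]\<close>; the shift functors form a strict action
  of the integers in all categories considered below.  \<open>Tri T X Y Z f g h\<close> says that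
  \<open>X \<rightarrow> Y \<rightarrow> Z \<rightarrow> X[1]\<close> with maps \<open>f\<close>, \<open>g\<close>, \<open>h\<close> is a distinguished triangle.
\<close>

record ('o, 'm, 'k) tricat = "('o, 'm, 'k) lincat" +
  ShO :: "int \<Rightarrow> 'o \<Rightarrow> 'o"
  ShM :: "int \<Rightarrow> 'm \<Rightarrow> 'm"
  Tri :: "'o \<Rightarrow> 'o \<Rightarrow> 'o \<Rightarrow> 'm \<Rightarrow> 'm \<Rightarrow> 'm \<Rightarrow> bool"

inductive_set tri_generated :: "('o, 'm, 'k, 'z) tricat_scheme \<Rightarrow> 'o set \<Rightarrow> 'o set"
  for T :: "('o, 'm, 'k, 'z) tricat_scheme" and S :: "'o set"
  where
    base: "\<lbrakk>X \<in> S; X \<in> Ob T\<rbrakk> \<Longrightarrow> X \<in> tri_generated T S"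
  | zero: "is_zero_obj T X \<Longrightarrow> X \<in> tri_generated T S"
  | iso: "\<lbrakk>X \<in> tri_generated T S; Y \<in> Ob T; isomorphic T X Y\<rbrakk> \<Longrightarrow> Y \<in> tri_generated T S"
  | shift: "X \<in> tri_generated T S \<Longrightarrow> ShO T n X \<in> tri_generated T S"
  | cone: "\<lbrakk>X \<in> tri_generated T S; Y \<in> tri_generated T S; Tri T X Y Z f g h\<rbrakk>
      \<Longrightarrow> Z \<in> tri_generated T S"

inductive_set thick_generated :: "('o, 'm, 'k, 'z) tricat_scheme \<Rightarrow> 'o set \<Rightarrow> 'o set"
  for T :: "('o, 'm, 'k, 'z) tricat_scheme" and S :: "'o set"
  where
    base: "\<lbrakk>X \<in> S; X \<in> Ob T\<rbrakk> \<Longrightarrow> X \<in> thick_generated T S"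
  | zero: "is_zero_obj T X \<Longrightarrow> X \<in> thick_generated T S"
  | retract: "\<lbrakk>X \<in> thick_generated T S; Y \<in> Ob T; retract_of_obj T Y X\<rbrakk>
      \<Longrightarrow> Y \<in> thick_generated T S"
  | shift: "X \<in> thick_generated T S \<Longrightarrow> ShO T n X \<in> thick_generated T S"
  | cone: "\<lbrakk>X \<in> thick_generated T S; Y \<in> thick_generated T S; Tri T X Y Z f g h\<rbrakk>
      \<Longrightarrow> Z \<in> thick_generated T S"

text \<open>Full subcategories are given by their sets of objects.\<close>

record 'o halves =
  le_part :: "'o set"
  ge_part :: "'o set"

definition iso_closed :: "('o, 'm, 'k, 'z) lincat_scheme \<Rightarrow> 'o set \<Rightarrow> bool"
  where "iso_closed C S \<longleftrightarrow> (\<forall>X \<in> S. \<forall>Y \<in> Ob C. isomorphic C X Y \<longrightarrow> Y \<in> S)"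

definition karoubi_closed :: "('o, 'm, 'k, 'z) lincat_scheme \<Rightarrow> 'o set \<Rightarrow> bool"
  where "karoubi_closed C S \<longleftrightarrow> (\<forall>X \<in> S. \<forall>Y \<in> Ob C. retract_of_obj C Y X \<longrightarrow> Y \<in> S)"

definition t_lt0 :: "('o, 'm, 'k, 'z) tricat_scheme \<Rightarrow> 'o halves \<Rightarrow> 'o set"
  where "t_lt0 D t = ShO D 1 ` le_part t"

definition t_gt0 :: "('o, 'm, 'k, 'z) tricat_scheme \<Rightarrow> 'o halves \<Rightarrow> 'o set"
  where "t_gt0 D t = ShO D (-1) ` ge_part t"

definition t_structure :: "('o, 'm, 'k, 'z) tricat_scheme \<Rightarrow> 'o halves \<Rightarrow> bool"
  where "t_structure D t \<longleftrightarrow>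
    le_part t \<subseteq> Ob D \<and> ge_part t \<subseteq> Ob D \<and>
    iso_closed D (le_part t) \<and> iso_closed D (ge_part t) \<and>
    ShO D 1 ` le_part t \<subseteq> le_part t \<and> ShO D (-1) ` ge_part t \<subseteq> ge_part t \<and>
    (\<forall>X \<in> le_part t. \<forall>Y \<in> t_gt0 D t. Hom D X Y = {Zero D X Y}) \<and>
    (\<forall>X \<in> Ob D. \<exists>L \<in> le_part t. \<exists>R \<in> t_gt0 D t. \<exists>f g h. Tri D L X R f g h)"

definition heart :: "('o, 'm, 'k, 'z) tricat_scheme \<Rightarrow> 'o halves \<Rightarrow> ('o, 'm, 'k, 'z) tricat_scheme"
  where "heart D t = full_subcat D (le_part t \<inter> ge_part t)"

definition bounded_t_structure :: "('o, 'm, 'k, 'z) tricat_scheme \<Rightarrow> 'o halves \<Rightarrow> bool"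
  where "bounded_t_structure D t \<longleftrightarrow>
    t_structure D t \<and> tri_generated D (le_part t \<inter> ge_part t) = Ob D"

definition weight_structure :: "('o, 'm, 'k, 'z) tricat_scheme \<Rightarrow> 'o halves \<Rightarrow> bool"
  where "weight_structure C w \<longleftrightarrow>
    le_part w \<subseteq> Ob C \<and> ge_part w \<subseteq> Ob C \<and>
    karoubi_closed C (le_part w) \<and> karoubi_closed C (ge_part w) \<and>
    ShO C 1 ` le_part w \<subseteq> le_part w \<and> ShO C (-1) ` ge_part w \<subseteq> ge_part w \<and>
    (\<forall>X \<in> ShO C (-1) ` ge_part w. \<forall>Y \<in> le_part w. Hom C X Y = {Zero C X Y}) \<and>
    (\<forall>X \<in> Ob C. \<exists>L \<in> ShO C (-1) ` ge_part w. \<exists>R \<in> le_part w. \<exists>f g h. Tri C L X R f g h)"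

definition bounded_weight_structure :: "('o, 'm, 'k, 'z) tricat_scheme \<Rightarrow> 'o halves \<Rightarrow> bool"
  where "bounded_weight_structure C w \<longleftrightarrow>
    weight_structure C w \<and> thick_generated C (le_part w \<inter> ge_part w) = Ob C"

subsection \<open>Functors\<close>

record ('o, 'm, 'p, 'n) catfun =
  FOb :: "'o \<Rightarrow> 'p"
  FMor :: "'m \<Rightarrow> 'n"

definition linear_functor ::
    "('o, 'm, 'k, 'y) lincat_scheme \<Rightarrow> ('p, 'n, 'k, 'z) lincat_scheme \<Rightarrow> ('o, 'm, 'p, 'n) catfun \<Rightarrow> bool"
  where "linear_functor C D F \<longleftrightarrow>
    (\<forall>X \<in> Ob C. FOb F X \<in> Ob D \<and> FMor F (Id C X) = Id D (FOb F X)) \<and>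
    (\<forall>X \<in> Ob C. \<forall>Y \<in> Ob C. \<forall>f \<in> Hom C X Y.
      FMor F f \<in> Hom D (FOb F X) (FOb F Y) \<and>
      (\<forall>c. FMor F (Scale C c f) = Scale D c (FMor F f)) \<and>
      (\<forall>g \<in> Hom C X Y. FMor F (f \<oplus>\<^bsub>C\<^esub> g) = FMor F f \<oplus>\<^bsub>D\<^esub> FMor F g) \<and>
      (\<forall>Z \<in> Ob C. \<forall>g \<in> Hom C Y Z. FMor F (g \<cdot>\<^bsub>C\<^esub> f) = FMor F g \<cdot>\<^bsub>D\<^esub> FMor F f))"

text \<open>A triangulated functor comes with a natural isomorphism \<open>\<eta> X : F(X[1]) \<cong> F(X)[1]\<close>.\<close>

definition triangulated_functor ::
    "('o, 'm, 'k, 'y) tricat_scheme \<Rightarrow> ('p, 'n, 'k, 'z) tricat_scheme \<Rightarrow> ('o, 'm, 'p, 'n) catfun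
      \<Rightarrow> ('o \<Rightarrow> 'n) \<Rightarrow> bool"
  where "triangulated_functor C D F \<eta> \<longleftrightarrow> linear_functor C D F \<and>
    (\<forall>X \<in> Ob C. is_iso D (FOb F (ShO C 1 X)) (ShO D 1 (FOb F X)) (\<eta> X)) \<and>
    (\<forall>X \<in> Ob C. \<forall>Y \<in> Ob C. \<forall>f \<in> Hom C X Y.
      \<eta> Y \<cdot>\<^bsub>D\<^esub> FMor F (ShM C 1 f) = ShM D 1 (FMor F f) \<cdot>\<^bsub>D\<^esub> \<eta> X) \<and>
    (\<forall>X Y Z f g h. Tri C X Y Z f g h \<longrightarrow>
      Tri D (FOb F X) (FOb F Y) (FOb F Z) (FMor F f) (FMor F g) (\<eta> X \<cdot>\<^bsub>D\<^esub> FMor F h))"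

definition t_exact :: "('o, 'm, 'p, 'n) catfun \<Rightarrow> 'o halves \<Rightarrow> 'p halves \<Rightarrow> bool"
  where "t_exact G t t' \<longleftrightarrow>
    FOb G ` le_part t \<subseteq> le_part t' \<and> FOb G ` ge_part t \<subseteq> ge_part t'"

definition weight_exact :: "('o, 'm, 'p, 'n) catfun \<Rightarrow> 'o halves \<Rightarrow> 'p halves \<Rightarrow> bool"
  where "weight_exact F w w' \<longleftrightarrow>
    FOb F ` le_part w \<subseteq> le_part w' \<and> FOb F ` ge_part w \<subseteq> ge_part w'"


section \<open>Complexes and the bounded homotopy category\<close>

record ('o, 'm) cplx =
  cob :: "int \<Rightarrow> 'o"
  cdiff :: "int \<Rightarrow> 'm"

definition bounded_cplx :: "('o, 'm, 'k, 'z) lincat_scheme \<Rightarrow> ('o, 'm) cplx \<Rightarrow> bool"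
  where "bounded_cplx A X \<longleftrightarrow>
    (\<forall>i. cob X i \<in> Ob A \<and> cdiff X i \<in> Hom A (cob X i) (cob X (i + 1)) \<and>
      cdiff X (i + 1) \<cdot>\<^bsub>A\<^esub> cdiff X i = Zero A (cob X i) (cob X (i + 2))) \<and>
    (\<exists>N. \<forall>i. \<bar>i\<bar> > N \<longrightarrow> is_zero_obj A (cob X i))"

definition chain_map ::
    "('o, 'm, 'k, 'z) lincat_scheme \<Rightarrow> ('o, 'm) cplx \<Rightarrow> ('o, 'm) cplx \<Rightarrow> (int \<Rightarrow> 'm) \<Rightarrow> bool"
  where "chain_map A X Y f \<longleftrightarrow>
    (\<forall>i. f i \<in> Hom A (cob X i) (cob Y i) \<and>
      cdiff Y i \<cdot>\<^bsub>A\<^esub> f i = f (i + 1) \<cdot>\<^bsub>A\<^esub> cdiff X i)"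

definition homotopic ::
    "('o, 'm, 'k, 'z) lincat_scheme \<Rightarrow> ('o, 'm) cplx \<Rightarrow> ('o, 'm) cplx \<Rightarrow> (int \<Rightarrow> 'm) \<Rightarrow> (int \<Rightarrow> 'm) \<Rightarrow> bool"
  where "homotopic A X Y f g \<longleftrightarrow>
    (\<exists>s. \<forall>i. s i \<in> Hom A (cob X i) (cob Y (i - 1)) \<and>
      f i = g i \<oplus>\<^bsub>A\<^esub> ((cdiff Y (i - 1) \<cdot>\<^bsub>A\<^esub> s i) \<oplus>\<^bsub>A\<^esub> (s (i + 1) \<cdot>\<^bsub>A\<^esub> cdiff X i)))"

text \<open>
  A morphism of the homotopy category is a homotopy class together with its source and target.
\<close>

type_synonym ('o, 'm) kmor = "('o, 'm) cplx \<times> (int \<Rightarrow> 'm) set \<times> ('o, 'm) cplx"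

definition hclass ::
    "('o, 'm, 'k, 'z) lincat_scheme \<Rightarrow> ('o, 'm) cplx \<Rightarrow> ('o, 'm) cplx \<Rightarrow> (int \<Rightarrow> 'm) \<Rightarrow> ('o, 'm) kmor"
  where "hclass A X Y f = (X, {g. chain_map A X Y g \<and> homotopic A X Y f g}, Y)"

definition hrep :: "('o, 'm) kmor \<Rightarrow> int \<Rightarrow> 'm"
  where "hrep a = (SOME f. f \<in> fst (snd a))"

definition Kb_lin :: "('o, 'm, 'k, 'z) lincat_scheme \<Rightarrow> (('o, 'm) cplx, ('o, 'm) kmor, 'k) lincat"
  where "Kb_lin A = \<lparr>
    Ob = {X. bounded_cplx A X},
    Hom = (\<lambda>X Y. hclass A X Y ` {f. chain_map A X Y f}),
    Id = (\<lambda>X. hclass A X X (\<lambda>i. Id A (cob X i))),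
    Comp = (\<lambda>b a. hclass A (fst a) (snd (snd b)) (\<lambda>i. hrep b i \<cdot>\<^bsub>A\<^esub> hrep a i)),
    Zero = (\<lambda>X Y. hclass A X Y (\<lambda>i. Zero A (cob X i) (cob Y i))),
    Plus = (\<lambda>a b. hclass A (fst a) (snd (snd a)) (\<lambda>i. hrep a i \<oplus>\<^bsub>A\<^esub> hrep b i)),
    Scale = (\<lambda>c a. hclass A (fst a) (snd (snd a)) (\<lambda>i. Scale A c (hrep a i))) \<rparr>"

text \<open>The shift is \<open>X[n]\<^sup>i = X\<^sup>i\<^sup>+\<^sup>n\<close>, with differential multiplied by \<open>(-1)\<^sup>n\<close>, and \<open>f[n]\<^sup>i = f\<^sup>i\<^sup>+\<^sup>n\<close>.\<close>

definition cplx_shift :: "('o, 'm, 'k::field, 'z) lincat_scheme \<Rightarrow> int \<Rightarrow> ('o, 'm) cplx \<Rightarrow> ('o, 'm) cplx"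
  where "cplx_shift A n X =
    \<lparr>cob = (\<lambda>i. cob X (i + n)),
     cdiff = (\<lambda>i. Scale A (if even n then 1 else -1) (cdiff X (i + n)))\<rparr>"

definition kmor_shift :: "('o, 'm, 'k::field, 'z) lincat_scheme \<Rightarrow> int \<Rightarrow> ('o, 'm) kmor \<Rightarrow> ('o, 'm) kmor"
  where "kmor_shift A n a =
    (cplx_shift A n (fst a), (\<lambda>f i. f (i + n)) ` fst (snd a), cplx_shift A n (snd (snd a)))"

text \<open>
  \<open>Z\<close> is a mapping cone of \<open>f : X \<rightarrow> Y\<close>, with canonical maps \<open>\<iota> : Y \<rightarrow> Z\<close> and \<open>\<pi> : Z \<rightarrow> X[1]\<close>, when
  \<open>Z\<^sup>i = X\<^sup>i\<^sup>+\<^sup>1 \<oplus> Y\<^sup>i\<close> with differential \<open>(x, y) \<mapsto> (- d x, f x + d y)\<close>.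
\<close>

definition mapping_cone ::
    "('o, 'm, 'k::field, 'z) lincat_scheme \<Rightarrow> ('o, 'm) cplx \<Rightarrow> ('o, 'm) cplx \<Rightarrow> (int \<Rightarrow> 'm)
      \<Rightarrow> ('o, 'm) cplx \<Rightarrow> (int \<Rightarrow> 'm) \<Rightarrow> (int \<Rightarrow> 'm) \<Rightarrow> bool"
  where "mapping_cone A X Y f Z \<iota> \<pi> \<longleftrightarrow>
    (\<exists>\<alpha> \<beta>. \<forall>i. is_biproduct A (cob X (i + 1)) (cob Y i) (cob Z i) (\<alpha> i) (\<iota> i) (\<pi> i) (\<beta> i) \<and>
      cdiff Z i =
        (\<alpha> (i + 1) \<cdot>\<^bsub>A\<^esub> Scale A (-1) (cdiff X (i + 1)) \<cdot>\<^bsub>A\<^esub> \<pi> i) \<oplus>\<^bsub>A\<^esub>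
        ((\<iota> (i + 1) \<cdot>\<^bsub>A\<^esub> f (i + 1) \<cdot>\<^bsub>A\<^esub> \<pi> i) \<oplus>\<^bsub>A\<^esub> (\<iota> (i + 1) \<cdot>\<^bsub>A\<^esub> cdiff Y i \<cdot>\<^bsub>A\<^esub> \<beta> i)))"

definition standard_triangle ::
    "('o, 'm, 'k::field, 'z) lincat_scheme \<Rightarrow> ('o, 'm) cplx \<Rightarrow> ('o, 'm) cplx \<Rightarrow> ('o, 'm) cplx
      \<Rightarrow> ('o, 'm) kmor \<Rightarrow> ('o, 'm) kmor \<Rightarrow> ('o, 'm) kmor \<Rightarrow> bool"
  where "standard_triangle A X Y Z a b c \<longleftrightarrow>
    bounded_cplx A X \<and> bounded_cplx A Y \<and> bounded_cplx A Z \<and>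
    (\<exists>f \<iota> \<pi>. chain_map A X Y f \<and> mapping_cone A X Y f Z \<iota> \<pi> \<and>
      a = hclass A X Y f \<and> b = hclass A Y Z \<iota> \<and> c = hclass A Z (cplx_shift A 1 X) \<pi>)"

text \<open>
  \<open>iso_triangle C s s' \<Delta>\<close> is the class of triangles in \<open>C\<close>, with suspension functor given by \<open>s\<close> on
  objects and \<open>s'\<close> on morphisms, that are isomorphic to a triangle of the class \<open>\<Delta>\<close>.
\<close>

definition iso_triangle ::
    "('o, 'm, 'k, 'z) lincat_scheme \<Rightarrow> ('o \<Rightarrow> 'o) \<Rightarrow> ('m \<Rightarrow> 'm)
      \<Rightarrow> ('o \<Rightarrow> 'o \<Rightarrow> 'o \<Rightarrow> 'm \<Rightarrow> 'm \<Rightarrow> 'm \<Rightarrow> bool) \<Rightarrow> 'o \<Rightarrow> 'o \<Rightarrow> 'o \<Rightarrow> 'm \<Rightarrow> 'm \<Rightarrow> 'm \<Rightarrow> bool"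
  where "iso_triangle C s s' \<Delta> X Y Z f g h \<longleftrightarrow>
    X \<in> Ob C \<and> Y \<in> Ob C \<and> Z \<in> Ob C \<and>
    f \<in> Hom C X Y \<and> g \<in> Hom C Y Z \<and> h \<in> Hom C Z (s X) \<and>
    (\<exists>X' Y' Z' f' g' h' a b c. \<Delta> X' Y' Z' f' g' h' \<and>
      is_iso C X X' a \<and> is_iso C Y Y' b \<and> is_iso C Z Z' c \<and>
      b \<cdot>\<^bsub>C\<^esub> f = f' \<cdot>\<^bsub>C\<^esub> a \<and> c \<cdot>\<^bsub>C\<^esub> g = g' \<cdot>\<^bsub>C\<^esub> b \<and> s' a \<cdot>\<^bsub>C\<^esub> h = h' \<cdot>\<^bsub>C\<^esub> c)"

definition Kb :: "('o, 'm, 'k::field, 'z) lincat_scheme \<Rightarrow> (('o, 'm) cplx, ('o, 'm) kmor, 'k) tricat"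
  where "Kb A = lincat.extend (Kb_lin A)
    (tricat.fields (cplx_shift A) (kmor_shift A)
      (iso_triangle (Kb_lin A) (cplx_shift A 1) (kmor_shift A 1) (standard_triangle A)))"


section \<open>The bounded derived category\<close>

text \<open>
  \<open>cohomology A X i N j H p\<close>: \<open>j : N \<rightarrow> X\<^sup>i\<close> is a kernel of \<open>d\<^sup>i\<close> and \<open>p : N \<rightarrow> H\<close> is a cokernel of the
  map \<open>X\<^sup>i\<^sup>-\<^sup>1 \<rightarrow> N\<close> induced by \<open>d\<^sup>i\<^sup>-\<^sup>1\<close>, so that \<open>H\<close> is \<open>H\<^sup>i(X)\<close>.
\<close>

definition cohomology ::
    "('o, 'm, 'k, 'z) lincat_scheme \<Rightarrow> ('o, 'm) cplx \<Rightarrow> int \<Rightarrow> 'o \<Rightarrow> 'm \<Rightarrow> 'o \<Rightarrow> 'm \<Rightarrow> bool"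
  where "cohomology A X i N j H p \<longleftrightarrow>
    is_kernel A (cob X i) (cob X (i + 1)) (cdiff X i) N j \<and>
    (\<exists>b. b \<in> Hom A (cob X (i - 1)) N \<and> j \<cdot>\<^bsub>A\<^esub> b = cdiff X (i - 1) \<and>
      is_cokernel A (cob X (i - 1)) N b H p)"

text \<open>
  The map \<open>h\<close> below is \<open>H\<^sup>i(f)\<close>, for any choice of the cohomology objects; in an abelian category
  these data exist, and \<open>z\<close> and \<open>h\<close> are determined by \<open>f\<close>.
\<close>

definition quasi_iso_map ::
    "('o, 'm, 'k, 'z) lincat_scheme \<Rightarrow> ('o, 'm) cplx \<Rightarrow> ('o, 'm) cplx \<Rightarrow> (int \<Rightarrow> 'm) \<Rightarrow> bool"
  where "quasi_iso_map A X Y f \<longleftrightarrow> chain_map A X Y f \<and>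
    (\<forall>i N j H p N' j' H' p' z h.
      cohomology A X i N j H p \<and> cohomology A Y i N' j' H' p' \<and>
      z \<in> Hom A N N' \<and> j' \<cdot>\<^bsub>A\<^esub> z = f i \<cdot>\<^bsub>A\<^esub> j \<and>
      h \<in> Hom A H H' \<and> h \<cdot>\<^bsub>A\<^esub> p = p' \<cdot>\<^bsub>A\<^esub> z \<longrightarrow> is_iso A H H' h)"

definition quasi_isos :: "('o, 'm, 'k, 'z) lincat_scheme \<Rightarrow> ('o, 'm) kmor set"
  where "quasi_isos A = {hclass A X Y f | X Y f.
    bounded_cplx A X \<and> bounded_cplx A Y \<and> quasi_iso_map A X Y f}"

text \<open>
  Localization of \<open>K\<close> at a class \<open>W\<close> of morphisms admitting a calculus of right fractions.
  A roof \<open>(Z, s, f)\<close> from \<open>X\<close> to \<open>Y\<close> consists of \<open>s : Z \<rightarrow> X\<close> in \<open>W\<close> and \<open>f : Z \<rightarrow> Y\<close>, and represents the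
  fraction \<open>f s\<^sup>-\<^sup>1\<close>.  A morphism of the localization is an equivalence class of roofs, together with
  its source and target.  The definite descriptions are well defined by the calculus of fractions.
\<close>

type_synonym ('o, 'm) lmor = "'o \<times> ('o \<times> 'm \<times> 'm) set \<times> 'o"

definition roofs :: "('o, 'm, 'k, 'z) lincat_scheme \<Rightarrow> 'm set \<Rightarrow> 'o \<Rightarrow> 'o \<Rightarrow> ('o \<times> 'm \<times> 'm) set"
  where "roofs K W X Y = {(Z, s, f). Z \<in> Ob K \<and> s \<in> Hom K Z X \<inter> W \<and> f \<in> Hom K Z Y}"

definition roof_equiv ::
    "('o, 'm, 'k, 'z) lincat_scheme \<Rightarrow> 'm set \<Rightarrow> 'o \<times> 'm \<times> 'm \<Rightarrow> 'o \<times> 'm \<times> 'm \<Rightarrow> bool"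
  where "roof_equiv K W r r' \<longleftrightarrow> (case (r, r') of ((Z, s, f), (Z', s', f')) \<Rightarrow>
    (\<exists>U \<in> Ob K. \<exists>u \<in> Hom K U Z. \<exists>u' \<in> Hom K U Z'.
      s \<cdot>\<^bsub>K\<^esub> u \<in> W \<and> s \<cdot>\<^bsub>K\<^esub> u = s' \<cdot>\<^bsub>K\<^esub> u' \<and> f \<cdot>\<^bsub>K\<^esub> u = f' \<cdot>\<^bsub>K\<^esub> u'))"

definition roof_class ::
    "('o, 'm, 'k, 'z) lincat_scheme \<Rightarrow> 'm set \<Rightarrow> 'o \<Rightarrow> 'o \<Rightarrow> 'o \<times> 'm \<times> 'm \<Rightarrow> ('o, 'm) lmor"
  where "roof_class K W X Y r = (X, {r' \<in> roofs K W X Y. roof_equiv K W r r'}, Y)"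

definition loc_comp ::
    "('o, 'm, 'k, 'z) lincat_scheme \<Rightarrow> 'm set \<Rightarrow> ('o, 'm) lmor \<Rightarrow> ('o, 'm) lmor \<Rightarrow> ('o, 'm) lmor"
  where "loc_comp K W b a = (THE c.
    \<exists>Z s f Z' s' f'. (Z, s, f) \<in> fst (snd a) \<and> (Z', s', f') \<in> fst (snd b) \<and>
      (\<exists>U \<in> Ob K. \<exists>u \<in> Hom K U Z \<inter> W. \<exists>v \<in> Hom K U Z'. f \<cdot>\<^bsub>K\<^esub> u = s' \<cdot>\<^bsub>K\<^esub> v \<and>
        c = roof_class K W (fst a) (snd (snd b)) (U, s \<cdot>\<^bsub>K\<^esub> u, f' \<cdot>\<^bsub>K\<^esub> v)))"

definition loc_plus ::
    "('o, 'm, 'k, 'z) lincat_scheme \<Rightarrow> 'm set \<Rightarrow> ('o, 'm) lmor \<Rightarrow> ('o, 'm) lmor \<Rightarrow> ('o, 'm) lmor"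
  where "loc_plus K W a b = (THE c.
    \<exists>Z s f Z' s' f'. (Z, s, f) \<in> fst (snd a) \<and> (Z', s', f') \<in> fst (snd b) \<and>
      (\<exists>U \<in> Ob K. \<exists>u \<in> Hom K U Z. \<exists>u' \<in> Hom K U Z'.
        s \<cdot>\<^bsub>K\<^esub> u \<in> W \<and> s \<cdot>\<^bsub>K\<^esub> u = s' \<cdot>\<^bsub>K\<^esub> u' \<and>
        c = roof_class K W (fst a) (snd (snd a)) (U, s \<cdot>\<^bsub>K\<^esub> u, (f \<cdot>\<^bsub>K\<^esub> u) \<oplus>\<^bsub>K\<^esub> (f' \<cdot>\<^bsub>K\<^esub> u'))))"

definition loc_scale ::
    "('o, 'm, 'k, 'z) lincat_scheme \<Rightarrow> 'm set \<Rightarrow> 'k \<Rightarrow> ('o, 'm) lmor \<Rightarrow> ('o, 'm) lmor"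
  where "loc_scale K W c a = (THE b.
    \<exists>Z s f. (Z, s, f) \<in> fst (snd a) \<and>
      b = roof_class K W (fst a) (snd (snd a)) (Z, s, Scale K c f))"

definition localization ::
    "('o, 'm, 'k, 'z) lincat_scheme \<Rightarrow> 'm set \<Rightarrow> ('o, ('o, 'm) lmor, 'k) lincat"
  where "localization K W = \<lparr>
    Ob = Ob K,
    Hom = (\<lambda>X Y. roof_class K W X Y ` roofs K W X Y),
    Id = (\<lambda>X. roof_class K W X X (X, Id K X, Id K X)),
    Comp = loc_comp K W,
    Zero = (\<lambda>X Y. roof_class K W X Y (X, Id K X, Zero K X Y)),
    Plus = loc_plus K W,
    Scale = loc_scale K W \<rparr>"

text \<open>The image in the localization of a morphism \<open>f : X \<rightarrow> Y\<close> of \<open>K\<close>.\<close>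

definition loc_mor :: "('o, 'm, 'k, 'z) lincat_scheme \<Rightarrow> 'm set \<Rightarrow> 'o \<Rightarrow> 'o \<Rightarrow> 'm \<Rightarrow> ('o, 'm) lmor"
  where "loc_mor K W X Y f = roof_class K W X Y (X, Id K X, f)"

type_synonym ('o, 'm) dmor = "(('o, 'm) cplx, ('o, 'm) kmor) lmor"

definition Qloc :: "('o, 'm, 'k::field, 'z) lincat_scheme \<Rightarrow> ('o, 'm) kmor \<Rightarrow> ('o, 'm) dmor"
  where "Qloc A a = loc_mor (Kb A) (quasi_isos A) (fst a) (snd (snd a)) a"

definition dmor_shift :: "('o, 'm, 'k::field, 'z) lincat_scheme \<Rightarrow> int \<Rightarrow> ('o, 'm) dmor \<Rightarrow> ('o, 'm) dmor"
  where "dmor_shift A n a =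
    (cplx_shift A n (fst a),
     (\<lambda>(Z, s, f). (cplx_shift A n Z, kmor_shift A n s, kmor_shift A n f)) ` fst (snd a),
     cplx_shift A n (snd (snd a)))"

definition Db_lin ::
    "('o, 'm, 'k::field, 'z) lincat_scheme \<Rightarrow> (('o, 'm) cplx, ('o, 'm) dmor, 'k) lincat"
  where "Db_lin A = localization (Kb A) (quasi_isos A)"

definition Db :: "('o, 'm, 'k::field, 'z) lincat_scheme \<Rightarrow> (('o, 'm) cplx, ('o, 'm) dmor, 'k) tricat"
  where "Db A = lincat.extend (Db_lin A)
    (tricat.fields (cplx_shift A) (dmor_shift A)
      (iso_triangle (Db_lin A) (cplx_shift A 1) (dmor_shift A 1)
        (\<lambda>X Y Z f g h. \<exists>f' g' h'. Tri (Kb A) X Y Z f' g' h' \<and> f = Qloc A f' \<and> g = Qloc A g' \<and> h = Qloc A h')))"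

text \<open>
  The fully faithful functor from \<open>KbProj A\<close> to \<open>Db A\<close> is the identity on objects and \<open>Qloc A\<close> on
  morphisms.
\<close>

definition KbProj :: "('o, 'm, 'k::field, 'z) lincat_scheme \<Rightarrow> (('o, 'm) cplx, ('o, 'm) kmor, 'k) tricat"
  where "KbProj A = Kb (Proj A)"


section \<open>Corresponding structures and right pseudo-adjoints\<close>

definition hom_orthogonal_to ::
    "('o, 'm, 'k::field, 'z) lincat_scheme \<Rightarrow> ('o, 'm) cplx set \<Rightarrow> ('o, 'm) cplx set"
  where "hom_orthogonal_to A S =
    {X \<in> Ob (KbProj A). \<forall>Y \<in> S. Hom (Db A) X Y = {Zero (Db A) X Y}}"

definition corresponding_weight_structure ::
    "('o, 'm, 'k::field, 'z) lincat_scheme \<Rightarrow> ('o, 'm) cplx halves \<Rightarrow> ('o, 'm) cplx halves"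
  where "corresponding_weight_structure A t =
    \<lparr>le_part = hom_orthogonal_to A (t_gt0 (Db A) t),
     ge_part = hom_orthogonal_to A (t_lt0 (Db A) t)\<rparr>"

text \<open>
  \<open>\<phi> X Y\<close> is the isomorphism from \<open>Hom(F X, Y)\<close> to \<open>Hom(X, G Y)\<close>, for \<open>X\<close> in \<open>KbProj B\<close> and \<open>Y\<close> in \<open>Db A\<close>.
\<close>

definition right_pseudo_adjoint ::
    "('o, 'm, 'k::field, 'y) lincat_scheme \<Rightarrow> ('p, 'n, 'k, 'z) lincat_scheme
      \<Rightarrow> (('p, 'n) cplx, ('p, 'n) kmor, ('o, 'm) cplx, ('o, 'm) kmor) catfun
      \<Rightarrow> (('o, 'm) cplx, ('o, 'm) dmor, ('p, 'n) cplx, ('p, 'n) dmor) catfun \<Rightarrow> bool"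
  where "right_pseudo_adjoint A B F G \<longleftrightarrow> (\<exists>\<phi>.
    (\<forall>X \<in> Ob (KbProj B). \<forall>Y \<in> Ob (Db A).
      bij_betw (\<phi> X Y) (Hom (Db A) (FOb F X) Y) (Hom (Db B) X (FOb G Y)) \<and>
      (\<forall>f \<in> Hom (Db A) (FOb F X) Y.
        (\<forall>g \<in> Hom (Db A) (FOb F X) Y. \<phi> X Y (f \<oplus>\<^bsub>Db A\<^esub> g) = \<phi> X Y f \<oplus>\<^bsub>Db B\<^esub> \<phi> X Y g) \<and>
        (\<forall>c. \<phi> X Y (Scale (Db A) c f) = Scale (Db B) c (\<phi> X Y f)) \<and>
        (\<forall>X' \<in> Ob (KbProj B). \<forall>a \<in> Hom (KbProj B) X' X.
          \<phi> X' Y (f \<cdot>\<^bsub>Db A\<^esub> Qloc A (FMor F a)) = \<phi> X Y f \<cdot>\<^bsub>Db B\<^esub> Qloc B a) \<and>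
        (\<forall>Y' \<in> Ob (Db A). \<forall>b \<in> Hom (Db A) Y Y'.
          \<phi> X Y' (b \<cdot>\<^bsub>Db A\<^esub> f) = FMor G b \<cdot>\<^bsub>Db B\<^esub> \<phi> X Y f))))"

end

theory Submission
  imports Defs
begin

text \<open>
  Write \<open>\<C>\<close> for \<open>KbProj A\<close>.  Pseudo-adjunction turns \<open>Hom(F X, Y) = 0\<close> into \<open>Hom(X, G Y) = 0\<close>, so
  everything follows once \<open>t\<close> and \<open>w\<close> determine each other through vanishing of \<open>Hom\<close>.  The weight
  structure is defined in this way.  Conversely, let \<open>Hom(\<C>\<^sub>w\<^sub>\<ge>\<^sub>0[-1], Y) = 0\<close> and let
  \<open>L \<rightarrow> Y \<rightarrow> R\<close> be the truncation triangle of \<open>Y\<close> for \<open>t\<close>.  Then \<open>Hom(\<C>\<^sub>w\<^sub>\<ge>\<^sub>0[-1], R) = 0\<close> because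
  \<open>\<C>\<^sub>w\<^sub>\<ge>\<^sub>0[-1]\<close> is left orthogonal to \<open>Y\<close> and to \<open>L[1]\<close>, and \<open>Hom(\<C>\<^sub>w\<^sub>\<le>\<^sub>0, R) = 0\<close> because \<open>R\<close> lies
  in the positive part of \<open>t\<close>.  By the weight decompositions \<open>R\<close> receives no maps from any bounded
  complex of projectives, hence it is acyclic and \<open>Y \<cong> L\<close>.  The argument for the coaisle is dual.
\<close>

section \<open>Embedding a linear category into a ring\<close>

text \<open>The categories are concrete: a morphism of \<open>Kb\<close> is a homotopy class, one of
  \<open>Db\<close> a class of roofs, and a triangle is isomorphic to one built from a mapping cone.
  So every vanishing of Hom is pushed down to chain maps. A roof out of a bounded complex P of
  projectives can be straightened, hence Hom(P, Y) = 0 in \<open>Db\<close> says that every chain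
  map from P to Y is null-homotopic (\<open>no_maps\<close>). The exact sequences of a triangle
  become explicit homotopies on a cone, and the objects of a triangle in \<open>Db\<close> matter
  only up to a roof of two quasi-isomorphisms (\<open>dequiv\<close>). That every isomorphism of
  \<open>Db\<close> is such a roof is a saturation statement and rests on the calculus of fractions.
  Quasi-isomorphisms are tested on maps from projectives, so that diagram chases become computations
  with elements; having enough projectives makes the test agree with cohomology. The dual argument
  involves a shift: Y[-1] is truncated instead of Y, its part L in the aisle turns out acyclic, and
  so Y[-1] is positive.\<close>

text \<open>
  A linear category is embedded into a ring of a fixed type, so that identities between composable
  morphisms become ring identities without typing side conditions.  The ring consists of the
  endomorphisms of the product of all abelian groups carried by subsets of \<open>'m\<close>; a morphism acts by
  composition on the factors that are its \<open>Hom\<close> groups.  The indices \<open>T\<close> and \<open>Y\<close> tag a factor as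
  \<open>Hom(T, Y)\<close>.
\<close>

definition ab_group_on :: "'m set \<Rightarrow> ('m \<Rightarrow> 'm \<Rightarrow> 'm) \<Rightarrow> 'm \<Rightarrow> bool"
  where "ab_group_on S pl z \<longleftrightarrow> z \<in> S \<and>
    (\<forall>x\<in>S. \<forall>y\<in>S. pl x y \<in> S \<and> pl x y = pl y x) \<and>
    (\<forall>x\<in>S. \<forall>y\<in>S. \<forall>w\<in>S. pl (pl x y) w = pl x (pl y w)) \<and>
    (\<forall>x\<in>S. pl z x = x \<and> (\<exists>y\<in>S. pl y x = z))"

type_synonym ('o, 'm) group_index = "'o \<times> 'o \<times> 'm set \<times> ('m \<Rightarrow> 'm \<Rightarrow> 'm) \<times> 'm"

text \<open>A HOL type cannot depend on the category \<open>C\<close>, hence the product over every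
  group structure at once. An index that describes no group contributes the one-point factor holding
  \<open>z\<close>.\<close>

typedef ('o, 'm) group_family =
  "{x :: ('o, 'm) group_index \<Rightarrow> 'm. \<forall>T Y S pl z.
     (if ab_group_on S pl z then x (T, Y, S, pl, z) \<in> S else x (T, Y, S, pl, z) = z)}"
proof -
  have "(\<lambda>(T, Y, S, pl, z). z) \<in> {x :: ('o, 'm) group_index \<Rightarrow> 'm. \<forall>T Y S pl z.
     (if ab_group_on S pl z then x (T, Y, S, pl, z) \<in> S else x (T, Y, S, pl, z) = z)}"
    by (auto simp: ab_group_on_def)
  then show ?thesis by blast
qed

setup_lifting type_definition_group_family

lemma ab_group_on_neg:
  assumes "ab_group_on S pl z" "x \<in> S"
  shows "(SOME y. y \<in> S \<and> pl y x = z) \<in> S" "pl (SOME y. y \<in> S \<and> pl y x = z) x = z"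
proof -
  have "\<exists>y. y \<in> S \<and> pl y x = z" using assms by (auto simp: ab_group_on_def)
  from someI_ex[OF this]
  show "(SOME y. y \<in> S \<and> pl y x = z) \<in> S" "pl (SOME y. y \<in> S \<and> pl y x = z) x = z" by auto
qed

lemma family_eqI:
  assumes "\<And>T Y S pl z. Rep_group_family x (T, Y, S, pl, z) = Rep_group_family y (T, Y, S, pl, z)"
  shows "x = y"
  using assms by (metis Rep_group_family_inject prod_cases5 ext)

lemma Rep_family:
  "ab_group_on S pl z \<Longrightarrow> Rep_group_family x (T, Y, S, pl, z) \<in> S"
  "\<not> ab_group_on S pl z \<Longrightarrow> Rep_group_family x (T, Y, S, pl, z) = z"
  using Rep_group_family[of x] unfolding mem_Collect_eq by presburger+

instantiation group_family :: (type, type) ab_group_add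
begin

lift_definition zero_group_family :: "('a, 'b) group_family"
  is "\<lambda>(T, Y, S, pl, z). z"
  by (auto simp: ab_group_on_def)

lift_definition plus_group_family ::
    "('a, 'b) group_family \<Rightarrow> ('a, 'b) group_family \<Rightarrow> ('a, 'b) group_family"
  is "\<lambda>x y (T, Y, S, pl, z).
    if ab_group_on S pl z then pl (x (T, Y, S, pl, z)) (y (T, Y, S, pl, z)) else z"
  by (simp add: ab_group_on_def)

lift_definition uminus_group_family :: "('a, 'b) group_family \<Rightarrow> ('a, 'b) group_family"
  is "\<lambda>x (T, Y, S, pl, z).
    if ab_group_on S pl z then SOME y. y \<in> S \<and> pl y (x (T, Y, S, pl, z)) = z else z"
  by (clarsimp, rule ab_group_on_neg(1), assumption) presburger

definition minus_group_family ::
    "('a, 'b) group_family \<Rightarrow> ('a, 'b) group_family \<Rightarrow> ('a, 'b) group_family"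
  where "minus_group_family x y = x + - y"

instance
proof
  fix a b c :: "('a, 'b) group_family"
  show "a + b + c = a + (b + c)"
    by (rule family_eqI) (auto simp: plus_group_family.rep_eq ab_group_on_def Rep_family)
  show "a + b = b + a"
    by (rule family_eqI) (auto simp: plus_group_family.rep_eq ab_group_on_def Rep_family)
  show "0 + a = a"
    by (rule family_eqI)
      (auto simp: plus_group_family.rep_eq zero_group_family.rep_eq ab_group_on_def Rep_family)
  show "- a + a = 0"
  proof (rule family_eqI)
    fix T Y S pl z
    show "Rep_group_family (- a + a) (T, Y, S, pl, z) = Rep_group_family 0 (T, Y, S, pl, z)"
    proof (cases "ab_group_on S pl z")
      case True
      then show ?thesis
        using ab_group_on_neg(2)[OF True Rep_family(1)[OF True]]
        by (simp add: plus_group_family.rep_eq zero_group_family.rep_eq uminus_group_family.rep_eq)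
    next
      case False
      then show ?thesis by (simp add: Rep_family)
    qed
  qed
  show "a - b = a + - b" by (simp add: minus_group_family_def)
qed

end

typedef (overloaded) 'a endomorphism = "{h :: 'a::ab_group_add \<Rightarrow> 'a. \<forall>x y. h (x + y) = h x + h y}"
  by (rule exI[of _ "\<lambda>x. x"]) simp

setup_lifting type_definition_endomorphism

instantiation endomorphism :: (ab_group_add) ring
begin

lift_definition zero_endomorphism :: "'a endomorphism" is "\<lambda>x. 0" by simp
lift_definition plus_endomorphism :: "'a endomorphism \<Rightarrow> 'a endomorphism \<Rightarrow> 'a endomorphism"
  is "\<lambda>g h x. g x + h x" by (simp add: algebra_simps)
lift_definition minus_endomorphism :: "'a endomorphism \<Rightarrow> 'a endomorphism \<Rightarrow> 'a endomorphism"
  is "\<lambda>g h x. g x - h x" by (simp add: algebra_simps)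
lift_definition uminus_endomorphism :: "'a endomorphism \<Rightarrow> 'a endomorphism"
  is "\<lambda>h x. - h x" by (simp add: algebra_simps)
lift_definition times_endomorphism :: "'a endomorphism \<Rightarrow> 'a endomorphism \<Rightarrow> 'a endomorphism"
  is "\<lambda>g h x. g (h x)" by simp

instance
  by standard (transfer; simp add: algebra_simps)+

end

context linear_category
begin

text \<open>\<open>op\<close> receives a bare morphism; by \<open>Hom_disjoint\<close> its end
  points can be recovered from it, so that the action depends on the morphism alone.\<close>

definition src_tgt :: "'m \<Rightarrow> 'o \<times> 'o"
  where "src_tgt f = (SOME (X, Y). X \<in> Ob C \<and> Y \<in> Ob C \<and> f \<in> Hom C X Y)"

lemma src_tgt: "\<lbrakk>X \<in> Ob C; Y \<in> Ob C; f \<in> Hom C X Y\<rbrakk> \<Longrightarrow> src_tgt f = (X, Y)"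
  unfolding src_tgt_def by (rule some_equality) (auto dest: Hom_disjoint)

lemma Zero_Plus: "\<lbrakk>X \<in> Ob C; Y \<in> Ob C; f \<in> Hom C X Y\<rbrakk> \<Longrightarrow> Zero C X Y \<oplus> f = f"
  by (metis Plus_Zero Plus_comm Zero_hom)

lemma ab_group_Hom:
  assumes [simp]: "X \<in> Ob C" "Y \<in> Ob C"
  shows "ab_group_on (Hom C X Y) (Plus C) (Zero C X Y)"
  unfolding ab_group_on_def
proof (intro conjI ballI)
  fix x assume x: "x \<in> Hom C X Y"
  show "Zero C X Y \<oplus> x = x" using x by (simp add: Zero_Plus)
  show "\<exists>y\<in>Hom C X Y. y \<oplus> x = Zero C X Y" by (metis Plus_inverse Plus_comm assms x)
qed (auto intro: Zero_hom Plus_hom Plus_assoc[of X Y] Plus_comm[of X Y])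

lemma Comp_Zero:
  assumes "X \<in> Ob C" "Y \<in> Ob C" "Z \<in> Ob C" "g \<in> Hom C Y Z"
  shows "g \<cdot> Zero C X Y = Zero C X Z"
proof -
  let ?z = "g \<cdot> Zero C X Y"
  have z: "Zero C X Y \<in> Hom C X Y" "?z \<in> Hom C X Z"
    using assms Comp_hom[of X Y Z] Zero_hom[of X Y] by blast+
  then have d: "?z \<oplus> ?z = ?z"
    using Comp_Plus_right[of X Y Z "Zero C X Y" "Zero C X Y" g] Plus_Zero[of X Y "Zero C X Y"] assms
    by simp
  obtain n where n: "n \<in> Hom C X Z" "?z \<oplus> n = Zero C X Z"
    using Plus_inverse[of X Z ?z] assms z by auto
  have "?z = ?z \<oplus> (?z \<oplus> n)" using n z assms Plus_Zero by simp
  also have "\<dots> = (?z \<oplus> ?z) \<oplus> n" using n z assms Plus_assoc[of X Z] by simp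
  also have "\<dots> = Zero C X Z" using d n by simp
  finally show ?thesis .
qed

text \<open>The covariant Yoneda action as a matrix with a single block: the factor Hom(T, Y) of the
  image reads the factor Hom(T, X) of the argument, and all other factors become zero. Hence
  \<open>op (Id C X)\<close> is a block projection and in general not a unit of the ring.\<close>

definition post_comp :: "'m \<Rightarrow> ('o, 'm) group_index \<Rightarrow> ('o, 'm) group_family \<Rightarrow> 'm"
  where "post_comp f i x = (case i of (T, Y, S, pl, z) \<Rightarrow>
    if T \<in> Ob C \<and> src_tgt f = (fst (src_tgt f), Y) \<and> S = Hom C T Y \<and> pl = Plus C \<and> z = Zero C T Y
    then f \<cdot> Rep_group_family x
      (T, fst (src_tgt f), Hom C T (fst (src_tgt f)), Plus C, Zero C T (fst (src_tgt f)))
    else z)"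

definition op :: "'m \<Rightarrow> ('o, 'm) group_family endomorphism"
  where "op f = Abs_endomorphism (\<lambda>x. Abs_group_family (\<lambda>i. post_comp f i x))"

lemma Rep_op:
  assumes XY: "X \<in> Ob C" "Y \<in> Ob C" and f: "f \<in> Hom C X Y"
  shows "Rep_group_family (Rep_endomorphism (op f) x) (T, Y', S, pl, z) =
    (if T \<in> Ob C \<and> Y' = Y \<and> S = Hom C T Y \<and> pl = Plus C \<and> z = Zero C T Y
     then f \<cdot> Rep_group_family x (T, X, Hom C T X, Plus C, Zero C T X) else z)"
proof -
  note st = src_tgt[OF XY f]
  have pc: "post_comp f (T, Y', S, pl, z) x =
    (if T \<in> Ob C \<and> Y' = Y \<and> S = Hom C T Y \<and> pl = Plus C \<and> z = Zero C T Y
     then f \<cdot> Rep_group_family x (T, X, Hom C T X, Plus C, Zero C T X) else z)" for T Y' S pl z x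
    by (auto simp: post_comp_def st)
  have mem: "Rep_group_family x (T, X, Hom C T X, Plus C, Zero C T X) \<in> Hom C T X"
    if "T \<in> Ob C" for T x
    using Rep_family(1)[OF ab_group_Hom[OF that XY(1)]] .
  have R: "Rep_group_family (Abs_group_family (\<lambda>i. post_comp f i x)) = (\<lambda>i. post_comp f i x)" for x
    by (rule Abs_group_family_inverse)
      (auto simp: pc ab_group_Hom[OF _ XY(2)] Comp_hom[OF _ XY _ f] mem,
        auto simp: ab_group_on_def)
  have "Rep_endomorphism (op f) = (\<lambda>x. Abs_group_family (\<lambda>i. post_comp f i x))"
    unfolding op_def
  proof (rule Abs_endomorphism_inverse, clarsimp, rule family_eqI)
    fix x y T Y' S pl z
    show "Rep_group_family (Abs_group_family (\<lambda>i. post_comp f i (x + y))) (T, Y', S, pl, z) =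
      Rep_group_family (Abs_group_family (\<lambda>i. post_comp f i x) + Abs_group_family (\<lambda>i. post_comp f i y))
        (T, Y', S, pl, z)"
      using ab_group_Hom[OF _ XY(1), of T] ab_group_Hom[OF _ XY(2), of T] XY f
      by (auto simp: R pc plus_group_family.rep_eq Comp_Plus_right[of T X Y] mem)
        (auto simp: ab_group_on_def)
  qed
  then show ?thesis by (simp add: R pc)
qed

lemma endomorphism_eqI:
  assumes "\<And>x T Y S pl z. Rep_group_family (Rep_endomorphism g x) (T, Y, S, pl, z) =
    Rep_group_family (Rep_endomorphism h x) (T, Y, S, pl, z)"
  shows "g = h"
  using assms by (metis Rep_endomorphism_inject family_eqI ext)

lemma Rep_Hom:
  "\<lbrakk>T \<in> Ob C; X \<in> Ob C\<rbrakk> \<Longrightarrow>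
    Rep_group_family x (T, X, Hom C T X, Plus C, Zero C T X) \<in> Hom C T X"
  using Rep_family(1)[OF ab_group_Hom] .

lemma op_Comp:
  assumes "X \<in> Ob C" "Y \<in> Ob C" "Z \<in> Ob C" "f \<in> Hom C X Y" "g \<in> Hom C Y Z"
  shows "op (g \<cdot> f) = op g * op f"
  by (rule endomorphism_eqI)
    (use assms Comp_hom[of X Y Z f g] in
      \<open>auto simp: times_endomorphism.rep_eq Rep_op[of X Z] Rep_op[of X Y] Rep_op[of Y Z]
        Comp_assoc[of _ X Y Z] Rep_Hom\<close>)

lemma Comp_Zero_left:
  assumes "X \<in> Ob C" "Y \<in> Ob C" "Z \<in> Ob C" "f \<in> Hom C X Y"
  shows "Zero C Y Z \<cdot> f = Zero C X Z"
proof -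
  let ?z = "Zero C Y Z \<cdot> f"
  have z: "Zero C Y Z \<in> Hom C Y Z" "?z \<in> Hom C X Z"
    using assms Comp_hom[of X Y Z] Zero_hom[of Y Z] by blast+
  then have d: "?z \<oplus> ?z = ?z"
    using Comp_Plus_left[of X Y Z f "Zero C Y Z" "Zero C Y Z"] Plus_Zero[of Y Z "Zero C Y Z"] assms
    by simp
  obtain n where n: "n \<in> Hom C X Z" "?z \<oplus> n = Zero C X Z"
    using Plus_inverse[of X Z ?z] assms z by auto
  have "?z = ?z \<oplus> (?z \<oplus> n)" using n z assms Plus_Zero by simp
  also have "\<dots> = (?z \<oplus> ?z) \<oplus> n" using n z assms Plus_assoc[of X Z] by simp
  also have "\<dots> = Zero C X Z" using d n by simp
  finally show ?thesis .
qed

lemma op_Plus: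
  assumes "X \<in> Ob C" "Y \<in> Ob C" "f \<in> Hom C X Y" "g \<in> Hom C X Y"
  shows "op (f \<oplus> g) = op f + op g"
proof (rule endomorphism_eqI)
  fix x and T Y' :: 'o and S pl and z :: 'm
  \<comment> \<open>Off the block of the two morphisms both summands contribute the neutral
    element.\<close>
  have "ab_group_on S pl z \<Longrightarrow> pl z z = z" by (auto simp: ab_group_on_def)
  then show "Rep_group_family (Rep_endomorphism (op (f \<oplus> g)) x) (T, Y', S, pl, z) =
    Rep_group_family (Rep_endomorphism (op f + op g) x) (T, Y', S, pl, z)"
    using assms Plus_hom[of X Y f g]
    by (auto simp: plus_endomorphism.rep_eq plus_group_family.rep_eq Rep_op[of X Y]
        Comp_Plus_left[of _ X Y] Rep_Hom ab_group_Hom)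
qed

lemma op_Zero:
  assumes "X \<in> Ob C" "Y \<in> Ob C"
  shows "op (Zero C X Y) = 0"
proof -
  have "Zero C X Y \<in> Hom C X Y" using assms by (rule Zero_hom)
  then have "op (Zero C X Y) + op (Zero C X Y) = op (Zero C X Y)"
    using op_Plus[of X Y "Zero C X Y" "Zero C X Y"] Plus_Zero[of X Y "Zero C X Y"] assms by simp
  then show ?thesis by simp
qed

lemma op_inj:
  assumes XY: "X \<in> Ob C" "Y \<in> Ob C" and f: "f \<in> Hom C X Y" and g: "g \<in> Hom C X Y"
    and eq: "op f = op g"
  shows "f = g"
proof -
  \<comment> \<open>Yoneda: the family with the identity in the factor Hom(X, X) and zero elsewhere.
    Its image under \<open>op h\<close> holds h in the factor Hom(X, Y).\<close>
  define x where "x = Abs_group_family (\<lambda>(T, Y, S, pl, z).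
    if (T, Y, S, pl, z) = (X, X, Hom C X X, Plus C, Zero C X X) then Id C X else z)"
  have "Rep_group_family x = (\<lambda>(T, Y, S, pl, z).
    if (T, Y, S, pl, z) = (X, X, Hom C X X, Plus C, Zero C X X) then Id C X else z)"
    unfolding x_def
    by (rule Abs_group_family_inverse)
      (auto simp: Id_hom XY ab_group_Hom, auto simp: ab_group_on_def)
  then have "Rep_group_family (Rep_endomorphism (op h) x) (X, Y, Hom C X Y, Plus C, Zero C X Y) = h"
    if "h \<in> Hom C X Y" for h
    using that XY by (simp add: Rep_op[OF XY] Comp_Id)
  with f g eq show ?thesis by metis
qed

lemma op_eq_iff:
  "\<lbrakk>X \<in> Ob C; Y \<in> Ob C; f \<in> Hom C X Y; g \<in> Hom C X Y\<rbrakk> \<Longrightarrow> op f = op g \<longleftrightarrow> f = g"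
  using op_inj by blast

text \<open>This identifies the scalar -1 in shifts and cones with the sign of the ring. It holds
  because (-1) f + f = 0 f, and 0 f vanishes as an additive idempotent.\<close>

lemma op_minus:
  assumes "X \<in> Ob C" "Y \<in> Ob C" "f \<in> Hom C X Y"
  shows "op (Scale C (-1) f) = - op f"
proof -
  have z: "Scale C 0 f = Zero C X Y"
  proof -
    have s: "Scale C 0 f \<in> Hom C X Y" using assms by (rule Scale_hom)
    have "Scale C 0 f \<oplus> Scale C 0 f = Scale C 0 f" using Scale_add[OF assms, of 0 0] by simp
    then have "op (Scale C 0 f) + op (Scale C 0 f) = op (Scale C 0 f)"
      using op_Plus[OF assms(1,2) s s] by simp
    then show ?thesis using op_inj[OF assms(1,2) s Zero_hom] assms op_Zero by simp
  qed
  have m: "Scale C (-1) f \<in> Hom C X Y" using assms by (rule Scale_hom)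
  have "Scale C (-1) f \<oplus> f = Zero C X Y"
    using Scale_add[OF assms, of "-1" 1] z Scale_one[OF assms] by simp
  then have "op (Scale C (-1) f) + op f = 0"
    using op_Plus[OF assms(1,2) m assms(3)] op_Zero assms by simp
  then show ?thesis by (simp add: eq_neg_iff_add_eq_0)
qed

end

section \<open>Complexes in a category embedded into a ring\<close>

text \<open>Attached with \<open>THEN\<close>, this turns an identity of maps into a rewrite rule
  that also fires inside right-nested products, as most chain computations below require.\<close>

lemma mult_assoc_eq: "a * b = c \<Longrightarrow> a * (b * u) = c * u" for u :: "'r::semigroup_mult"
  by (simp add: mult.assoc[symmetric])

text \<open>Most chain conditions are handled in degree i + 1; this brings an arbitrary degree into
  that form.\<close>

lemma int_plus1_cases: "(\<And>j. P (j + 1)) \<Longrightarrow> P i" for i :: int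
  by (metis diff_add_cancel)

text \<open>An additive category inside a ring that is not assumed unital: \<open>e X\<close> is the
  idempotent of X, and X is a zero object exactly when \<open>e X = 0\<close>. \<open>Pr\<close> is
  at this stage a class of test objects with a zero object among them; its projectivity enters when
  the tests are compared with cohomology.\<close>

locale ring_category =
  fixes Obj :: "'o set" and H :: "'o \<Rightarrow> 'o \<Rightarrow> 'r::ring set" and e :: "'o \<Rightarrow> 'r" and Pr :: "'o set"
  assumes H_Obj: "f \<in> H X Y \<Longrightarrow> X \<in> Obj \<and> Y \<in> Obj"
    and H_zero: "\<lbrakk>X \<in> Obj; Y \<in> Obj\<rbrakk> \<Longrightarrow> 0 \<in> H X Y"
    and H_add: "\<lbrakk>f \<in> H X Y; g \<in> H X Y\<rbrakk> \<Longrightarrow> f + g \<in> H X Y"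
    and H_uminus: "f \<in> H X Y \<Longrightarrow> - f \<in> H X Y"
    and H_mult: "\<lbrakk>f \<in> H X Y; g \<in> H Y Z\<rbrakk> \<Longrightarrow> g * f \<in> H X Z"
    and e_hom: "X \<in> Obj \<Longrightarrow> e X \<in> H X X"
    and e_left: "f \<in> H X Y \<Longrightarrow> e Y * f = f"
    and e_right: "f \<in> H X Y \<Longrightarrow> f * e X = f"
    and Pr_Obj: "P \<in> Pr \<Longrightarrow> P \<in> Obj"
    and zero_Pr: "\<exists>P\<in>Pr. e P = 0"
    and biproduct: "\<lbrakk>X \<in> Obj; Y \<in> Obj\<rbrakk> \<Longrightarrow> \<exists>S\<in>Obj. \<exists>i\<^sub>1\<in>H X S. \<exists>i\<^sub>2\<in>H Y S. \<exists>p\<^sub>1\<in>H S X. \<exists>p\<^sub>2\<in>H S Y.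
      p\<^sub>1 * i\<^sub>1 = e X \<and> p\<^sub>2 * i\<^sub>2 = e Y \<and> p\<^sub>1 * i\<^sub>2 = 0 \<and> p\<^sub>2 * i\<^sub>1 = 0 \<and> i\<^sub>1 * p\<^sub>1 + i\<^sub>2 * p\<^sub>2 = e S"
begin

lemma H_diff: "\<lbrakk>f \<in> H X Y; g \<in> H X Y\<rbrakk> \<Longrightarrow> f - g \<in> H X Y"
  using H_add[OF _ H_uminus] by fastforce

lemma e_zero_hom: "e X = 0 \<Longrightarrow> f \<in> H X Y \<Longrightarrow> f = 0" "e Y = 0 \<Longrightarrow> f \<in> H X Y \<Longrightarrow> f = 0"
  by (metis e_right mult_zero_right, metis e_left mult_zero_left)

definition cx :: "('o, 'r) cplx \<Rightarrow> bool"
  where "cx X \<longleftrightarrow>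
    (\<forall>i. cdiff X i \<in> H (cob X i) (cob X (i + 1)) \<and> cdiff X (i + 1) * cdiff X i = 0) \<and>
    (\<exists>N. \<forall>i. \<bar>i\<bar> > N \<longrightarrow> e (cob X i) = 0)"

definition cmap :: "('o, 'r) cplx \<Rightarrow> ('o, 'r) cplx \<Rightarrow> (int \<Rightarrow> 'r) \<Rightarrow> bool"
  where "cmap X Y f \<longleftrightarrow>
    (\<forall>i. f i \<in> H (cob X i) (cob Y i) \<and> cdiff Y i * f i = f (i + 1) * cdiff X i)"

text \<open>A homotopy is indexed as \<open>s\<^sup>i : X\<^sup>i\<^sup>+\<^sup>1 \<rightarrow> Y\<^sup>i\<close>, which avoids subtraction of indices.\<close>

definition htpy :: "('o, 'r) cplx \<Rightarrow> ('o, 'r) cplx \<Rightarrow> (int \<Rightarrow> 'r) \<Rightarrow> (int \<Rightarrow> 'r) \<Rightarrow> bool"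
  where "htpy X Y f g \<longleftrightarrow>
    (\<exists>s. \<forall>i. s i \<in> H (cob X (i + 1)) (cob Y i) \<and>
      f (i + 1) = g (i + 1) + (cdiff Y i * s i + s (i + 1) * cdiff X (i + 1)))"

definition no_maps :: "('o, 'r) cplx \<Rightarrow> ('o, 'r) cplx \<Rightarrow> bool"
  where "no_maps X Y \<longleftrightarrow> (\<forall>f. cmap X Y f \<longrightarrow> htpy X Y f (\<lambda>i. 0))"

text \<open>
  Cohomological conditions are tested on generalised elements, that is, on maps from the objects
  of \<open>Pr\<close>, which will be the projectives; \<open>hinj\<close> and \<open>hsurj\<close> are injectivity and surjectivity on
  cohomology.
\<close>

definition acyclic :: "('o, 'r) cplx \<Rightarrow> bool"
  where "acyclic X \<longleftrightarrow> (\<forall>P\<in>Pr. \<forall>i. \<forall>x\<in>H P (cob X (i + 1)).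
    cdiff X (i + 1) * x = 0 \<longrightarrow> (\<exists>y\<in>H P (cob X i). x = cdiff X i * y))"

definition hinj :: "('o, 'r) cplx \<Rightarrow> ('o, 'r) cplx \<Rightarrow> (int \<Rightarrow> 'r) \<Rightarrow> bool"
  where "hinj X Y f \<longleftrightarrow> (\<forall>P\<in>Pr. \<forall>i. \<forall>x\<in>H P (cob X (i + 1)). \<forall>y\<in>H P (cob Y i).
    cdiff X (i + 1) * x = 0 \<longrightarrow> f (i + 1) * x = cdiff Y i * y \<longrightarrow>
    (\<exists>z\<in>H P (cob X i). x = cdiff X i * z))"

definition hsurj :: "('o, 'r) cplx \<Rightarrow> ('o, 'r) cplx \<Rightarrow> (int \<Rightarrow> 'r) \<Rightarrow> bool"
  where "hsurj X Y f \<longleftrightarrow> (\<forall>P\<in>Pr. \<forall>i. \<forall>y\<in>H P (cob Y (i + 1)). cdiff Y (i + 1) * y = 0 \<longrightarrow>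
    (\<exists>x\<in>H P (cob X (i + 1)). \<exists>z\<in>H P (cob Y i).
      cdiff X (i + 1) * x = 0 \<and> y = f (i + 1) * x + cdiff Y i * z))"

definition qis :: "('o, 'r) cplx \<Rightarrow> ('o, 'r) cplx \<Rightarrow> (int \<Rightarrow> 'r) \<Rightarrow> bool"
  where "qis X Y f \<longleftrightarrow> cmap X Y f \<and> hinj X Y f \<and> hsurj X Y f"

definition shift :: "int \<Rightarrow> ('o, 'r) cplx \<Rightarrow> ('o, 'r) cplx"
  where "shift n X =
    \<lparr>cob = (\<lambda>i. cob X (i + n)),
     cdiff = (\<lambda>i. if even n then cdiff X (i + n) else - cdiff X (i + n))\<rparr>"

lemma cxD:
  assumes "cx X"
  shows "cob X i \<in> Obj" "cdiff X i \<in> H (cob X i) (cob X (i + 1))"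
    "cdiff X (i + 1) * cdiff X i = 0"
  using assms H_Obj unfolding cx_def by blast+

lemma cmapD:
  assumes "cmap X Y f"
  shows "f i \<in> H (cob X i) (cob Y i)" "cdiff Y i * f i = f (i + 1) * cdiff X i"
  using assms unfolding cmap_def by blast+

lemma cx_shift:
  assumes "cx X"
  shows "cx (shift n X)"
proof -
  obtain N where "\<forall>i. \<bar>i\<bar> > N \<longrightarrow> e (cob X i) = 0" using assms by (auto simp: cx_def)
  then have "\<forall>i. \<bar>i\<bar> > N + \<bar>n\<bar> \<longrightarrow> e (cob (shift n X) i) = 0" by (simp add: shift_def)
  then show ?thesis
    using cxD[OF assms] cxD(2,3)[OF assms, of "_ + n"]
    by (auto simp: cx_def shift_def H_uminus algebra_simps)
qed

lemma cmap_shift: "cmap X Y f \<Longrightarrow> cmap (shift n X) (shift n Y) (\<lambda>i. f (i + n))"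
  unfolding cmap_def shift_def by (simp add: add.commute add.left_commute)

lemma htpy_shift:
  assumes "htpy X Y f g"
  shows "htpy (shift n X) (shift n Y) (\<lambda>i. f (i + n)) (\<lambda>i. g (i + n))"
proof -
  obtain s where s: "\<And>i. s i \<in> H (cob X (i + 1)) (cob Y i)"
    "\<And>i. f (i + 1) = g (i + 1) + (cdiff Y i * s i + s (i + 1) * cdiff X (i + 1))"
    using assms unfolding htpy_def by blast
  have c: "i + 1 + n = i + n + 1" for i by simp
  show ?thesis
    unfolding htpy_def shift_def
    by (rule exI[of _ "\<lambda>i. if even n then s (i + n) else - s (i + n)"])
      (simp add: c s H_uminus)
qed

lemma shift_shift: "shift m (shift n X) = shift (m + n) X"
  by (cases "even m"; cases "even n"; simp add: shift_def add.assoc add.commute[of n])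

lemma shift_zero: "shift 0 X = X"
  by (simp add: shift_def)

lemma cmap_id: "cx X \<Longrightarrow> cmap X X (\<lambda>i. e (cob X i))"
  by (simp add: cmap_def e_hom cxD e_left[OF cxD(2)] e_right[OF cxD(2)])

lemma cmap_comp: "\<lbrakk>cmap X Y f; cmap Y Z g\<rbrakk> \<Longrightarrow> cmap X Z (\<lambda>i. g i * f i)"
  unfolding cmap_def by (metis H_mult mult.assoc)

lemma cmap_zero: "\<lbrakk>cx X; cx Y\<rbrakk> \<Longrightarrow> cmap X Y (\<lambda>i. 0)"
  by (simp add: cmap_def H_zero cxD)

lemma htpy_refl: "\<lbrakk>cx X; cx Y\<rbrakk> \<Longrightarrow> htpy X Y f f"
  unfolding htpy_def by (rule exI[of _ "\<lambda>i. 0"]) (simp add: H_zero cxD)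

lemma htpy_sym: "htpy X Y f g \<Longrightarrow> htpy X Y g f"
proof -
  assume "htpy X Y f g"
  then obtain s where s: "\<And>i. s i \<in> H (cob X (i + 1)) (cob Y i)"
    "\<And>i. f (i + 1) = g (i + 1) + (cdiff Y i * s i + s (i + 1) * cdiff X (i + 1))"
    unfolding htpy_def by blast
  then show ?thesis
    unfolding htpy_def by (intro exI[of _ "\<lambda>i. - s i"]) (simp add: H_uminus)
qed

lemma htpy_trans: "\<lbrakk>htpy X Y f g; htpy X Y g h\<rbrakk> \<Longrightarrow> htpy X Y f h"
proof -
  assume "htpy X Y f g" "htpy X Y g h"
  then obtain s t where s: "\<And>i. s i \<in> H (cob X (i + 1)) (cob Y i)"
    "\<And>i. f (i + 1) = g (i + 1) + (cdiff Y i * s i + s (i + 1) * cdiff X (i + 1))"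
    and t: "\<And>i. t i \<in> H (cob X (i + 1)) (cob Y i)"
    "\<And>i. g (i + 1) = h (i + 1) + (cdiff Y i * t i + t (i + 1) * cdiff X (i + 1))"
    unfolding htpy_def by blast
  then show ?thesis
    unfolding htpy_def by (intro exI[of _ "\<lambda>i. s i + t i"]) (simp add: H_add algebra_simps)
qed

lemma htpy_comp_left:
  assumes "htpy X Y f f'" "cmap Y Z g"
  shows "htpy X Z (\<lambda>i. g i * f i) (\<lambda>i. g i * f' i)"
proof -
  obtain s where s: "\<And>i. s i \<in> H (cob X (i + 1)) (cob Y i)"
    "\<And>i. f (i + 1) = f' (i + 1) + (cdiff Y i * s i + s (i + 1) * cdiff X (i + 1))"
    using assms(1) unfolding htpy_def by blast
  show ?thesis
    unfolding htpy_def
    by (rule exI[of _ "\<lambda>i. g i * s i"])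
      (simp add: s H_mult[OF s(1) cmapD(1)[OF assms(2)]] distrib_left
        cmapD(2)[OF assms(2), THEN mult_assoc_eq] mult.assoc)
qed

lemma htpy_comp_right:
  assumes "htpy Y Z g g'" "cmap X Y f"
  shows "htpy X Z (\<lambda>i. g i * f i) (\<lambda>i. g' i * f i)"
proof -
  obtain s where s: "\<And>i. s i \<in> H (cob Y (i + 1)) (cob Z i)"
    "\<And>i. g (i + 1) = g' (i + 1) + (cdiff Z i * s i + s (i + 1) * cdiff Y (i + 1))"
    using assms(1) unfolding htpy_def by blast
  show ?thesis
    unfolding htpy_def
    by (rule exI[of _ "\<lambda>i. s i * f (i + 1)"])
      (simp add: s H_mult[OF cmapD(1)[OF assms(2)] s(1)] distrib_right mult.assoc
        cmapD(2)[OF assms(2)])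
qed

lemma htpy_zero_diff:
  assumes "htpy X Y f g"
  shows "htpy X Y (\<lambda>i. f i - g i) (\<lambda>i. 0)"
proof -
  obtain s where "\<And>i. s i \<in> H (cob X (i + 1)) (cob Y i)"
    "\<And>i. f (i + 1) = g (i + 1) + (cdiff Y i * s i + s (i + 1) * cdiff X (i + 1))"
    using assms(1) unfolding htpy_def by blast
  then show ?thesis unfolding htpy_def by (intro exI[of _ s]) simp
qed

lemma htpy_of_diff:
  assumes "htpy X Y (\<lambda>i. f i - g i) (\<lambda>i. 0)"
  shows "htpy X Y f g"
proof -
  obtain s where s: "\<And>i. s i \<in> H (cob X (i + 1)) (cob Y i)"
    "\<And>i. f (i + 1) - g (i + 1) = 0 + (cdiff Y i * s i + s (i + 1) * cdiff X (i + 1))"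
    using assms(1) unfolding htpy_def by blast
  have "f (i + 1) = g (i + 1) + (cdiff Y i * s i + s (i + 1) * cdiff X (i + 1))" for i
    using s(2)[of i] by (simp add: algebra_simps)
  with s(1) show ?thesis unfolding htpy_def by blast
qed

lemma cmap_diff: "\<lbrakk>cmap X Y f; cmap X Y g\<rbrakk> \<Longrightarrow> cmap X Y (\<lambda>i. f i - g i)"
  unfolding cmap_def by (simp add: H_diff algebra_simps)

lemma no_maps_shift:
  assumes "no_maps X Y"
  shows "no_maps (shift n X) (shift n Y)"
  unfolding no_maps_def
proof (intro allI impI)
  fix f assume "cmap (shift n X) (shift n Y) f"
  from cmap_shift[OF this, of "- n"] have "cmap X Y (\<lambda>i. f (i + - n))"
    by (simp add: shift_shift shift_zero)
  then have "htpy X Y (\<lambda>i. f (i + - n)) (\<lambda>i. 0)" using assms by (simp add: no_maps_def)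
  from htpy_shift[OF this, of n] show "htpy (shift n X) (shift n Y) f (\<lambda>i. 0)" by simp
qed

lemma no_maps_shift_iff: "no_maps (shift n X) (shift n Y) \<longleftrightarrow> no_maps X Y"
  using no_maps_shift[of "shift n X" "shift n Y" "- n"] no_maps_shift
  by (auto simp: shift_shift shift_zero)

text \<open>f is homotopic to f v u, and f v is null because it starts at X'.\<close>

lemma no_maps_retract_source:
  assumes "cmap X X' u" "cmap X' X v" "htpy X X (\<lambda>i. v i * u i) (\<lambda>i. e (cob X i))" "no_maps X' Y"
  shows "no_maps X Y"
  unfolding no_maps_def
proof (intro allI impI)
  fix f assume f: "cmap X Y f"
  have "htpy X' Y (\<lambda>i. f i * v i) (\<lambda>i. 0)"
    using assms(4) cmap_comp[OF assms(2) f] by (simp add: no_maps_def)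
  from htpy_comp_right[OF this assms(1)]
  have 1: "htpy X Y (\<lambda>i. f i * v i * u i) (\<lambda>i. 0)" by simp
  from htpy_comp_left[OF assms(3) f]
  have "htpy X Y (\<lambda>i. f i * v i * u i) f"
    by (simp add: e_right[OF cmapD(1)[OF f]] mult.assoc)
  from htpy_trans[OF htpy_sym[OF this] 1] show "htpy X Y f (\<lambda>i. 0)" .
qed

text \<open>The contracting homotopy is built by descending induction, starting above the top degree
  of P. In each degree the part of f not yet accounted for is a cycle of C with source in
  \<open>Pr\<close>, so acyclicity supplies the next component.\<close>

lemma no_maps_into_acyclic:
  assumes P: "cx P" "\<And>i. cob P i \<in> Pr" and C: "cx C" "acyclic C"
  shows "no_maps P C"
  unfolding no_maps_def
proof (intro allI impI)
  fix f assume f: "cmap P C f"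
  obtain M where M: "\<And>i. i \<ge> M \<Longrightarrow> e (cob P i) = 0"
  proof -
    obtain N where "\<And>i. \<bar>i\<bar> > N \<Longrightarrow> e (cob P i) = 0" using P by (auto simp: cx_def)
    then show ?thesis by (intro that[of "\<bar>N\<bar> + 1"]) auto
  qed
  note [simp] = cxD[OF P(1)] cxD[OF C(1)] cmapD(1)[OF f]
  \<comment> \<open>Dependent choice sees one predecessor only, but the homotopy identity involves
    two neighbouring components. So stage n carries both, s in degree j = M - n first and s in
    degree j + 1 second.\<close>
  define good where "good n ab \<longleftrightarrow> (let j = M - int n in
    fst ab \<in> H (cob P (j + 1)) (cob C j) \<and> snd ab \<in> H (cob P (j + 1 + 1)) (cob C (j + 1)) \<and>
    f (j + 1) = cdiff C j * fst ab + snd ab * cdiff P (j + 1))" for n ab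
  have "\<exists>F. \<forall>n. good n (F n) \<and> snd (F (Suc n)) = fst (F n)"
  proof (rule dependent_nat_choice)
    have "f (M + 1) = 0" by (rule e_zero_hom(1)[OF M cmapD(1)[OF f]]) simp
    then show "\<exists>x. good 0 x"
      by (intro exI[of _ "(0, 0)"]) (simp add: good_def H_zero)
  next
    fix x n assume x: "good n x"
    define j where "j = M - int (Suc n)"
    have j: "M - int n = j + 1" by (simp add: j_def)
    obtain a b where ab: "x = (a, b)" by fastforce
    have a: "a \<in> H (cob P (j + 1 + 1)) (cob C (j + 1))"
      and b: "b \<in> H (cob P (j + 1 + 1 + 1)) (cob C (j + 1 + 1))"
      and eq: "f (j + 1 + 1) = cdiff C (j + 1) * a + b * cdiff P (j + 1 + 1)"
      using x unfolding good_def Let_def j ab by simp_all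
    \<comment> \<open>What the component a already chosen leaves of f in degree j + 1; the identity
      one degree higher makes it a cycle.\<close>
    let ?r = "f (j + 1) - a * cdiff P (j + 1)"
    have r: "?r \<in> H (cob P (j + 1)) (cob C (j + 1))"
      by (intro H_diff H_mult[OF _ a] cmapD(1)[OF f] cxD(2)[OF P(1)])
    have "cdiff C (j + 1) * ?r = 0"
    proof -
      have "cdiff C (j + 1) * a = f (j + 1 + 1) - b * cdiff P (j + 1 + 1)" using eq by simp
      then show ?thesis
        using cxD(3)[OF P(1), of "j + 1"]
        by (simp add: right_diff_distrib cmapD(2)[OF f] mult.assoc[symmetric])
          (simp add: left_diff_distrib mult.assoc)
    qed
    then obtain y where y: "y \<in> H (cob P (j + 1)) (cob C j)" "?r = cdiff C j * y"
      using C(2) P(2) r unfolding acyclic_def by blast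
    have "f (j + 1) = cdiff C j * y + a * cdiff P (j + 1)"
      using y(2) by (simp add: algebra_simps)
    then have "good (Suc n) (y, a)"
      using y(1) a unfolding good_def Let_def j_def[symmetric] by simp
    then show "\<exists>y. good (Suc n) y \<and> snd y = fst x" by (auto simp: ab)
  qed
  then obtain F where F: "\<And>n. good n (F n)" "\<And>n. snd (F (Suc n)) = fst (F n)" by blast
  define s where "s i = (if i \<le> M then fst (F (nat (M - i))) else 0)" for i
  show "htpy P C f (\<lambda>i. 0)"
    unfolding htpy_def
  proof (intro exI[of _ s] allI conjI)
    fix i
    show si: "s i \<in> H (cob P (i + 1)) (cob C i)"
      using F(1)[of "nat (M - i)"] by (auto simp: s_def good_def Let_def H_zero)
    show "f (i + 1) = 0 + (cdiff C i * s i + s (i + 1) * cdiff P (i + 1))"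
    proof (cases "i \<le> M")
      case True
      then have g: "snd (F (nat (M - i))) \<in> H (cob P (i + 1 + 1)) (cob C (i + 1))"
        "f (i + 1) = cdiff C i * s i + snd (F (nat (M - i))) * cdiff P (i + 1)"
        using F(1)[of "nat (M - i)"] by (auto simp: good_def Let_def s_def)
      \<comment> \<open>For i = M, dependent choice leaves the second component of
        \<open>F 0\<close> unspecified; it vanishes since its source lies above M.\<close>
      have "snd (F (nat (M - i))) = s (i + 1)"
      proof (cases "i = M")
        case True
        then show ?thesis using e_zero_hom(1)[OF M g(1)] by (simp add: s_def)
      next
        case False
        then have "nat (M - i) = Suc (nat (M - (i + 1)))" using \<open>i \<le> M\<close> by simp
        then show ?thesis using F(2) False \<open>i \<le> M\<close> by (simp add: s_def)
      qed
      with g show ?thesis by simp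
    next
      case False
      then have "f (i + 1) = 0" by (intro e_zero_hom(1)[OF M cmapD(1)[OF f]]) simp
      with False show ?thesis by (simp add: s_def)
    qed
  qed
qed

text \<open>A cycle with source P in degree i + 1 is a chain map from the complex with P in that
  degree alone, and a null homotopy of it contains the preimage. The zero object is taken in
  \<open>Pr\<close> so that this complex is an admissible test.\<close>

lemma acyclic_of_no_maps:
  assumes X: "cx X" and no: "\<And>P :: ('o, 'r) cplx. \<lbrakk>cx P; \<And>i. cob P i \<in> Pr\<rbrakk> \<Longrightarrow> no_maps P X"
  shows "acyclic X"
  unfolding acyclic_def
proof (intro ballI allI impI)
  fix P i x assume P: "P \<in> Pr" and x: "x \<in> H P (cob X (i + 1))" "cdiff X (i + 1) * x = 0"
  obtain Z where Z: "Z \<in> Pr" "e Z = 0" using zero_Pr by blast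
  define Q :: "('o, 'r) cplx" where "Q = \<lparr>cob = (\<lambda>j. if j = i + 1 then P else Z), cdiff = (\<lambda>j. 0)\<rparr>"
  have Q: "cx Q" "\<And>j. cob Q j \<in> Pr"
    using P Z by (auto simp: cx_def Q_def Pr_Obj H_zero intro!: exI[of _ "\<bar>i + 1\<bar>"])
  have "cmap Q X (\<lambda>j. if j = i + 1 then x else 0)"
    using x Z by (auto simp: cmap_def Q_def Pr_Obj cxD[OF X] H_zero)
  then have "htpy Q X (\<lambda>j. if j = i + 1 then x else 0) (\<lambda>j. 0)"
    using no[OF Q] by (simp add: no_maps_def)
  then obtain s where s: "\<And>j. s j \<in> H (cob Q (j + 1)) (cob X j) \<and>
      (if j + 1 = i + 1 then x else 0) = 0 + (cdiff X j * s j + s (j + 1) * cdiff Q (j + 1))"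
    unfolding htpy_def by blast
  from s[of i] show "\<exists>y\<in>H P (cob X i). x = cdiff X i * y" by (auto simp: Q_def)
qed

end

section \<open>Mapping cones and their exact sequences\<close>

locale ring_cone = ring_category +
  fixes X Y Z :: "('a, 'b) cplx" and f \<alpha> \<iota> \<pi> \<beta> :: "int \<Rightarrow> 'b"
  assumes cxX: "cx X" and cxY: "cx Y" and f: "cmap X Y f"
    and \<alpha>: "\<And>i. \<alpha> i \<in> H (cob X (i + 1)) (cob Z i)" and \<iota>: "\<And>i. \<iota> i \<in> H (cob Y i) (cob Z i)"
    and \<pi>: "\<And>i. \<pi> i \<in> H (cob Z i) (cob X (i + 1))" and \<beta>: "\<And>i. \<beta> i \<in> H (cob Z i) (cob Y i)"
    and \<pi>\<alpha>: "\<And>i. \<pi> i * \<alpha> i = e (cob X (i + 1))" and \<beta>\<iota>: "\<And>i. \<beta> i * \<iota> i = e (cob Y i)"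
    and \<pi>\<iota>: "\<And>i. \<pi> i * \<iota> i = 0" and \<beta>\<alpha>: "\<And>i. \<beta> i * \<alpha> i = 0"
    and \<alpha>\<pi>_\<iota>\<beta>: "\<And>i. \<alpha> i * \<pi> i + \<iota> i * \<beta> i = e (cob Z i)"
    and dZ: "\<And>i. cdiff Z i = \<alpha> (i + 1) * (- cdiff X (i + 1) * \<pi> i) +
      (\<iota> (i + 1) * (f (i + 1) * \<pi> i) + \<iota> (i + 1) * (cdiff Y i * \<beta> i))"
begin

lemmas dX_hom = cxD(2)[OF cxX] and dY_hom = cxD(2)[OF cxY]
lemmas f_hom = cmapD(1)[OF f] and f_comm = cmapD(2)[OF f]

lemma \<pi>\<alpha>_mult: "x \<in> H P (cob X (i + 1)) \<Longrightarrow> \<pi> i * (\<alpha> i * x) = x"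
  by (simp add: \<pi>\<alpha>[THEN mult_assoc_eq] e_left)

lemma \<beta>\<iota>_mult: "x \<in> H P (cob Y i) \<Longrightarrow> \<beta> i * (\<iota> i * x) = x"
  by (simp add: \<beta>\<iota>[THEN mult_assoc_eq] e_left)

lemma split: "z \<in> H P (cob Z i) \<Longrightarrow> \<alpha> i * (\<pi> i * z) + \<iota> i * (\<beta> i * z) = z"
  using arg_cong[OF \<alpha>\<pi>_\<iota>\<beta>[of i], of "\<lambda>u. u * z"] by (simp add: distrib_right mult.assoc e_left)

text \<open>Here and in the next three lemmas the matrix of the cone differential is read off along
  inclusions and projections; later computations use these entries in place of the formula.\<close>

lemma d\<iota>: "cdiff Z i * \<iota> i = \<iota> (i + 1) * cdiff Y i"
  by (simp add: dZ distrib_right left_diff_distrib mult.assoc \<pi>\<iota> \<beta>\<iota> e_right[OF dY_hom])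

lemma d\<alpha>: "cdiff Z i * \<alpha> i = \<iota> (i + 1) * f (i + 1) - \<alpha> (i + 1) * cdiff X (i + 1)"
  by (simp add: dZ distrib_right left_diff_distrib mult.assoc \<pi>\<alpha> \<beta>\<alpha>
      e_right[OF dX_hom] e_right[OF f_hom])

lemma \<pi>d: "\<pi> (i + 1) * cdiff Z i = - cdiff X (i + 1) * \<pi> i"
  by (simp only: dZ distrib_left \<pi>\<alpha>[THEN mult_assoc_eq] \<pi>\<iota>[THEN mult_assoc_eq]
      e_left[OF H_mult[OF \<pi> H_uminus[OF dX_hom]]] mult_zero_left add_0_right)

lemma \<beta>d: "\<beta> (i + 1) * cdiff Z i = f (i + 1) * \<pi> i + cdiff Y i * \<beta> i"
  by (simp add: dZ distrib_left right_diff_distrib \<beta>\<alpha>[THEN mult_assoc_eq] \<beta>\<iota>[THEN mult_assoc_eq]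
      e_left[OF f_hom, THEN mult_assoc_eq] e_left[OF dY_hom, THEN mult_assoc_eq])

lemma dZ_hom: "cdiff Z i \<in> H (cob Z i) (cob Z (i + 1))"
  unfolding dZ
  by (intro H_add H_mult[OF _ \<alpha>] H_mult[OF _ \<iota>] H_mult[OF \<pi>] H_mult[OF \<beta>]
      H_uminus dX_hom dY_hom f_hom)

lemma dZ_dZ: "cdiff Z (i + 1) * cdiff Z i = 0"
  by (simp only: dZ[of i] distrib_left d\<alpha>[THEN mult_assoc_eq] d\<iota>[THEN mult_assoc_eq]
      left_diff_distrib mult_minus_left mult_minus_right mult.assoc f_comm[THEN mult_assoc_eq]
      cxD(3)[OF cxX, THEN mult_assoc_eq] cxD(3)[OF cxY, THEN mult_assoc_eq]) simp

lemma cxZ: "cx Z"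
proof -
  obtain M N where M: "\<And>i. \<bar>i\<bar> > M \<Longrightarrow> e (cob X i) = 0" and N: "\<And>i. \<bar>i\<bar> > N \<Longrightarrow> e (cob Y i) = 0"
    using cxX cxY unfolding cx_def by blast
  have "e (cob Z i) = 0" if "\<bar>i\<bar> > max (M + 1) N" for i
  proof -
    have "\<alpha> i = 0" "\<iota> i = 0"
      using that by (auto intro!: e_zero_hom(1)[OF _ \<alpha>] e_zero_hom(1)[OF _ \<iota>] M N)
    then show ?thesis using \<alpha>\<pi>_\<iota>\<beta>[of i] by simp
  qed
  then show ?thesis unfolding cx_def using dZ_hom dZ_dZ by blast
qed

lemma cmap_\<iota>: "cmap Y Z \<iota>"
  by (simp add: cmap_def \<iota> d\<iota>)

lemma cmap_\<pi>: "cmap Z (shift 1 X) \<pi>"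
  by (simp add: cmap_def \<pi> \<pi>d shift_def)

text \<open>For f x = dy the pair (x, -y) is a cycle of the cone, hence a boundary. Its X-component
  says that x is a boundary, with the sign of the shifted differential.\<close>

lemma acyclic_imp_hinj:
  assumes "acyclic Z"
  shows "hinj X Y f"
  unfolding hinj_def
proof (intro ballI allI impI)
  fix P i x y
  assume P: "P \<in> Pr" and x: "x \<in> H P (cob X (i + 1))" and y: "y \<in> H P (cob Y i)"
    and dx: "cdiff X (i + 1) * x = 0" and fx: "f (i + 1) * x = cdiff Y i * y"
  \<comment> \<open>The cycle lives in degree i of the cone, whereas \<open>acyclic\<close> speaks
    of degrees of the form j + 1.\<close>
  define j where "j = i - 1"
  have i: "i = j + 1" by (simp add: j_def)
  let ?z = "\<alpha> i * x - \<iota> i * y"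
  have z: "?z \<in> H P (cob Z i)" by (intro H_diff H_mult[OF x \<alpha>] H_mult[OF y \<iota>])
  have "cdiff Z i * ?z = 0"
    by (simp add: right_diff_distrib d\<alpha>[THEN mult_assoc_eq] d\<iota>[THEN mult_assoc_eq]
        left_diff_distrib mult.assoc dx fx)
  then obtain w where w: "w \<in> H P (cob Z j)" "?z = cdiff Z j * w"
    using assms P z unfolding acyclic_def i by blast
  have "x = \<pi> i * ?z"
    by (simp add: right_diff_distrib \<pi>\<alpha>_mult[OF x] \<pi>\<iota>[THEN mult_assoc_eq])
  also have "\<dots> = cdiff X i * - (\<pi> j * w)"
    unfolding w(2) by (simp add: i \<pi>d[THEN mult_assoc_eq] mult.assoc)
  finally have "x = cdiff X i * - (\<pi> j * w)" .
  moreover have "- (\<pi> j * w) \<in> H P (cob X i)" unfolding i by (rule H_uminus[OF H_mult[OF w(1) \<pi>]])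
  ultimately show "\<exists>z\<in>H P (cob X i). x = cdiff X i * z" by blast
qed

text \<open>\<open>\<iota> y\<close> is a cycle of the cone; the two components of a preimage w
  express y through f and a boundary.\<close>

lemma acyclic_imp_hsurj:
  assumes "acyclic Z"
  shows "hsurj X Y f"
  unfolding hsurj_def
proof (intro ballI allI impI)
  fix P i y
  assume P: "P \<in> Pr" and y: "y \<in> H P (cob Y (i + 1))" "cdiff Y (i + 1) * y = 0"
  have "cdiff Z (i + 1) * (\<iota> (i + 1) * y) = 0"
    by (simp add: d\<iota>[THEN mult_assoc_eq] mult.assoc y)
  then obtain w where w: "w \<in> H P (cob Z i)" "\<iota> (i + 1) * y = cdiff Z i * w"
    using assms P H_mult[OF y(1) \<iota>] unfolding acyclic_def by blast
  have "y = \<beta> (i + 1) * (\<iota> (i + 1) * y)" by (simp add: \<beta>\<iota>_mult[OF y(1)])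
  also have "\<dots> = f (i + 1) * (\<pi> i * w) + cdiff Y i * (\<beta> i * w)"
    unfolding w(2) by (simp add: \<beta>d[THEN mult_assoc_eq] distrib_right mult.assoc)
  finally have 1: "y = f (i + 1) * (\<pi> i * w) + cdiff Y i * (\<beta> i * w)" .
  have "0 = \<pi> (i + 1) * (\<iota> (i + 1) * y)" by (simp add: \<pi>\<iota>[THEN mult_assoc_eq])
  also have "\<dots> = - (cdiff X (i + 1) * (\<pi> i * w))"
    unfolding w(2) by (simp add: \<pi>d[THEN mult_assoc_eq] mult.assoc)
  finally have "cdiff X (i + 1) * (\<pi> i * w) = 0" by simp
  with 1 show "\<exists>x\<in>H P (cob X (i + 1)). \<exists>z\<in>H P (cob Y i).
      cdiff X (i + 1) * x = 0 \<and> y = f (i + 1) * x + cdiff Y i * z"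
    using H_mult[OF w(1) \<pi>] H_mult[OF w(1) \<beta>] by blast
qed

text \<open>A cycle (x, y) of the cone satisfies dx = 0 and f x + dy = 0. Injectivity gives x = dx';
  then y + f x' is a cycle, which surjectivity writes as f x'' + dy''. The preimage is (x'' - x',
  y'').\<close>

lemma qis_imp_acyclic:
  assumes "hinj X Y f" "hsurj X Y f"
  shows "acyclic Z"
  unfolding acyclic_def
proof (intro ballI allI impI)
  fix P i z
  assume P: "P \<in> Pr" and z: "z \<in> H P (cob Z (i + 1))" "cdiff Z (i + 1) * z = 0"
  let ?x = "\<pi> (i + 1) * z" and ?y = "\<beta> (i + 1) * z"
  note x = H_mult[OF z(1) \<pi>] and y = H_mult[OF z(1) \<beta>]
  have dx: "cdiff X (i + 1 + 1) * ?x = 0"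
    using arg_cong[OF z(2), of "\<lambda>u. \<pi> (i + 1 + 1) * u"]
    by (simp only: \<pi>d[THEN mult_assoc_eq] mult_zero_right) (simp add: mult.assoc)
  have dy: "f (i + 1 + 1) * ?x + cdiff Y (i + 1) * ?y = 0"
    using arg_cong[OF z(2), of "\<lambda>u. \<beta> (i + 1 + 1) * u"]
    by (simp only: \<beta>d[THEN mult_assoc_eq] mult_zero_right) (simp add: distrib_right mult.assoc)
  then have "f (i + 1 + 1) * ?x = cdiff Y (i + 1) * (- ?y)"
    by (simp add: eq_neg_iff_add_eq_0)
  then obtain x' where x': "x' \<in> H P (cob X (i + 1))" "?x = cdiff X (i + 1) * x'"
    using assms(1) P x H_uminus[OF y] dx unfolding hinj_def by blast
  let ?v = "?y + f (i + 1) * x'"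
  have v: "?v \<in> H P (cob Y (i + 1))" by (intro H_add y H_mult[OF x'(1) f_hom])
  have "cdiff Y (i + 1) * ?v = 0"
    using dy unfolding distrib_left f_comm[THEN mult_assoc_eq] mult.assoc x'(2)[symmetric]
    by (simp only: add.commute)
  then obtain x'' y'' where w: "x'' \<in> H P (cob X (i + 1))" "y'' \<in> H P (cob Y i)"
    "cdiff X (i + 1) * x'' = 0" "?v = f (i + 1) * x'' + cdiff Y i * y''"
    using assms(2) P v unfolding hsurj_def by blast
  let ?w = "\<alpha> i * (x'' - x') + \<iota> i * y''"
  have "cdiff Z i * ?w = \<iota> (i + 1) * (f (i + 1) * x'' + cdiff Y i * y'' - f (i + 1) * x')
      + \<alpha> (i + 1) * (cdiff X (i + 1) * x') - \<alpha> (i + 1) * (cdiff X (i + 1) * x'')"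
    by (simp add: distrib_left d\<alpha>[THEN mult_assoc_eq] d\<iota>[THEN mult_assoc_eq] mult.assoc
        right_diff_distrib left_diff_distrib)
  also have "\<dots> = \<alpha> (i + 1) * ?x + \<iota> (i + 1) * ?y"
    unfolding w(4)[symmetric] w(3) x'(2)[symmetric] by simp
  also have "\<dots> = z" by (rule split[OF z(1)])
  finally have "z = cdiff Z i * ?w" ..
  moreover have "?w \<in> H P (cob Z i)"
    by (intro H_add H_mult[OF _ \<alpha>] H_mult[OF _ \<iota>] H_diff w x')
  ultimately show "\<exists>y\<in>H P (cob Z i). z = cdiff Z i * y" by blast
qed

text \<open>Z is an extension of X[1] by Y. The X-component of a cycle of Z is some dx', and
  subtracting the boundary of (-x', 0) moves the cycle into Y.\<close>

lemma acyclic_source_imp_qis_\<iota>: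
  assumes "acyclic X"
  shows "qis Y Z \<iota>"
  unfolding qis_def
proof (intro conjI cmap_\<iota>)
  show "hinj Y Z \<iota>"
    unfolding hinj_def
  proof (intro ballI allI impI)
    fix P i y w
    assume P: "P \<in> Pr" and y: "y \<in> H P (cob Y (i + 1))" and w: "w \<in> H P (cob Z i)"
      and eq: "\<iota> (i + 1) * y = cdiff Z i * w"
    define j where "j = i - 1"
    have i: "i = j + 1" by (simp add: j_def)
    have "0 = \<pi> (i + 1) * (\<iota> (i + 1) * y)" by (simp add: \<pi>\<iota>[THEN mult_assoc_eq])
    also have "\<dots> = - (cdiff X (i + 1) * (\<pi> i * w))"
      unfolding eq by (simp add: \<pi>d[THEN mult_assoc_eq] mult.assoc)
    finally have "cdiff X (i + 1) * (\<pi> i * w) = 0" by simp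
    then obtain x where x: "x \<in> H P (cob X i)" "\<pi> i * w = cdiff X i * x"
      using assms P H_mult[OF w \<pi>] unfolding acyclic_def by blast
    have "y = \<beta> (i + 1) * (\<iota> (i + 1) * y)" by (simp add: \<beta>\<iota>_mult[OF y(1)])
    also have "\<dots> = f (i + 1) * (\<pi> i * w) + cdiff Y i * (\<beta> i * w)"
      unfolding eq by (simp add: \<beta>d[THEN mult_assoc_eq] distrib_right mult.assoc)
    also have "\<dots> = cdiff Y i * (f i * x + \<beta> i * w)"
      unfolding x(2) by (simp add: distrib_left f_comm[THEN mult_assoc_eq] mult.assoc)
    finally show "\<exists>z\<in>H P (cob Y i). y = cdiff Y i * z"
      using H_add[OF H_mult[OF x(1) f_hom] H_mult[OF w \<beta>]] by blast
  qed
  show "hsurj Y Z \<iota>"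
    unfolding hsurj_def
  proof (intro ballI allI impI)
    fix P i z
    assume P: "P \<in> Pr" and z: "z \<in> H P (cob Z (i + 1))" "cdiff Z (i + 1) * z = 0"
    let ?x = "\<pi> (i + 1) * z" and ?y = "\<beta> (i + 1) * z"
    note x = H_mult[OF z(1) \<pi>] and y = H_mult[OF z(1) \<beta>]
    have dx: "cdiff X (i + 1 + 1) * ?x = 0"
      using arg_cong[OF z(2), of "\<lambda>u. \<pi> (i + 1 + 1) * u"]
      by (simp only: \<pi>d[THEN mult_assoc_eq] mult_zero_right) (simp add: mult.assoc)
    have dy: "f (i + 1 + 1) * ?x + cdiff Y (i + 1) * ?y = 0"
      using arg_cong[OF z(2), of "\<lambda>u. \<beta> (i + 1 + 1) * u"]
      by (simp only: \<beta>d[THEN mult_assoc_eq] mult_zero_right) (simp add: distrib_right mult.assoc)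
    obtain x' where x': "x' \<in> H P (cob X (i + 1))" "?x = cdiff X (i + 1) * x'"
      using assms P x dx unfolding acyclic_def by blast
    let ?v = "?y + f (i + 1) * x'"
    have v: "?v \<in> H P (cob Y (i + 1))" by (intro H_add y H_mult[OF x'(1) f_hom])
    have dv: "cdiff Y (i + 1) * ?v = 0"
      using dy unfolding distrib_left f_comm[THEN mult_assoc_eq] mult.assoc x'(2)[symmetric]
      by (simp only: add.commute)
    let ?w = "\<alpha> i * - x'"
    have w: "?w \<in> H P (cob Z i)" by (intro H_mult[OF _ \<alpha>] H_uminus x')
    have "\<iota> (i + 1) * ?v + cdiff Z i * ?w = \<alpha> (i + 1) * ?x + \<iota> (i + 1) * ?y"
      unfolding x'(2)
      by (simp add: distrib_left d\<alpha>[THEN mult_assoc_eq] left_diff_distrib mult.assoc)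
    also have "\<dots> = z" by (rule split[OF z(1)])
    finally show "\<exists>y\<in>H P (cob Y (i + 1)). \<exists>w\<in>H P (cob Z i).
        cdiff Y (i + 1) * y = 0 \<and> z = \<iota> (i + 1) * y + cdiff Z i * w"
      using v dv w by metis
  qed
qed

text \<open>Exactness of Hom(T, -) at Y. The null homotopy s has two components:
  \<open>\<pi> s\<close> is the lift and \<open>\<beta> s\<close> the homotopy that makes it
  one.\<close>

lemma lift_along_f:
  assumes T: "cx T" and x: "cmap T Y x" and null: "htpy T Z (\<lambda>i. \<iota> i * x i) (\<lambda>i. 0)"
  shows "\<exists>v. cmap T X v \<and> htpy T Y x (\<lambda>i. f i * v i)"
proof -
  obtain s where s: "\<And>i. s i \<in> H (cob T (i + 1)) (cob Z i)"
    and eq: "\<And>i. \<iota> (i + 1) * x (i + 1) = cdiff Z i * s i + s (i + 1) * cdiff T (i + 1)"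
    using null unfolding htpy_def by auto
  \<comment> \<open>s in degree i starts at degree i + 1 of T, so the lift in degree i reads s in
    degree i - 1.\<close>
  define v where "v i = \<pi> (i - 1) * s (i - 1)" for i
  have v1: "v (i + 1) = \<pi> i * s i" for i by (simp add: v_def)
  have "cmap T X v"
    unfolding cmap_def
  proof (intro allI conjI)
    fix i
    show "v i \<in> H (cob T i) (cob X i)"
    proof (rule int_plus1_cases[of _ i])
      fix j show "v (j + 1) \<in> H (cob T (j + 1)) (cob X (j + 1))"
        unfolding v1 by (rule H_mult[OF s \<pi>])
    qed
    show "cdiff X i * v i = v (i + 1) * cdiff T i"
    proof (rule int_plus1_cases[of _ i])
      fix j
      have "0 = \<pi> (j + 1) * (\<iota> (j + 1) * x (j + 1))" by (simp add: \<pi>\<iota>[THEN mult_assoc_eq])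
      also have "\<dots> = v (j + 1 + 1) * cdiff T (j + 1) - cdiff X (j + 1) * v (j + 1)"
        unfolding eq v1 by (simp add: distrib_left \<pi>d[THEN mult_assoc_eq] mult.assoc)
      finally show "cdiff X (j + 1) * v (j + 1) = v (j + 1 + 1) * cdiff T (j + 1)" by simp
    qed
  qed
  moreover have "htpy T Y x (\<lambda>i. f i * v i)"
    unfolding htpy_def
  proof (intro exI[of _ "\<lambda>i. \<beta> i * s i"] allI conjI H_mult[OF s \<beta>])
    fix i
    have "x (i + 1) = \<beta> (i + 1) * (\<iota> (i + 1) * x (i + 1))"
      by (simp add: \<beta>\<iota>_mult[OF cmapD(1)[OF x]])
    also have "\<dots> = f (i + 1) * v (i + 1) + (cdiff Y i * (\<beta> i * s i) + \<beta> (i + 1) * s (i + 1) * cdiff T (i + 1))"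
      unfolding eq v1 by (simp add: distrib_left distrib_right \<beta>d[THEN mult_assoc_eq] mult.assoc)
    finally show "x (i + 1) = f (i + 1) * v (i + 1) +
      (cdiff Y i * (\<beta> i * s i) + \<beta> (i + 1) * s (i + 1) * cdiff T (i + 1))" .
  qed
  ultimately show ?thesis by blast
qed

text \<open>The homotopy fibre of f: the cone shifted back, so that its projection lands in X. In
  the Ore and cancellation lemmas it is the source of the new denominator.\<close>

abbreviation fib :: "('a, 'b) cplx"
  where "fib \<equiv> shift (- 1) Z"

abbreviation fib_map :: "int \<Rightarrow> 'b"
  where "fib_map \<equiv> \<lambda>i. \<pi> (i - 1)"

lemma fib_sel: "cob fib (i + 1) = cob Z i" "cdiff fib (i + 1) = - cdiff Z i"
  by (simp_all add: shift_def)

lemma cmap_fib_map: "cmap fib X fib_map"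
  unfolding cmap_def
proof (intro allI conjI)
  fix i
  show "\<pi> (i - 1) \<in> H (cob fib i) (cob X i)" using \<pi>[of "i - 1"] by (simp add: shift_def)
  show "cdiff X i * \<pi> (i - 1) = \<pi> (i + 1 - 1) * cdiff fib i"
    using \<pi>d[of "i - 1"] by (simp add: shift_def)
qed

lemma htpy_fib_map: "htpy fib Y (\<lambda>i. f i * fib_map i) (\<lambda>i. 0)"
  unfolding htpy_def
  by (rule exI[of _ "\<lambda>i. - \<beta> i"]) (simp add: fib_sel \<beta> H_uminus \<beta>d)

text \<open>The null homotopy s of f x is the missing component: the lift is (x, -s). It recovers x
  exactly and not merely up to homotopy.\<close>

lemma lift_to_fib:
  assumes x: "cmap T X x" and null: "htpy T Y (\<lambda>i. f i * x i) (\<lambda>i. 0)"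
  shows "\<exists>g. cmap T fib g \<and> (\<forall>i. fib_map i * g i = x i)"
proof -
  obtain s where s: "\<And>i. s i \<in> H (cob T (i + 1)) (cob Y i)"
    and eq: "\<And>i. f (i + 1) * x (i + 1) = cdiff Y i * s i + s (i + 1) * cdiff T (i + 1)"
    using null unfolding htpy_def by auto
  define g where "g i = \<alpha> (i - 1) * x i - \<iota> (i - 1) * s (i - 1)" for i
  have g1: "g (i + 1) = \<alpha> i * x (i + 1) - \<iota> i * s i" for i by (simp add: g_def)
  have "cmap T fib g"
    unfolding cmap_def
  proof (intro allI)
    fix i
    show "g i \<in> H (cob T i) (cob fib i) \<and> cdiff fib i * g i = g (i + 1) * cdiff T i"
    proof (rule int_plus1_cases[of _ i], intro conjI)
      fix j
      show "g (j + 1) \<in> H (cob T (j + 1)) (cob fib (j + 1))"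
        unfolding g1 fib_sel by (intro H_diff H_mult[OF cmapD(1)[OF x] \<alpha>] H_mult[OF s \<iota>])
      have "cdiff fib (j + 1) * g (j + 1) = \<alpha> (j + 1) * (cdiff X (j + 1) * x (j + 1))
          - \<iota> (j + 1) * (f (j + 1) * x (j + 1) - cdiff Y j * s j)"
        unfolding g1 fib_sel
        by (simp add: right_diff_distrib left_diff_distrib d\<alpha>[THEN mult_assoc_eq]
            d\<iota>[THEN mult_assoc_eq] mult.assoc)
      also have "\<dots> = g (j + 1 + 1) * cdiff T (j + 1)"
        unfolding g1 eq cmapD(2)[OF x]
        by (simp add: right_diff_distrib left_diff_distrib mult.assoc)
      finally show "cdiff fib (j + 1) * g (j + 1) = g (j + 1 + 1) * cdiff T (j + 1)" .
    qed
  qed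
  moreover have "fib_map i * g i = x i" for i
    by (rule int_plus1_cases[of _ i])
      (simp add: g1 right_diff_distrib \<pi>\<alpha>_mult[OF cmapD(1)[OF x]] \<pi>\<iota>[THEN mult_assoc_eq])
  ultimately show ?thesis by blast
qed

text \<open>The fibre is an extension of X by Y[-1], so an acyclic Y leaves cohomology unchanged:
  for a cycle x one has f x = dy, and (x, -y) is a cycle over x.\<close>

lemma acyclic_target_imp_qis_fib_map:
  assumes "acyclic Y"
  shows "qis fib X fib_map"
  unfolding qis_def
proof (intro conjI cmap_fib_map)
  show "hinj fib X fib_map"
    unfolding hinj_def
  proof (intro ballI allI impI)
    fix P and i :: int and z x
    define j where "j = i - 1"
    have i: "i = j + 1" by (simp add: j_def)
    assume P: "P \<in> Pr" and "z \<in> H P (cob fib (i + 1))" and x: "x \<in> H P (cob X i)"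
      and "cdiff fib (i + 1) * z = 0" and "\<pi> (i + 1 - 1) * z = cdiff X i * x"
    then have z: "z \<in> H P (cob Z (j + 1))" "cdiff Z (j + 1) * z = 0"
      and eq: "\<pi> (j + 1) * z = cdiff X (j + 1) * x"
      by (simp_all only: fib_sel i add_diff_cancel_right' mult_minus_left neg_equal_0_iff_equal)
    have dy: "f (j + 1 + 1) * (\<pi> (j + 1) * z) + cdiff Y (j + 1) * (\<beta> (j + 1) * z) = 0"
      using arg_cong[OF z(2), of "\<lambda>u. \<beta> (j + 1 + 1) * u"]
      by (simp only: \<beta>d[THEN mult_assoc_eq] mult_zero_right) (simp add: distrib_right mult.assoc)
    let ?v = "\<beta> (j + 1) * z + f (j + 1) * x"
    have "?v \<in> H P (cob Y (j + 1))"
      using x i by (auto intro: H_add H_mult[OF _ f_hom] H_mult[OF z(1) \<beta>])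
    moreover have "cdiff Y (j + 1) * ?v = 0"
      using dy unfolding distrib_left f_comm[THEN mult_assoc_eq] mult.assoc eq[symmetric]
      by (simp only: add.commute)
    ultimately obtain y where y: "y \<in> H P (cob Y j)" "?v = cdiff Y j * y"
      using assms P unfolding acyclic_def by blast
    let ?w = "\<alpha> j * x - \<iota> j * y"
    have w: "?w \<in> H P (cob Z j)" using x i by (auto intro: H_diff H_mult[OF _ \<alpha>] H_mult[OF y(1) \<iota>])
    have "cdiff Z j * ?w = \<iota> (j + 1) * (f (j + 1) * x - cdiff Y j * y) - \<alpha> (j + 1) * (cdiff X (j + 1) * x)"
      by (simp add: right_diff_distrib left_diff_distrib d\<alpha>[THEN mult_assoc_eq]
            d\<iota>[THEN mult_assoc_eq] mult.assoc)
    also have "\<dots> = - (\<alpha> (j + 1) * (\<pi> (j + 1) * z) + \<iota> (j + 1) * (\<beta> (j + 1) * z))"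
      unfolding y(2)[symmetric] eq by (simp add: right_diff_distrib distrib_left)
    also have "\<dots> = - z" by (simp only: split[OF z(1)])
    finally have "z = cdiff fib i * ?w" by (simp add: i fib_sel)
    then show "\<exists>w\<in>H P (cob fib i). z = cdiff fib i * w" using w i by (auto simp: fib_sel)
  qed
  show "hsurj fib X fib_map"
    unfolding hsurj_def
  proof (intro ballI allI impI)
    fix P i x
    assume P: "P \<in> Pr" and x: "x \<in> H P (cob X (i + 1))" "cdiff X (i + 1) * x = 0"
    have "cdiff Y (i + 1) * (f (i + 1) * x) = 0"
      by (simp add: f_comm[THEN mult_assoc_eq] mult.assoc x)
    then obtain y where y: "y \<in> H P (cob Y i)" "f (i + 1) * x = cdiff Y i * y"
      using assms P H_mult[OF x(1) f_hom] unfolding acyclic_def by blast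
    let ?z = "\<alpha> i * x - \<iota> i * y"
    have "?z \<in> H P (cob fib (i + 1))"
      by (auto simp: fib_sel intro: H_diff H_mult[OF x(1) \<alpha>] H_mult[OF y(1) \<iota>])
    moreover have "cdiff fib (i + 1) * ?z = 0"
      by (simp add: fib_sel right_diff_distrib left_diff_distrib d\<alpha>[THEN mult_assoc_eq]
          d\<iota>[THEN mult_assoc_eq] mult.assoc x y(2)[symmetric])
    moreover have "x = \<pi> (i + 1 - 1) * ?z + cdiff X i * 0"
      by (simp add: right_diff_distrib \<pi>\<alpha>_mult[OF x(1)] \<pi>\<iota>[THEN mult_assoc_eq])
    moreover have "0 \<in> H P (cob X i)" using P by (simp add: H_zero Pr_Obj cxD[OF cxX])
    ultimately show "\<exists>z\<in>H P (cob fib (i + 1)). \<exists>y\<in>H P (cob X i).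
        cdiff fib (i + 1) * z = 0 \<and> x = \<pi> (i + 1 - 1) * z + cdiff X i * y" by blast
  qed
qed

text \<open>Exactness of Hom(T, -) at the cone: z is first moved into Y by a homotopy, where it is
  null.\<close>

lemma no_maps_to_cone:
  assumes "no_maps T Y" "no_maps T (shift 1 X)"
  shows "no_maps T Z"
  unfolding no_maps_def
proof (intro allI impI)
  fix z assume z: "cmap T Z z"
  have "htpy T (shift 1 X) (\<lambda>i. \<pi> i * z i) (\<lambda>i. 0)"
    using assms(2) cmap_comp[OF z cmap_\<pi>] by (simp add: no_maps_def)
  then obtain k where k: "\<And>i. k i \<in> H (cob T (i + 1)) (cob X (i + 1))"
    and \<pi>z: "\<And>i. \<pi> (i + 1) * z (i + 1) = k (i + 1) * cdiff T (i + 1) - cdiff X (i + 1) * k i"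
    unfolding htpy_def shift_def by (auto simp: algebra_simps)
  \<comment> \<open>Subtracting from z the boundary of \<open>\<alpha> k\<close> kills its
    X-component; y is the Y-component that remains. The sign in the equation for
    \<open>\<pi> z\<close> is that of the differential of X[1].\<close>
  define y where "y i = \<beta> i * z i - f i * k (i - 1)" for i
  have y1: "y (i + 1) = \<beta> (i + 1) * z (i + 1) - f (i + 1) * k i" for i by (simp add: y_def)
  have "cmap T Y y"
    unfolding cmap_def
  proof (intro allI)
    fix i
    show "y i \<in> H (cob T i) (cob Y i) \<and> cdiff Y i * y i = y (i + 1) * cdiff T i"
    proof (rule int_plus1_cases[of _ i], intro conjI)
      fix j
      show "y (j + 1) \<in> H (cob T (j + 1)) (cob Y (j + 1))"
        unfolding y1 by (intro H_diff H_mult[OF cmapD(1)[OF z] \<beta>] H_mult[OF k f_hom])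
      have "\<beta> (j + 1 + 1) * (cdiff Z (j + 1) * z (j + 1)) = \<beta> (j + 1 + 1) * (z (j + 1 + 1) * cdiff T (j + 1))"
        by (simp only: cmapD(2)[OF z])
      then have "cdiff Y (j + 1) * (\<beta> (j + 1) * z (j + 1)) =
          \<beta> (j + 1 + 1) * (z (j + 1 + 1) * cdiff T (j + 1)) - f (j + 1 + 1) * (\<pi> (j + 1) * z (j + 1))"
        by (simp only: \<beta>d[THEN mult_assoc_eq]) (simp add: distrib_right mult.assoc algebra_simps)
      then show "cdiff Y (j + 1) * y (j + 1) = y (j + 1 + 1) * cdiff T (j + 1)"
        unfolding y1 \<pi>z
        by (simp add: right_diff_distrib left_diff_distrib mult.assoc f_comm[THEN mult_assoc_eq])
    qed
  qed
  then have "htpy T Y y (\<lambda>i. 0)" using assms(1) by (simp add: no_maps_def)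
  then obtain h where h: "\<And>i. h i \<in> H (cob T (i + 1)) (cob Y i)"
    and yh: "\<And>i. y (i + 1) = cdiff Y i * h i + h (i + 1) * cdiff T (i + 1)"
    unfolding htpy_def by auto
  show "htpy T Z z (\<lambda>i. 0)"
    unfolding htpy_def
  proof (intro exI[of _ "\<lambda>i. \<alpha> i * k i + \<iota> i * h i"] allI conjI)
    fix i
    show "\<alpha> i * k i + \<iota> i * h i \<in> H (cob T (i + 1)) (cob Z i)"
      by (intro H_add H_mult[OF k \<alpha>] H_mult[OF h \<iota>])
    have "z (i + 1) = \<alpha> (i + 1) * (\<pi> (i + 1) * z (i + 1)) + \<iota> (i + 1) * (y (i + 1) + f (i + 1) * k i)"
      by (simp add: y1 split[OF cmapD(1)[OF z]])
    then show "z (i + 1) = 0 + (cdiff Z i * (\<alpha> i * k i + \<iota> i * h i) +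
        (\<alpha> (i + 1) * k (i + 1) + \<iota> (i + 1) * h (i + 1)) * cdiff T (i + 1))"
      unfolding \<pi>z yh
      by (simp add: distrib_left distrib_right right_diff_distrib left_diff_distrib
          d\<alpha>[THEN mult_assoc_eq] d\<iota>[THEN mult_assoc_eq] mult.assoc)
  qed
qed

text \<open>The same exactness one term earlier in the triangle: x lifts to the fibre, where it is
  null.\<close>

lemma no_maps_to_source:
  assumes "no_maps T Y" "no_maps T fib"
  shows "no_maps T X"
  unfolding no_maps_def
proof (intro allI impI)
  fix x assume x: "cmap T X x"
  have "htpy T Y (\<lambda>i. f i * x i) (\<lambda>i. 0)"
    using assms(1) cmap_comp[OF x f] by (simp add: no_maps_def)
  then obtain g where g: "cmap T fib g" "\<And>i. fib_map i * g i = x i"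
    using lift_to_fib[OF x] by blast
  have "htpy T fib g (\<lambda>i. 0)" using assms(2) g(1) by (simp add: no_maps_def)
  from htpy_comp_left[OF this cmap_fib_map] show "htpy T X x (\<lambda>i. 0)" by (simp add: g(2))
qed

text \<open>Exactness of Hom(-, R) at Y: a null homotopy h of g f extends g to the cone as
  \<open>g \<beta> + h \<pi>\<close>, and a null homotopy of the extension restricts along
  \<open>\<iota>\<close> to one of g.\<close>

lemma no_maps_from_target:
  assumes "no_maps X R" "no_maps Z R"
  shows "no_maps Y R"
  unfolding no_maps_def
proof (intro allI impI)
  fix g assume g: "cmap Y R g"
  have "htpy X R (\<lambda>i. g i * f i) (\<lambda>i. 0)"
    using assms(1) cmap_comp[OF f g] by (simp add: no_maps_def)
  then obtain h where h: "\<And>i. h i \<in> H (cob X (i + 1)) (cob R i)"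
    and gf: "\<And>i. g (i + 1) * f (i + 1) = cdiff R i * h i + h (i + 1) * cdiff X (i + 1)"
    unfolding htpy_def by auto
  let ?k = "\<lambda>i. g i * \<beta> i + h i * \<pi> i"
  have "cmap Z R ?k"
    unfolding cmap_def
  proof (intro allI conjI)
    fix i
    show "?k i \<in> H (cob Z i) (cob R i)"
      by (intro H_add H_mult[OF \<beta> cmapD(1)[OF g]] H_mult[OF \<pi> h])
    have "?k (i + 1) * cdiff Z i = (g (i + 1) * f (i + 1)) * \<pi> i + g (i + 1) * (cdiff Y i * \<beta> i)
        - h (i + 1) * (cdiff X (i + 1) * \<pi> i)"
      by (simp add: distrib_right distrib_left mult.assoc \<beta>d \<pi>d)
    also have "\<dots> = cdiff R i * ?k i"
      unfolding gf by (simp add: distrib_right distrib_left mult.assoc cmapD(2)[OF g, THEN mult_assoc_eq])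
    finally show "cdiff R i * ?k i = ?k (i + 1) * cdiff Z i" ..
  qed
  then have "htpy Z R ?k (\<lambda>i. 0)" using assms(2) by (simp add: no_maps_def)
  from htpy_comp_right[OF this cmap_\<iota>] show "htpy Y R g (\<lambda>i. 0)"
    by (simp add: distrib_right mult.assoc \<beta>\<iota> \<pi>\<iota> e_right[OF cmapD(1)[OF g]])
qed

end

section \<open>Lifting, Ore condition and cancellation for quasi-isomorphisms\<close>

context ring_category
begin

lemma cone_exists:
  assumes X: "cx X" and Y: "cx Y" and f: "cmap X Y f"
  shows "\<exists>Z \<alpha> \<iota> \<pi> \<beta>. ring_cone Obj H e Pr X Y Z f \<alpha> \<iota> \<pi> \<beta>"
proof -
  have "\<forall>i. \<exists>S \<alpha> \<iota> \<pi> \<beta>. \<alpha> \<in> H (cob X (i + 1)) S \<and> \<iota> \<in> H (cob Y i) S \<and> \<pi> \<in> H S (cob X (i + 1)) \<and>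
    \<beta> \<in> H S (cob Y i) \<and> \<pi> * \<alpha> = e (cob X (i + 1)) \<and> \<beta> * \<iota> = e (cob Y i) \<and> \<pi> * \<iota> = 0 \<and> \<beta> * \<alpha> = 0 \<and>
    \<alpha> * \<pi> + \<iota> * \<beta> = e S"
    using biproduct[OF cxD(1)[OF X] cxD(1)[OF Y]] by blast
  then obtain S \<alpha> \<iota> \<pi> \<beta> where "\<forall>i. \<alpha> i \<in> H (cob X (i + 1)) (S i) \<and> \<iota> i \<in> H (cob Y i) (S i) \<and>
    \<pi> i \<in> H (S i) (cob X (i + 1)) \<and> \<beta> i \<in> H (S i) (cob Y i) \<and> \<pi> i * \<alpha> i = e (cob X (i + 1)) \<and>
    \<beta> i * \<iota> i = e (cob Y i) \<and> \<pi> i * \<iota> i = 0 \<and> \<beta> i * \<alpha> i = 0 \<and> \<alpha> i * \<pi> i + \<iota> i * \<beta> i = e (S i)"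
    by metis
  then have "ring_cone Obj H e Pr X Y \<lparr>cob = S, cdiff = (\<lambda>i. \<alpha> (i + 1) * (- cdiff X (i + 1) * \<pi> i) +
      (\<iota> (i + 1) * (f (i + 1) * \<pi> i) + \<iota> (i + 1) * (cdiff Y i * \<beta> i)))\<rparr> f \<alpha> \<iota> \<pi> \<beta>"
    using assms by unfold_locales auto
  then show ?thesis by blast
qed

text \<open>The obstruction to lifting x is its composite into the cone of s; the cone is acyclic
  and receives no maps from P.\<close>

lemma qis_lift:
  assumes X: "cx X" and Y: "cx Y" and s: "qis X Y s"
    and P: "cx P" "\<And>i. cob P i \<in> Pr" and x: "cmap P Y x"
  shows "\<exists>v. cmap P X v \<and> htpy P Y x (\<lambda>i. s i * v i)"
proof -
  have s': "cmap X Y s" "hinj X Y s" "hsurj X Y s" using s by (auto simp: qis_def)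
  obtain Z \<alpha> \<iota> \<pi> \<beta> where "ring_cone Obj H e Pr X Y Z s \<alpha> \<iota> \<pi> \<beta>"
    using cone_exists[OF X Y s'(1)] by blast
  then interpret ring_cone Obj H e Pr X Y Z s \<alpha> \<iota> \<pi> \<beta> .
  show ?thesis
    using lift_along_f[OF P(1) x] cmap_comp[OF x cmap_\<iota>]
      no_maps_into_acyclic[OF P cxZ qis_imp_acyclic[OF s'(2,3)]]
    unfolding no_maps_def by blast
qed

text \<open>Let C be the cone of s, which is acyclic, and U the fibre of the composite from X to C.
  Then U maps quasi-isomorphically to X, and over U the map f becomes null in C, so it lifts through
  s.\<close>

lemma qis_ore:
  assumes X: "cx X" and Y: "cx Y" and Z: "cx Z" and f: "cmap X Y f" and s: "qis Z Y s"
  shows "\<exists>U t v. cx U \<and> qis U X t \<and> cmap U Z v \<and> htpy U Y (\<lambda>i. f i * t i) (\<lambda>i. s i * v i)"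
proof -
  have s': "cmap Z Y s" "hinj Z Y s" "hsurj Z Y s" using s by (auto simp: qis_def)
  obtain C \<alpha> \<iota> \<pi> \<beta> where "ring_cone Obj H e Pr Z Y C s \<alpha> \<iota> \<pi> \<beta>"
    using cone_exists[OF Z Y s'(1)] by blast
  then interpret c: ring_cone Obj H e Pr Z Y C s \<alpha> \<iota> \<pi> \<beta> .
  note C = c.qis_imp_acyclic[OF s'(2,3)] and g = cmap_comp[OF f c.cmap_\<iota>]
  obtain D \<alpha>' \<iota>' \<pi>' \<beta>' where "ring_cone Obj H e Pr X C D (\<lambda>i. \<iota> i * f i) \<alpha>' \<iota>' \<pi>' \<beta>'"
    using cone_exists[OF X c.cxZ g] by blast
  then interpret d: ring_cone Obj H e Pr X C D "\<lambda>i. \<iota> i * f i" \<alpha>' \<iota>' \<pi>' \<beta>' .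
  note U = cx_shift[OF d.cxZ, of "- 1"]
  show ?thesis
    using c.lift_along_f[OF U cmap_comp[OF d.cmap_fib_map f]] d.htpy_fib_map
      d.acyclic_target_imp_qis_fib_map[OF C] U
    by (auto simp: mult.assoc)
qed

text \<open>Since s (f - g) is null, f - g factors through the fibre of s, which is acyclic. The
  fibre of this factor h maps quasi-isomorphically to X and makes h null.\<close>

lemma qis_cancel:
  assumes X: "cx X" and Y: "cx Y" and Z: "cx Z" and f: "cmap X Y f" and g: "cmap X Y g"
    and s: "qis Y Z s" and eq: "htpy X Z (\<lambda>i. s i * f i) (\<lambda>i. s i * g i)"
  shows "\<exists>U t. cx U \<and> qis U X t \<and> htpy U Y (\<lambda>i. f i * t i) (\<lambda>i. g i * t i)"
proof -
  have s': "cmap Y Z s" "hinj Y Z s" "hsurj Y Z s" using s by (auto simp: qis_def)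
  obtain C \<alpha> \<iota> \<pi> \<beta> where "ring_cone Obj H e Pr Y Z C s \<alpha> \<iota> \<pi> \<beta>"
    using cone_exists[OF Y Z s'(1)] by blast
  then interpret c: ring_cone Obj H e Pr Y Z C s \<alpha> \<iota> \<pi> \<beta> .
  have "acyclic C" by (rule c.qis_imp_acyclic[OF s'(2,3)])
  \<comment> \<open>Acyclicity of the fibre is read off from that of its shift C, by testing with
    P[1] in place of P.\<close>
  then have "\<And>P. \<lbrakk>cx P; \<And>i. cob P i \<in> Pr\<rbrakk> \<Longrightarrow> no_maps (shift 1 P) C"
    by (intro no_maps_into_acyclic cx_shift c.cxZ) (auto simp: shift_def)
  then have F: "acyclic c.fib"
    using no_maps_shift_iff[of 1 _ c.fib]
    by (intro acyclic_of_no_maps cx_shift c.cxZ) (simp add: shift_shift shift_zero)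
  have "htpy X Z (\<lambda>i. s i * (f i - g i)) (\<lambda>i. 0)"
    using htpy_zero_diff[OF eq] by (simp add: right_diff_distrib)
  then obtain h where h: "cmap X c.fib h" "\<And>i. c.fib_map i * h i = f i - g i"
    using c.lift_to_fib[OF cmap_diff[OF f g]] by blast
  obtain D \<alpha>' \<iota>' \<pi>' \<beta>' where "ring_cone Obj H e Pr X c.fib D h \<alpha>' \<iota>' \<pi>' \<beta>'"
    using cone_exists[OF X cx_shift[OF c.cxZ] h(1)] by blast
  then interpret d: ring_cone Obj H e Pr X c.fib D h \<alpha>' \<iota>' \<pi>' \<beta>' .
  have "htpy d.fib Y (\<lambda>i. f i * d.fib_map i - g i * d.fib_map i) (\<lambda>i. 0)"
    using htpy_comp_left[OF d.htpy_fib_map c.cmap_fib_map]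
    by (simp add: mult.assoc[symmetric] h(2) left_diff_distrib)
  from htpy_of_diff[OF this] show ?thesis
    using d.acyclic_target_imp_qis_fib_map[OF F] cx_shift[OF d.cxZ] by blast
qed

section \<open>Composition, cancellation, homotopy invariance and shifts of
  quasi-isomorphisms\<close>

lemma qisD: "qis X Y f \<Longrightarrow> cmap X Y f" "qis X Y f \<Longrightarrow> hinj X Y f" "qis X Y f \<Longrightarrow> hsurj X Y f"
  by (auto simp: qis_def)

lemma hinj_comp:
  assumes "cmap X Y f" "hinj X Y f" "hinj Y Z g"
  shows "hinj X Z (\<lambda>i. g i * f i)"
  unfolding hinj_def
proof (intro ballI allI impI)
  fix P i x z
  assume P: "P \<in> Pr" and x: "x \<in> H P (cob X (i + 1))" "cdiff X (i + 1) * x = 0"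
    and z: "z \<in> H P (cob Z i)" "g (i + 1) * f (i + 1) * x = cdiff Z i * z"
  note fx = H_mult[OF x(1) cmapD(1)[OF assms(1)]]
  have "cdiff Y (i + 1) * (f (i + 1) * x) = 0"
    by (simp add: cmapD(2)[OF assms(1), THEN mult_assoc_eq] mult.assoc x)
  then obtain y where "y \<in> H P (cob Y i)" "f (i + 1) * x = cdiff Y i * y"
    using assms(3) P fx z unfolding hinj_def mult.assoc by blast
  then show "\<exists>z\<in>H P (cob X i). x = cdiff X i * z"
    using assms(2) P x unfolding hinj_def by blast
qed

lemma hsurj_comp:
  assumes "cmap X Y f" "cmap Y Z g" "hsurj X Y f" "hsurj Y Z g"
  shows "hsurj X Z (\<lambda>i. g i * f i)"
  unfolding hsurj_def
proof (intro ballI allI impI)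
  fix P i z
  assume P: "P \<in> Pr" and z: "z \<in> H P (cob Z (i + 1))" "cdiff Z (i + 1) * z = 0"
  obtain y w where y: "y \<in> H P (cob Y (i + 1))" "w \<in> H P (cob Z i)" "cdiff Y (i + 1) * y = 0"
    "z = g (i + 1) * y + cdiff Z i * w"
    using assms(4) P z unfolding hsurj_def by blast
  obtain x v where x: "x \<in> H P (cob X (i + 1))" "v \<in> H P (cob Y i)" "cdiff X (i + 1) * x = 0"
    "y = f (i + 1) * x + cdiff Y i * v"
    using assms(3) P y(1,3) unfolding hsurj_def by blast
  have "z = g (i + 1) * f (i + 1) * x + cdiff Z i * (g i * v + w)"
    unfolding y(4) x(4)
    by (simp add: distrib_left cmapD(2)[OF assms(2), THEN mult_assoc_eq] mult.assoc)
  then show "\<exists>x\<in>H P (cob X (i + 1)). \<exists>v\<in>H P (cob Z i). cdiff X (i + 1) * x = 0 \<and>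
      z = g (i + 1) * f (i + 1) * x + cdiff Z i * v"
    using x y H_add[OF H_mult[OF x(2) cmapD(1)[OF assms(2)]] y(2)] by blast
qed

lemma qis_comp: "\<lbrakk>qis X Y f; qis Y Z g\<rbrakk> \<Longrightarrow> qis X Z (\<lambda>i. g i * f i)"
  using hinj_comp hsurj_comp cmap_comp unfolding qis_def by blast

lemma qis_id:
  assumes "cx X"
  shows "qis X X (\<lambda>i. e (cob X i))"
proof -
  have "0 \<in> H P (cob X i)" if "P \<in> Pr" for P i using that assms by (simp add: H_zero Pr_Obj cxD)
  then show ?thesis
    unfolding qis_def hinj_def hsurj_def using cmap_id[OF assms]
    by (auto simp: e_left) (metis add.right_neutral mult_zero_right e_left)
qed

lemma hinj_htpy:
  assumes "cmap X Y f" "htpy X Y f g" "hinj X Y f"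
  shows "hinj X Y g"
  unfolding hinj_def
proof (intro ballI allI impI)
  fix P i x y
  assume P: "P \<in> Pr" and x: "x \<in> H P (cob X (i + 1))" "cdiff X (i + 1) * x = 0"
    and y: "y \<in> H P (cob Y i)" "g (i + 1) * x = cdiff Y i * y"
  obtain s where s: "\<And>i. s i \<in> H (cob X (i + 1)) (cob Y i)"
    "\<And>i. f (i + 1) = g (i + 1) + (cdiff Y i * s i + s (i + 1) * cdiff X (i + 1))"
    using assms(2) unfolding htpy_def by blast
  have "f (i + 1) * x = cdiff Y i * (y + s i * x)"
    unfolding s(2) by (simp add: distrib_left distrib_right y mult.assoc x)
  then show "\<exists>z\<in>H P (cob X i). x = cdiff X i * z"
    using assms(3) P x H_add[OF y(1) H_mult[OF x(1) s(1)]] unfolding hinj_def by blast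
qed

lemma hsurj_htpy:
  assumes "cmap X Y f" "htpy X Y f g" "hsurj X Y f"
  shows "hsurj X Y g"
  unfolding hsurj_def
proof (intro ballI allI impI)
  fix P i y
  assume P: "P \<in> Pr" and y: "y \<in> H P (cob Y (i + 1))" "cdiff Y (i + 1) * y = 0"
  obtain s where s: "\<And>i. s i \<in> H (cob X (i + 1)) (cob Y i)"
    "\<And>i. f (i + 1) = g (i + 1) + (cdiff Y i * s i + s (i + 1) * cdiff X (i + 1))"
    using assms(2) unfolding htpy_def by blast
  obtain x v where x: "x \<in> H P (cob X (i + 1))" "v \<in> H P (cob Y i)" "cdiff X (i + 1) * x = 0"
    "y = f (i + 1) * x + cdiff Y i * v"
    using assms(3) P y unfolding hsurj_def by blast
  have "y = g (i + 1) * x + cdiff Y i * (s i * x + v)"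
    unfolding x(4) s(2) by (simp add: distrib_left distrib_right mult.assoc x(3))
  then show "\<exists>x\<in>H P (cob X (i + 1)). \<exists>z\<in>H P (cob Y i).
      cdiff X (i + 1) * x = 0 \<and> y = g (i + 1) * x + cdiff Y i * z"
    using x H_add[OF H_mult[OF x(1) s(1)] x(2)] by blast
qed

lemma qis_htpy: "\<lbrakk>qis X Y f; htpy X Y f g; cmap X Y g\<rbrakk> \<Longrightarrow> qis X Y g"
  using hinj_htpy hsurj_htpy unfolding qis_def by blast

lemma hinj_of_comp:
  assumes "cmap Y Z g" "hinj X Z (\<lambda>i. g i * f i)"
  shows "hinj X Y f"
  unfolding hinj_def
proof (intro ballI allI impI)
  fix P i x y
  assume P: "P \<in> Pr" and x: "x \<in> H P (cob X (i + 1))" "cdiff X (i + 1) * x = 0"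
    and y: "y \<in> H P (cob Y i)" "f (i + 1) * x = cdiff Y i * y"
  have "g (i + 1) * f (i + 1) * x = cdiff Z i * (g i * y)"
    by (simp add: mult.assoc y cmapD(2)[OF assms(1), THEN mult_assoc_eq])
  then show "\<exists>z\<in>H P (cob X i). x = cdiff X i * z"
    using assms(2) P x H_mult[OF y(1) cmapD(1)[OF assms(1)]] unfolding hinj_def by blast
qed

lemma hsurj_of_comp:
  assumes "cmap X Y f" "hsurj X Z (\<lambda>i. g i * f i)"
  shows "hsurj Y Z g"
  unfolding hsurj_def
proof (intro ballI allI impI)
  fix P i z
  assume P: "P \<in> Pr" and z: "z \<in> H P (cob Z (i + 1))" "cdiff Z (i + 1) * z = 0"
  obtain x v where x: "x \<in> H P (cob X (i + 1))" "v \<in> H P (cob Z i)" "cdiff X (i + 1) * x = 0"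
    "z = g (i + 1) * f (i + 1) * x + cdiff Z i * v"
    using assms(2) P z unfolding hsurj_def by blast
  have "cdiff Y (i + 1) * (f (i + 1) * x) = 0"
    by (simp add: cmapD(2)[OF assms(1), THEN mult_assoc_eq] mult.assoc x)
  then show "\<exists>y\<in>H P (cob Y (i + 1)). \<exists>v\<in>H P (cob Z i).
      cdiff Y (i + 1) * y = 0 \<and> z = g (i + 1) * y + cdiff Z i * v"
    using x(2,4) H_mult[OF x(1) cmapD(1)[OF assms(1)]] unfolding mult.assoc by blast
qed

text \<open>Surjectivity of u replaces a cycle y by some u x up to a boundary, and the hypothesis on
  f u applies to x.\<close>

lemma hinj_cancel_right:
  assumes "cmap X Y u" "cmap Y Z f" "hsurj X Y u" "hinj X Z (\<lambda>i. f i * u i)"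
  shows "hinj Y Z f"
  unfolding hinj_def
proof (intro ballI allI impI)
  fix P i y z
  assume P: "P \<in> Pr" and y: "y \<in> H P (cob Y (i + 1))" "cdiff Y (i + 1) * y = 0"
    and z: "z \<in> H P (cob Z i)" "f (i + 1) * y = cdiff Z i * z"
  obtain x v where x: "x \<in> H P (cob X (i + 1))" "v \<in> H P (cob Y i)" "cdiff X (i + 1) * x = 0"
    "y = u (i + 1) * x + cdiff Y i * v"
    using assms(3) P y unfolding hsurj_def by blast
  have "f (i + 1) * u (i + 1) * x = f (i + 1) * (y - cdiff Y i * v)"
    unfolding x(4) by (simp add: mult.assoc)
  also have "\<dots> = cdiff Z i * (z - f i * v)"
    by (simp add: right_diff_distrib z cmapD(2)[OF assms(2), THEN mult_assoc_eq] mult.assoc)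
  finally obtain w where w: "w \<in> H P (cob X i)" "x = cdiff X i * w"
    using assms(4) P x H_diff[OF z(1) H_mult[OF x(2) cmapD(1)[OF assms(2)]]]
    unfolding hinj_def by blast
  have "y = cdiff Y i * (u i * w + v)"
    unfolding x(4) w(2)
    by (simp add: distrib_left cmapD(2)[OF assms(1), THEN mult_assoc_eq] mult.assoc)
  then show "\<exists>z\<in>H P (cob Y i). y = cdiff Y i * z"
    using H_add[OF H_mult[OF w(1) cmapD(1)[OF assms(1)]] x(2)] by blast
qed

text \<open>g y is cohomologous to some g f x, so injectivity of g makes y - f x a boundary.\<close>

lemma hsurj_cancel_left:
  assumes f: "cmap X Y f" and g: "cmap Y Z g" and "hsurj X Z (\<lambda>i. g i * f i)" "hinj Y Z g"
  shows "hsurj X Y f"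
  unfolding hsurj_def
proof (intro ballI allI impI)
  fix P i y
  assume P: "P \<in> Pr" and y: "y \<in> H P (cob Y (i + 1))" "cdiff Y (i + 1) * y = 0"
  have "cdiff Z (i + 1) * (g (i + 1) * y) = 0"
    by (simp add: cmapD(2)[OF g, THEN mult_assoc_eq] mult.assoc y)
  then obtain x w where x: "x \<in> H P (cob X (i + 1))" "w \<in> H P (cob Z i)" "cdiff X (i + 1) * x = 0"
    "g (i + 1) * y = g (i + 1) * f (i + 1) * x + cdiff Z i * w"
    using assms(3) P H_mult[OF y(1) cmapD(1)[OF g]] unfolding hsurj_def by blast
  let ?y = "y - f (i + 1) * x"
  have "cdiff Y (i + 1) * ?y = 0"
    by (simp add: right_diff_distrib cmapD(2)[OF f, THEN mult_assoc_eq] mult.assoc x y)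
  moreover have "g (i + 1) * ?y = cdiff Z i * w" using x(4) by (simp add: right_diff_distrib mult.assoc)
  ultimately obtain v where v: "v \<in> H P (cob Y i)" "?y = cdiff Y i * v"
    using assms(4) P H_diff[OF y(1) H_mult[OF x(1) cmapD(1)[OF f]]] x(2) unfolding hinj_def by blast
  then have "y = f (i + 1) * x + cdiff Y i * v" by (simp add: algebra_simps)
  with v x show "\<exists>x\<in>H P (cob X (i + 1)). \<exists>z\<in>H P (cob Y i).
      cdiff X (i + 1) * x = 0 \<and> y = f (i + 1) * x + cdiff Y i * z" by blast
qed

lemma qis_shift:
  assumes q: "qis X Y f"
  shows "qis (shift n X) (shift n Y) (\<lambda>i. f (i + n))"
proof -
  have c: "i + 1 + n = i + n + 1" for i by simp
  have "hinj (shift n X) (shift n Y) (\<lambda>i. f (i + n))"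
    unfolding hinj_def
  proof (intro ballI allI impI)
    fix P i x y
    assume P: "P \<in> Pr" and x: "x \<in> H P (cob (shift n X) (i + 1))" "cdiff (shift n X) (i + 1) * x = 0"
      and y: "y \<in> H P (cob (shift n Y) i)" "f (i + 1 + n) * x = cdiff (shift n Y) i * y"
    \<comment> \<open>For odd n the shifted differentials carry a sign, which \<open>?e\<close>
      moves to the preimage.\<close>
    let ?e = "\<lambda>u. if even n then u else - u"
    have "x \<in> H P (cob X (i + n + 1))" "cdiff X (i + n + 1) * x = 0"
      using x by (simp_all add: shift_def c split: if_splits)
    moreover have "?e y \<in> H P (cob Y (i + n))" "f (i + n + 1) * x = cdiff Y (i + n) * ?e y"
      using y by (simp_all add: shift_def c H_uminus)
    ultimately obtain z where "z \<in> H P (cob X (i + n))" "x = cdiff X (i + n) * z"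
      using qisD(2)[OF q] P unfolding hinj_def by blast
    then have "?e z \<in> H P (cob (shift n X) i)" "x = cdiff (shift n X) i * ?e z"
      by (simp_all add: shift_def H_uminus)
    then show "\<exists>z\<in>H P (cob (shift n X) i). x = cdiff (shift n X) i * z" by blast
  qed
  moreover have "hsurj (shift n X) (shift n Y) (\<lambda>i. f (i + n))"
    unfolding hsurj_def
  proof (intro ballI allI impI)
    fix P i y
    assume P: "P \<in> Pr" and y: "y \<in> H P (cob (shift n Y) (i + 1))" "cdiff (shift n Y) (i + 1) * y = 0"
    let ?e = "\<lambda>u. if even n then u else - u"
    have "y \<in> H P (cob Y (i + n + 1))" "cdiff Y (i + n + 1) * y = 0"
      using y by (simp_all add: shift_def c split: if_splits)
    then obtain x z where x: "x \<in> H P (cob X (i + n + 1))" "z \<in> H P (cob Y (i + n))"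
      "cdiff X (i + n + 1) * x = 0" "y = f (i + n + 1) * x + cdiff Y (i + n) * z"
      using qisD(3)[OF q] P unfolding hsurj_def by blast
    then have "x \<in> H P (cob (shift n X) (i + 1))" "?e z \<in> H P (cob (shift n Y) i)"
      "cdiff (shift n X) (i + 1) * x = 0" "y = f (i + 1 + n) * x + cdiff (shift n Y) i * ?e z"
      by (simp_all add: shift_def c H_uminus)
    then show "\<exists>x\<in>H P (cob (shift n X) (i + 1)). \<exists>z\<in>H P (cob (shift n Y) i).
        cdiff (shift n X) (i + 1) * x = 0 \<and> y = f (i + 1 + n) * x + cdiff (shift n Y) i * z"
      by blast
  qed
  ultimately show ?thesis using cmap_shift[OF qisD(1)[OF q]] by (simp add: qis_def)
qed

lemma qis_of_htpy_inverse:
  assumes X: "cx X" and Y: "cx Y" and u: "cmap X Y u" and v: "cmap Y X v"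
    and vu: "htpy X X (\<lambda>i. v i * u i) (\<lambda>i. e (cob X i))"
    and uv: "htpy Y Y (\<lambda>i. u i * v i) (\<lambda>i. e (cob Y i))"
  shows "qis X Y u"
proof -
  have "hinj X X (\<lambda>i. v i * u i)"
    by (rule hinj_htpy[OF cmap_id[OF X] htpy_sym[OF vu] qisD(2)[OF qis_id[OF X]]])
  then have "hinj X Y u" by (rule hinj_of_comp[OF v])
  moreover have "hsurj Y Y (\<lambda>i. u i * v i)"
    by (rule hsurj_htpy[OF cmap_id[OF Y] htpy_sym[OF uv] qisD(3)[OF qis_id[OF Y]]])
  then have "hsurj X Y u" by (rule hsurj_of_comp[OF v])
  ultimately show ?thesis using u by (simp add: qis_def)
qed

text \<open>Saturation: a roof \<open>(Z, s, f)\<close> that is invertible in the localization has \<open>f\<close> a quasi-isomorphism.\<close>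

lemma qis_of_inverse_roof:
  assumes s: "qis Z X s" and f: "cmap Z Y f" and s': "qis Z' Y s'" and g: "cmap Z' X g"
    and u: "qis U Z u" and v: "cmap U Z' v" and sq: "htpy U Y (\<lambda>i. f i * u i) (\<lambda>i. s' i * v i)"
    and gv: "cmap V U a" "hinj V X (\<lambda>i. g i * (v i * a i))" "hsurj V U a"
    and v': "cmap U' Z v'" and fv': "cmap V' U' a'" "hsurj V' Y (\<lambda>i. f i * (v' i * a' i))"
  shows "qis Z Y f"
proof -
  have "hsurj Z Y f" by (rule hsurj_of_comp[OF cmap_comp[OF fv'(1) v'] fv'(2)])
  \<comment> \<open>Injectivity travels around the square: from g v a to v a and back across a to v,
    on through s' to f u, and back across u to f.\<close>
  moreover have "hinj V Z' (\<lambda>i. v i * a i)" by (rule hinj_of_comp[OF g gv(2)])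
  then have "hinj U Z' v" by (rule hinj_cancel_right[OF gv(1) v gv(3)])
  then have "hinj U Y (\<lambda>i. s' i * v i)" by (rule hinj_comp[OF v _ qisD(2)[OF s']])
  then have "hinj U Y (\<lambda>i. f i * u i)"
    by (rule hinj_htpy[OF cmap_comp[OF v qisD(1)[OF s']] htpy_sym[OF sq]])
  then have "hinj Z Y f" by (rule hinj_cancel_right[OF qisD(1)[OF u] f qisD(3)[OF u]])
  ultimately show ?thesis using f by (simp add: qis_def)
qed

lemma qis_section:
  assumes "cx X" "cx P" "\<And>i. cob P i \<in> Pr" "qis X P s"
  shows "\<exists>v. cmap P X v \<and> htpy P P (\<lambda>i. e (cob P i)) (\<lambda>i. s i * v i)"
  by (rule qis_lift[OF assms(1,2,4,2,3) cmap_id[OF assms(2)]])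

text \<open>t has a homotopy section v, since its target is a complex of objects of
  \<open>Pr\<close>; composing the given null homotopy with v removes t.\<close>

lemma null_of_qis_null:
  assumes U: "cx U" and P: "cx P" "\<And>i. cob P i \<in> Pr" and Y: "cx Y" and t: "qis U P t"
    and x: "cmap P Y x" and null: "htpy U Y (\<lambda>i. x i * t i) (\<lambda>i. 0)"
  shows "htpy P Y x (\<lambda>i. 0)"
proof -
  obtain v where v: "cmap P U v" "htpy P P (\<lambda>i. e (cob P i)) (\<lambda>i. t i * v i)"
    using qis_section[OF U P t] by blast
  have "htpy P Y x (\<lambda>i. x i * (t i * v i))"
    using htpy_comp_left[OF v(2) x] by (simp add: e_right[OF cmapD(1)[OF x]])
  moreover have "htpy P Y (\<lambda>i. x i * (t i * v i)) (\<lambda>i. 0)"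
    using htpy_comp_right[OF null v(1)] by (simp add: mult.assoc)
  ultimately show ?thesis by (rule htpy_trans)
qed

text \<open>Homotopy classes of maps from P do not see s: lifting gives surjectivity. For
  injectivity, \<open>qis_cancel\<close> makes x null after a quasi-isomorphism onto P, and
  \<open>null_of_qis_null\<close> removes that.\<close>

lemma no_maps_qis_iff:
  assumes P: "cx P" "\<And>i. cob P i \<in> Pr" and X: "cx X" and Y: "cx Y" and s: "qis X Y s"
  shows "no_maps P X \<longleftrightarrow> no_maps P Y"
proof
  assume no: "no_maps P X"
  show "no_maps P Y"
    unfolding no_maps_def
  proof (intro allI impI)
    fix x assume x: "cmap P Y x"
    obtain v where v: "cmap P X v" "htpy P Y x (\<lambda>i. s i * v i)"
      using qis_lift[OF X Y s P x] by blast
    then have "htpy P X v (\<lambda>i. 0)" using no by (simp add: no_maps_def)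
    from htpy_comp_left[OF this qisD(1)[OF s]] have "htpy P Y (\<lambda>i. s i * v i) (\<lambda>i. 0)" by simp
    with v(2) show "htpy P Y x (\<lambda>i. 0)" by (rule htpy_trans)
  qed
next
  assume no: "no_maps P Y"
  show "no_maps P X"
    unfolding no_maps_def
  proof (intro allI impI)
    fix x assume x: "cmap P X x"
    have "htpy P Y (\<lambda>i. s i * x i) (\<lambda>i. s i * 0)"
      using no cmap_comp[OF x qisD(1)[OF s]] by (simp add: no_maps_def)
    then obtain U t where U: "cx U" "qis U P t" "htpy U X (\<lambda>i. x i * t i) (\<lambda>i. 0 * t i)"
      using qis_cancel[OF P(1) X Y x cmap_zero[OF P(1) X] s] by blast
    then show "htpy P X x (\<lambda>i. 0)" using null_of_qis_null[OF U(1) P X U(2) x] by simp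
  qed
qed

section \<open>Kernels, cokernels and cohomology in the ring\<close>

definition rmono :: "'o \<Rightarrow> 'o \<Rightarrow> 'r \<Rightarrow> bool"
  where "rmono X Y f \<longleftrightarrow> f \<in> H X Y \<and> (\<forall>T. \<forall>g\<in>H T X. f * g = 0 \<longrightarrow> g = 0)"

definition repi :: "'o \<Rightarrow> 'o \<Rightarrow> 'r \<Rightarrow> bool"
  where "repi X Y f \<longleftrightarrow> f \<in> H X Y \<and> (\<forall>T. \<forall>g\<in>H Y T. g * f = 0 \<longrightarrow> g = 0)"

text \<open>Uniqueness of the factorisation is stored as monicity of j, which in additive form
  concerns zero composites only; \<open>rcok\<close> treats cokernels alike.\<close>

definition rker :: "'o \<Rightarrow> 'o \<Rightarrow> 'r \<Rightarrow> 'o \<Rightarrow> 'r \<Rightarrow> bool"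
  where "rker X Y f N j \<longleftrightarrow> f \<in> H X Y \<and> rmono N X j \<and> f * j = 0 \<and>
    (\<forall>T. \<forall>u\<in>H T X. f * u = 0 \<longrightarrow> (\<exists>v\<in>H T N. j * v = u))"

definition rcok :: "'o \<Rightarrow> 'o \<Rightarrow> 'r \<Rightarrow> 'o \<Rightarrow> 'r \<Rightarrow> bool"
  where "rcok X Y f Q p \<longleftrightarrow> f \<in> H X Y \<and> repi Y Q p \<and> p * f = 0 \<and>
    (\<forall>T. \<forall>u\<in>H Y T. u * f = 0 \<longrightarrow> (\<exists>v\<in>H Q T. v * p = u))"

text \<open>The cohomology in degree i + 1, in line with the other conditions. The map b induced by
  the incoming differential is kept as data.\<close>

definition rcoh :: "('o, 'r) cplx \<Rightarrow> int \<Rightarrow> 'o \<Rightarrow> 'r \<Rightarrow> 'r \<Rightarrow> 'o \<Rightarrow> 'r \<Rightarrow> bool"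
  where "rcoh X i N j b L p \<longleftrightarrow>
    rker (cob X (i + 1)) (cob X (i + 1 + 1)) (cdiff X (i + 1)) N j \<and>
    b \<in> H (cob X i) N \<and> j * b = cdiff X i \<and> rcok (cob X i) N b L p"

lemma rmonoD: "rmono X Y f \<Longrightarrow> g \<in> H T X \<Longrightarrow> h \<in> H T X \<Longrightarrow> f * g = f * h \<Longrightarrow> g = h"
  unfolding rmono_def using H_diff[of g T X h] by (metis eq_iff_diff_eq_0 right_diff_distrib)

lemma repiD: "repi X Y f \<Longrightarrow> g \<in> H Y T \<Longrightarrow> h \<in> H Y T \<Longrightarrow> g * f = h * f \<Longrightarrow> g = h"
  unfolding repi_def using H_diff[of g Y T h] by (metis eq_iff_diff_eq_0 left_diff_distrib)

lemma rmono_comp: "\<lbrakk>rmono X Y f; rmono Y Z g\<rbrakk> \<Longrightarrow> rmono X Z (g * f)"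
  unfolding rmono_def by (metis H_mult mult.assoc)

end

locale ring_abelian_category = ring_category +
  assumes ex_rker: "f \<in> H X Y \<Longrightarrow> \<exists>N j. rker X Y f N j"
    and ex_rcok: "f \<in> H X Y \<Longrightarrow> \<exists>Q p. rcok X Y f Q p"
    and rmono_is_rker: "rmono X Y f \<Longrightarrow> \<exists>Z g. rker Y Z g X f"
    and Pr_lift: "\<lbrakk>P \<in> Pr; repi X Y p; f \<in> H P Y\<rbrakk> \<Longrightarrow> \<exists>g\<in>H P X. p * g = f"
    and enough_Pr: "X \<in> Obj \<Longrightarrow> \<exists>P\<in>Pr. \<exists>p. repi P X p"
begin

text \<open>Exactness at Y on generalised elements: b maps onto its image, the kernel K of p, and y
  factors through K, so projectivity lifts it. The work is to show that the corestriction e' of b to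
  K is epi.\<close>

lemma rcok_lift:
  assumes cok: "rcok X Y b Q p" and P: "P \<in> Pr" and y: "y \<in> H P Y" "p * y = 0"
  shows "\<exists>a\<in>H P X. b * a = y"
proof -
  have b: "b \<in> H X Y" and p: "p \<in> H Y Q" and pb: "p * b = 0"
    using cok by (auto simp: rcok_def repi_def)
  obtain K m where m: "rker Y Q p K m" using ex_rker[OF p] by blast
  then have mono: "rmono K Y m" and mH: "m \<in> H K Y" and pm: "p * m = 0"
    by (auto simp: rker_def rmono_def)
  obtain e' where e': "e' \<in> H X K" "m * e' = b" using m b pb unfolding rker_def by blast
  have "repi X K e'"
    unfolding repi_def
  proof (intro conjI allI ballI impI e'(1))
    fix T g assume g: "g \<in> H K T" "g * e' = 0"
    obtain L n where n: "rker K T g L n" using ex_rker[OF g(1)] by blast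
    then have nmono: "rmono L K n" and nH: "n \<in> H L K" and gn: "g * n = 0"
      by (auto simp: rker_def rmono_def)
    obtain e'' where e'': "e'' \<in> H X L" "n * e'' = e'" using n e'(1) g(2) unfolding rker_def by blast
    \<comment> \<open>m n is monic and hence a kernel of some q. As q kills b, it factors through p
      and kills m too. So m factors through m n, which splits n, and then g n = 0 forces g =
      0.\<close>
    obtain W q where q: "rker Y W q L (m * n)"
      using rmono_is_rker[OF rmono_comp[OF nmono mono]] by blast
    then have qH: "q \<in> H Y W" and qmn: "q * (m * n) = 0" by (auto simp: rker_def)
    have "q * b = q * (m * n) * e''"
      by (simp add: e'(2)[symmetric] e''(2)[symmetric] mult.assoc)
    then have "q * b = 0" by (simp add: qmn)
    then obtain q' where "q' \<in> H Q W" "q' * p = q" using cok qH unfolding rcok_def by blast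
    then have "q * m = 0" by (metis mult.assoc mult_zero_right pm)
    then obtain r where r: "r \<in> H K L" "m * n * r = m" using q mH unfolding rker_def by blast
    have K: "K \<in> Obj" using H_Obj[OF mH] by blast
    have "n * r = e K"
      by (rule rmonoD[OF mono H_mult[OF r(1) nH] e_hom[OF K]])
        (simp add: r(2)[unfolded mult.assoc] e_right[OF mH])
    then have "g = g * n * r" by (simp add: mult.assoc e_right[OF g(1)])
    then show "g = 0" by (simp add: gn)
  qed
  moreover obtain y' where y': "y' \<in> H P K" "m * y' = y" using m y unfolding rker_def by blast
  ultimately obtain a where "a \<in> H P X" "e' * a = y'" using Pr_lift[OF P] by blast
  with y' e' show ?thesis by (metis mult.assoc)
qed

text \<open>A mono is the kernel of some k; as k f = 0 and f is epi, k = 0, so the identity of Y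
  factors through f.\<close>

lemma rmono_repi_iso:
  assumes mono: "rmono X Y f" and epi: "repi X Y f"
  shows "\<exists>g\<in>H Y X. g * f = e X \<and> f * g = e Y"
proof -
  have f: "f \<in> H X Y" using mono by (simp add: rmono_def)
  then have XY: "X \<in> Obj" "Y \<in> Obj" using H_Obj by blast+
  obtain Z k where k: "rker Y Z k X f" using rmono_is_rker[OF mono] by blast
  then have "k = 0" using epi unfolding rker_def repi_def by blast
  then obtain g where g: "g \<in> H Y X" "f * g = e Y"
    using k e_hom[OF XY(2)] unfolding rker_def by (metis mult_zero_left)
  have "g * f = e X"
    by (rule rmonoD[OF mono H_mult[OF f g(1)] e_hom[OF XY(1)]])
      (simp add: mult.assoc[symmetric] g(2) e_left[OF f] e_right[OF f])
  with g show ?thesis by blast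
qed

lemma ex_rcoh:
  assumes "cx X"
  shows "\<exists>N j b L p. rcoh X i N j b L p"
proof -
  obtain N j where j: "rker (cob X (i + 1)) (cob X (i + 1 + 1)) (cdiff X (i + 1)) N j"
    using ex_rker[OF cxD(2)[OF assms]] by blast
  then obtain b where b: "b \<in> H (cob X i) N" "j * b = cdiff X i"
    using cxD(2,3)[OF assms] unfolding rker_def by blast
  obtain L p where "rcok (cob X i) N b L p" using ex_rcok[OF b(1)] by blast
  with j b show ?thesis unfolding rcoh_def by blast
qed

lemma rcohD:
  assumes "rcoh X i N j b L p"
  shows "j \<in> H N (cob X (i + 1))" "b \<in> H (cob X i) N" "p \<in> H N L" "j * b = cdiff X i"
    "cdiff X (i + 1) * j = 0" "p * b = 0" "rmono N (cob X (i + 1)) j" "repi N L p"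
    "rcok (cob X i) N b L p"
  using assms by (auto simp: rcoh_def rker_def rcok_def rmono_def repi_def)

lemma rcoh_lift:
  assumes "rcoh X i N j b L p" "x \<in> H P (cob X (i + 1))" "cdiff X (i + 1) * x = 0"
  shows "\<exists>n\<in>H P N. j * n = x"
  using assms unfolding rcoh_def rker_def by blast

lemma rcoh_square:
  assumes f: "cmap X Y f" and c: "rcoh X i N j b L p" and c': "rcoh Y i N' j' b' L' p'"
    and z: "z \<in> H N N'" "j' * z = f (i + 1) * j"
  shows "z * b = b' * f i"
  by (rule rmonoD[OF rcohD(7)[OF c'] H_mult[OF rcohD(2)[OF c] z(1)]
        H_mult[OF cmapD(1)[OF f] rcohD(2)[OF c']]])
    (simp add: z(2)[THEN mult_assoc_eq] mult.assoc rcohD(4)[OF c] rcohD(4)[OF c', THEN mult_assoc_eq]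
      cmapD(2)[OF f])

lemma rcoh_map_exists:
  assumes f: "cmap X Y f" and c: "rcoh X i N j b L p" and c': "rcoh Y i N' j' b' L' p'"
  shows "\<exists>z\<in>H N N'. \<exists>h\<in>H L L'. j' * z = f (i + 1) * j \<and> h * p = p' * z"
proof -
  have "cdiff Y (i + 1) * (f (i + 1) * j) = 0"
    by (simp add: cmapD(2)[OF f, THEN mult_assoc_eq] mult.assoc rcohD(5)[OF c])
  then obtain z where z: "z \<in> H N N'" "j' * z = f (i + 1) * j"
    using rcoh_lift[OF c' H_mult[OF rcohD(1)[OF c] cmapD(1)[OF f]]] by blast
  have "p' * z * b = 0"
    by (simp add: mult.assoc rcoh_square[OF f c c' z] rcohD(6)[OF c', THEN mult_assoc_eq])
  then obtain h where "h \<in> H L L'" "h * p = p' * z"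
    using rcohD(9)[OF c] H_mult[OF z(1) rcohD(3)[OF c']] unfolding rcok_def by blast
  with z show ?thesis by blast
qed

text \<open>By \<open>rmono_repi_iso\<close> it suffices that h is mono and epi. Classes are lifted
  to cycles along p, and vanishing classes to boundaries by \<open>rcok_lift\<close>; both are
  possible on maps from projectives.\<close>

lemma qis_imp_coh_iso:
  assumes q: "qis X Y f" and c: "rcoh X i N j b L p" and c': "rcoh Y i N' j' b' L' p'"
    and z: "z \<in> H N N'" "j' * z = f (i + 1) * j" and h: "h \<in> H L L'" "h * p = p' * z"
  shows "\<exists>g\<in>H L' L. g * h = e L \<and> h * g = e L'"
proof (rule rmono_repi_iso)
  note f = qisD(1)[OF q]
  note C = rcohD[OF c] and C' = rcohD[OF c']
  show "rmono L L' h"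
    unfolding rmono_def
  proof (intro conjI h(1) allI ballI impI)
    fix T g assume g: "g \<in> H T L" "h * g = 0"
    \<comment> \<open>Covering T by a projective makes g q a generalised element of L, which lifts
      to a cycle n.\<close>
    obtain P q where P: "P \<in> Pr" and q': "repi P T q" using enough_Pr H_Obj[OF g(1)] by blast
    then have qH: "q \<in> H P T" by (simp add: repi_def)
    obtain n where n: "n \<in> H P N" "p * n = g * q" using Pr_lift[OF P C(8) H_mult[OF qH g(1)]] by blast
    have "p' * (z * n) = h * (p * n)" by (simp add: h(2)[THEN mult_assoc_eq] mult.assoc)
    then have "p' * (z * n) = 0" by (simp add: n(2) g(2)[THEN mult_assoc_eq])
    then obtain y where y: "y \<in> H P (cob Y i)" "b' * y = z * n"
      using rcok_lift[OF C'(9) P H_mult[OF n(1) z(1)]] by blast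
    have "f (i + 1) * (j * n) = cdiff Y i * y"
      by (simp add: C'(4)[symmetric] mult.assoc y(2) z(2)[THEN mult_assoc_eq])
    moreover have "cdiff X (i + 1) * (j * n) = 0" by (simp add: C(5)[THEN mult_assoc_eq])
    ultimately obtain x where x: "x \<in> H P (cob X i)" "j * n = cdiff X i * x"
      using qisD(2)[OF q] P H_mult[OF n(1) C(1)] y(1) unfolding hinj_def by blast
    have "n = b * x"
      by (rule rmonoD[OF C(7) n(1) H_mult[OF x(1) C(2)]]) (simp add: x(2) C(4)[THEN mult_assoc_eq])
    then have "g * q = 0" using n(2) C(6)[THEN mult_assoc_eq] by simp
    then show "g = 0" using q' g(1) unfolding repi_def by blast
  qed
  show "repi L L' h"
    unfolding repi_def
  proof (intro conjI h(1) allI ballI impI)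
    fix T g assume g: "g \<in> H L' T" "g * h = 0"
    obtain P q where P: "P \<in> Pr" and q': "repi P L' q" using enough_Pr H_Obj[OF g(1)] by blast
    then have qH: "q \<in> H P L'" by (simp add: repi_def)
    obtain n' where n': "n' \<in> H P N'" "p' * n' = q" using Pr_lift[OF P C'(8) qH] by blast
    have "cdiff Y (i + 1) * (j' * n') = 0" by (simp add: C'(5)[THEN mult_assoc_eq])
    then obtain x w where x: "x \<in> H P (cob X (i + 1))" "w \<in> H P (cob Y i)" "cdiff X (i + 1) * x = 0"
      "j' * n' = f (i + 1) * x + cdiff Y i * w"
      using qisD(3)[OF q] P H_mult[OF n'(1) C'(1)] unfolding hsurj_def by blast
    obtain n where n: "n \<in> H P N" "j * n = x" using rcoh_lift[OF c x(1,3)] by blast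
    have "n' = z * n + b' * w"
      by (rule rmonoD[OF C'(7) n'(1) H_add[OF H_mult[OF n(1) z(1)] H_mult[OF x(2) C'(2)]]])
        (simp add: x(4) distrib_left z(2)[THEN mult_assoc_eq] C'(4)[THEN mult_assoc_eq] mult.assoc n(2))
    then have "q = h * (p * n)"
      by (simp add: n'(2)[symmetric] distrib_left C'(6)[THEN mult_assoc_eq] h(2)[THEN mult_assoc_eq]
          mult.assoc)
    then have "g * q = 0" by (simp add: g(2)[THEN mult_assoc_eq])
    then show "g = 0" using q' g(1) unfolding repi_def by blast
  qed
qed

text \<open>A single choice of cohomology objects suffices for the chase: injectivity of h gives
  \<open>hinj\<close>, and its inverse g supplies the class needed for \<open>hsurj\<close>.\<close>

lemma coh_iso_imp_qis:
  assumes X: "cx X" and Y: "cx Y" and f: "cmap X Y f"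
    and iso: "\<And>i N j b L p N' j' b' L' p' z h.
      \<lbrakk>rcoh X i N j b L p; rcoh Y i N' j' b' L' p'; z \<in> H N N'; j' * z = f (i + 1) * j;
       h \<in> H L L'; h * p = p' * z\<rbrakk> \<Longrightarrow> \<exists>g\<in>H L' L. g * h = e L \<and> h * g = e L'"
  shows "qis X Y f"
proof -
  { fix P i assume P: "P \<in> Pr"
    obtain N j b L p where c: "rcoh X i N j b L p" using ex_rcoh[OF X] by blast
    obtain N' j' b' L' p' where c': "rcoh Y i N' j' b' L' p'" using ex_rcoh[OF Y] by blast
    obtain z h where z: "z \<in> H N N'" "j' * z = f (i + 1) * j" and h: "h \<in> H L L'" "h * p = p' * z"
      using rcoh_map_exists[OF f c c'] by blast
    obtain g where g: "g \<in> H L' L" "g * h = e L" "h * g = e L'" using iso[OF c c' z h] by blast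
    note C = rcohD[OF c] and C' = rcohD[OF c']
    have "\<exists>a\<in>H P (cob X i). x = cdiff X i * a"
      if x: "x \<in> H P (cob X (i + 1))" "cdiff X (i + 1) * x = 0"
        and y: "y \<in> H P (cob Y i)" "f (i + 1) * x = cdiff Y i * y" for x y
    proof -
      obtain n where n: "n \<in> H P N" "j * n = x" using rcoh_lift[OF c x] by blast
      have "z * n = b' * y"
        by (rule rmonoD[OF C'(7) H_mult[OF n(1) z(1)] H_mult[OF y(1) C'(2)]])
          (simp add: z(2)[THEN mult_assoc_eq] mult.assoc n(2) y(2) C'(4)[THEN mult_assoc_eq])
      then have "h * (p * n) = 0"
        by (simp add: h(2)[THEN mult_assoc_eq] mult.assoc C'(6)[THEN mult_assoc_eq])
      then have "e L * (p * n) = 0" by (simp add: g(2)[symmetric] mult.assoc)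
      then have "p * n = 0" by (simp add: e_left[OF H_mult[OF n(1) C(3)]])
      then obtain a where "a \<in> H P (cob X i)" "b * a = n" using rcok_lift[OF C(9) P n(1)] by blast
      then show ?thesis using n(2) C(4)[THEN mult_assoc_eq] by auto
    qed
    moreover have "\<exists>x\<in>H P (cob X (i + 1)). \<exists>w\<in>H P (cob Y i).
        cdiff X (i + 1) * x = 0 \<and> y = f (i + 1) * x + cdiff Y i * w"
      if y: "y \<in> H P (cob Y (i + 1))" "cdiff Y (i + 1) * y = 0" for y
    proof -
      obtain n' where n': "n' \<in> H P N'" "j' * n' = y" using rcoh_lift[OF c' y] by blast
      note q = H_mult[OF n'(1) C'(3)]
      obtain n where n: "n \<in> H P N" "p * n = g * (p' * n')"
        using Pr_lift[OF P C(8) H_mult[OF q g(1)]] by blast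
      have "p' * (z * n) = h * (p * n)" by (simp add: h(2)[THEN mult_assoc_eq] mult.assoc)
      also have "\<dots> = p' * n'" by (simp add: n(2) g(3)[THEN mult_assoc_eq] e_left[OF q])
      finally have "p' * (n' - z * n) = 0" by (simp add: right_diff_distrib)
      then obtain w where w: "w \<in> H P (cob Y i)" "b' * w = n' - z * n"
        using rcok_lift[OF C'(9) P H_diff[OF n'(1) H_mult[OF n(1) z(1)]]] by blast
      have "y - f (i + 1) * (j * n) = j' * (n' - z * n)"
        by (simp add: right_diff_distrib n'(2) z(2)[THEN mult_assoc_eq] mult.assoc)
      also have "\<dots> = cdiff Y i * w" by (simp add: w(2)[symmetric] C'(4)[THEN mult_assoc_eq])
      finally have "y = f (i + 1) * (j * n) + cdiff Y i * w" by (simp add: algebra_simps)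
      moreover have "cdiff X (i + 1) * (j * n) = 0" by (simp add: C(5)[THEN mult_assoc_eq])
      ultimately show ?thesis using w(1) H_mult[OF n(1) C(1)] by blast
    qed
    ultimately have "(\<forall>x\<in>H P (cob X (i + 1)). \<forall>y\<in>H P (cob Y i). cdiff X (i + 1) * x = 0 \<longrightarrow>
        f (i + 1) * x = cdiff Y i * y \<longrightarrow> (\<exists>z\<in>H P (cob X i). x = cdiff X i * z)) \<and>
      (\<forall>y\<in>H P (cob Y (i + 1)). cdiff Y (i + 1) * y = 0 \<longrightarrow>
        (\<exists>x\<in>H P (cob X (i + 1)). \<exists>z\<in>H P (cob Y i).
          cdiff X (i + 1) * x = 0 \<and> y = f (i + 1) * x + cdiff Y i * z))"
      by blast }
  then show ?thesis unfolding qis_def hinj_def hsurj_def using f by blast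
qed

end

section \<open>Complexes over an abelian category with enough projectives\<close>

locale enough_projectives_category = abelian_category C
  for C :: "('o, 'm, 'k::field, 'z) lincat_scheme" (structure) +
  assumes enough_projectives: "enough_projectives C"
begin

text \<open>Empty unless both arguments are objects: this is what makes \<open>H_Obj\<close> true,
  so that membership in a Hom set carries all typing information.\<close>

definition opHom :: "'o \<Rightarrow> 'o \<Rightarrow> ('o, 'm) group_family endomorphism set"
  where "opHom X Y = (if X \<in> Ob C \<and> Y \<in> Ob C then op ` Hom C X Y else {})"

lemma opHomI: "\<lbrakk>f \<in> Hom C X Y; X \<in> Ob C; Y \<in> Ob C\<rbrakk> \<Longrightarrow> op f \<in> opHom X Y"
  by (simp add: opHom_def)

lemma opHomE:
  assumes "r \<in> opHom X Y"
  obtains f where "X \<in> Ob C" "Y \<in> Ob C" "f \<in> Hom C X Y" "r = op f"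
  using assms by (auto simp: opHom_def split: if_splits)

lemma zero_obj_iff:
  assumes "X \<in> Ob C"
  shows "is_zero_obj C X \<longleftrightarrow> op (Id C X) = 0"
proof
  assume "is_zero_obj C X"
  then have "Id C X = Zero C X X" using Id_hom[OF assms] by (auto simp: is_zero_obj_def)
  then show "op (Id C X) = 0" using op_Zero assms by simp
next
  assume z: "op (Id C X) = 0"
  have "Id C X = Zero C X X"
    by (rule op_inj[OF assms assms Id_hom[OF assms] Zero_hom[OF assms assms]]) (simp add: z op_Zero assms)
  then have "f = Zero C X Y" "g = Zero C Y X" if "Y \<in> Ob C" "f \<in> Hom C X Y" "g \<in> Hom C Y X" for Y f g
    using that assms Comp_Id[of X Y f] Id_Comp[of Y X g] Comp_Zero[of X X Y f] Comp_Zero_left[of Y X X g]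
    by auto
  then show "is_zero_obj C X"
    using assms Zero_hom unfolding is_zero_obj_def by blast
qed

sublocale R: ring_category "Ob C" opHom "\<lambda>X. op (Id C X)" "{P. projective_obj C P}"
proof
  fix X Y f g assume fg: "f \<in> opHom X Y" "g \<in> opHom X Y"
  obtain f' where f: "X \<in> Ob C" "Y \<in> Ob C" "f' \<in> Hom C X Y" "f = op f'" using fg(1) by (rule opHomE)
  obtain g' where g: "g' \<in> Hom C X Y" "g = op g'" using fg(2) by (rule opHomE)
  show "X \<in> Ob C \<and> Y \<in> Ob C" using f by simp
  show "f + g \<in> opHom X Y"
    using opHomI[OF Plus_hom[OF f(1-3) g(1)] f(1,2)] op_Plus[OF f(1-3) g(1)] f(4) g(2) by simp
  show "- f \<in> opHom X Y"
    using opHomI[OF Scale_hom[OF f(1-3)] f(1,2)] op_minus[OF f(1-3)] f(4) by metis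
  show "op (Id C Y) * f = f"
    using op_Comp[OF f(1,2,2,3) Id_hom[OF f(2)]] Id_Comp[OF f(1-3)] f(4) by simp
  show "f * op (Id C X) = f"
    using op_Comp[OF f(1,1,2) Id_hom[OF f(1)] f(3)] Comp_Id[OF f(1-3)] f(4) by simp
next
  fix X Y assume XY: "X \<in> Ob C" "Y \<in> Ob C"
  show "0 \<in> opHom X Y" using opHomI[OF Zero_hom[OF XY] XY] op_Zero[OF XY] by simp
next
  fix X Y Z f g assume fg: "f \<in> opHom X Y" "g \<in> opHom Y Z"
  obtain f' where f: "X \<in> Ob C" "Y \<in> Ob C" "f' \<in> Hom C X Y" "f = op f'" using fg(1) by (rule opHomE)
  obtain g' where g: "Z \<in> Ob C" "g' \<in> Hom C Y Z" "g = op g'" using fg(2) by (rule opHomE)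
  show "g * f \<in> opHom X Z"
    using opHomI[OF Comp_hom[OF f(1,2) g(1) f(3) g(2)] f(1) g(1)] op_Comp[OF f(1,2) g(1) f(3) g(2)] f(4) g(3)
    by simp
next
  fix X assume "X \<in> Ob C"
  then show "op (Id C X) \<in> opHom X X" by (simp add: opHomI Id_hom)
next
  fix P assume "P \<in> {P. projective_obj C P}"
  then show "P \<in> Ob C" by (simp add: projective_obj_def)
next
  obtain Z where Z: "is_zero_obj C Z" using ex_zero_obj by blast
  then have ZOb: "Z \<in> Ob C" by (simp add: is_zero_obj_def)
  have "projective_obj C Z"
    unfolding projective_obj_def
  proof (intro conjI ballI allI impI)
    fix X Y e f assume XY: "X \<in> Ob C" "Y \<in> Ob C" and e: "is_epi C X Y e" and f: "f \<in> Hom C Z Y"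
    have "f = Zero C Z Y" using f Z XY by (auto simp: is_zero_obj_def)
    then have "e \<cdot> Zero C Z X = f" using Comp_Zero[of Z X Y e] e XY ZOb by (simp add: is_epi_def)
    then show "\<exists>g\<in>Hom C Z X. e \<cdot> g = f" using Zero_hom[OF ZOb XY(1)] by blast
  qed (rule ZOb)
  then show "\<exists>P\<in>{P. projective_obj C P}. op (Id C P) = 0" using Z ZOb zero_obj_iff by blast
next
  fix X Y assume XY: "X \<in> Ob C" "Y \<in> Ob C"
  obtain S i\<^sub>1 i\<^sub>2 p\<^sub>1 p\<^sub>2 where b: "is_biproduct C X Y S i\<^sub>1 i\<^sub>2 p\<^sub>1 p\<^sub>2" using ex_biproduct[OF XY] by blast
  then have b': "S \<in> Ob C" "i\<^sub>1 \<in> Hom C X S" "i\<^sub>2 \<in> Hom C Y S" "p\<^sub>1 \<in> Hom C S X" "p\<^sub>2 \<in> Hom C S Y"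
    by (auto simp: is_biproduct_def)
  have "op p\<^sub>1 * op i\<^sub>1 = op (Id C X)" "op p\<^sub>2 * op i\<^sub>2 = op (Id C Y)" "op p\<^sub>1 * op i\<^sub>2 = 0"
    "op p\<^sub>2 * op i\<^sub>1 = 0" "op i\<^sub>1 * op p\<^sub>1 + op i\<^sub>2 * op p\<^sub>2 = op (Id C S)"
    using b b' XY Comp_hom[of S X S p\<^sub>1 i\<^sub>1] Comp_hom[of S Y S p\<^sub>2 i\<^sub>2]
    by (auto simp: is_biproduct_def op_Comp[symmetric] op_Plus[symmetric] op_Zero)
  then show "\<exists>S\<in>Ob C. \<exists>i\<^sub>1\<in>opHom X S. \<exists>i\<^sub>2\<in>opHom Y S. \<exists>p\<^sub>1\<in>opHom S X. \<exists>p\<^sub>2\<in>opHom S Y.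
      p\<^sub>1 * i\<^sub>1 = op (Id C X) \<and> p\<^sub>2 * i\<^sub>2 = op (Id C Y) \<and> p\<^sub>1 * i\<^sub>2 = 0 \<and> p\<^sub>2 * i\<^sub>1 = 0 \<and>
      i\<^sub>1 * p\<^sub>1 + i\<^sub>2 * p\<^sub>2 = op (Id C S)"
    using b' XY opHomI by blast
qed

text \<open>The bridge for commuting squares and triangles: with all maps typed, identities in
  \<open>C\<close> and in the ring are interchangeable.\<close>

lemma Comp_eq_iff:
  assumes "X \<in> Ob C" "Y \<in> Ob C" "Z \<in> Ob C" "f \<in> Hom C X Y" "g \<in> Hom C Y Z" "h \<in> Hom C X Z"
  shows "g \<cdot> f = h \<longleftrightarrow> op g * op f = op h"
  using op_eq_iff[of X Z "g \<cdot> f" h] op_Comp[of X Y Z f g] Comp_hom[of X Y Z f g] assms by auto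

lemma is_mono_iff:
  assumes XY: "X \<in> Ob C" "Y \<in> Ob C" and f: "f \<in> Hom C X Y"
  shows "is_mono C X Y f \<longleftrightarrow> R.rmono X Y (op f)"
proof
  assume m: "is_mono C X Y f"
  show "R.rmono X Y (op f)"
    unfolding R.rmono_def
  proof (intro conjI allI ballI impI opHomI f XY)
    fix T r assume "r \<in> opHom T X" and 0: "op f * r = 0"
    then obtain g where g: "T \<in> Ob C" "g \<in> Hom C T X" "r = op g" by (elim opHomE)
    note z = Zero_hom[OF g(1) XY(1)]
    have "f \<cdot> g = f \<cdot> Zero C T X"
      using Comp_eq_iff[OF g(1) XY g(2) f Zero_hom[OF g(1) XY(2)]] Comp_Zero[OF g(1) XY f] 0 g
        op_Zero[OF g(1) XY(2)] by simp
    then show "r = 0" using m g z op_Zero[OF g(1) XY(1)] unfolding is_mono_def by metis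
  qed
next
  assume m: "R.rmono X Y (op f)"
  show "is_mono C X Y f"
    unfolding is_mono_def
  proof (intro conjI ballI impI f)
    fix T g h assume T: "T \<in> Ob C" and g: "g \<in> Hom C T X" and h: "h \<in> Hom C T X"
      and eq: "f \<cdot> g = f \<cdot> h"
    have "op f * op g = op f * op h" using eq op_Comp[OF T XY g f] op_Comp[OF T XY h f] by simp
    then show "g = h"
      using R.rmonoD[OF m opHomI opHomI] op_inj[OF T XY(1) g h] T XY g h by blast
  qed
qed

lemma is_epi_iff:
  assumes XY: "X \<in> Ob C" "Y \<in> Ob C" and f: "f \<in> Hom C X Y"
  shows "is_epi C X Y f \<longleftrightarrow> R.repi X Y (op f)"
proof
  assume m: "is_epi C X Y f"
  show "R.repi X Y (op f)"
    unfolding R.repi_def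
  proof (intro conjI allI ballI impI opHomI f XY)
    fix T r assume "r \<in> opHom Y T" and 0: "r * op f = 0"
    then obtain g where g: "T \<in> Ob C" "g \<in> Hom C Y T" "r = op g" by (elim opHomE)
    note z = Zero_hom[OF XY(2) g(1)]
    have "g \<cdot> f = Zero C Y T \<cdot> f"
      using Comp_eq_iff[OF XY g(1) f g(2) Zero_hom[OF XY(1) g(1)]] Comp_Zero_left[OF XY g(1) f] 0 g
        op_Zero[OF XY(1) g(1)] by simp
    then show "r = 0" using m g z op_Zero[OF XY(2) g(1)] unfolding is_epi_def by metis
  qed
next
  assume m: "R.repi X Y (op f)"
  show "is_epi C X Y f"
    unfolding is_epi_def
  proof (intro conjI ballI impI f)
    fix T g h assume T: "T \<in> Ob C" and g: "g \<in> Hom C Y T" and h: "h \<in> Hom C Y T"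
      and eq: "g \<cdot> f = h \<cdot> f"
    have "op g * op f = op h * op f" using eq op_Comp[OF XY T f g] op_Comp[OF XY T f h] by simp
    then show "g = h"
      using R.repiD[OF m opHomI opHomI] op_inj[OF XY(2) T g h] T XY g h by blast
  qed
qed

lemma is_kernel_iff:
  assumes XY: "X \<in> Ob C" "Y \<in> Ob C" and N: "N \<in> Ob C" and f: "f \<in> Hom C X Y" and j: "j \<in> Hom C N X"
  shows "is_kernel C X Y f N j \<longleftrightarrow> R.rker X Y (op f) N (op j)"
proof
  assume k: "is_kernel C X Y f N j"
  have lift: "\<exists>!v. v \<in> Hom C T N \<and> j \<cdot> v = u"
    if "T \<in> Ob C" "u \<in> Hom C T X" "op f * op u = 0" for T u
    using k that Comp_eq_iff[OF that(1) XY that(2) f Zero_hom[OF that(1) XY(2)]] op_Zero[OF that(1) XY(2)]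
    unfolding is_kernel_def by simp
  have fj: "op f * op j = 0"
    using k Comp_eq_iff[OF N XY j f Zero_hom[OF N XY(2)]] op_Zero[OF N XY(2)]
    by (simp add: is_kernel_def)
  have "is_mono C N X j"
    unfolding is_mono_def
  proof (intro conjI ballI impI j)
    fix T g h assume T: "T \<in> Ob C" and g: "g \<in> Hom C T N" and h: "h \<in> Hom C T N"
      and eq: "j \<cdot> g = j \<cdot> h"
    have "op f * op (j \<cdot> g) = 0"
      using fj by (simp add: op_Comp[OF T N XY(1) g j] mult.assoc[symmetric])
    from lift[OF T Comp_hom[OF T N XY(1) g j] this] show "g = h" using g h eq by metis
  qed
  then show "R.rker X Y (op f) N (op j)"
    unfolding R.rker_def
  proof (intro conjI allI ballI impI fj opHomI f XY)
    fix T u assume "u \<in> opHom T X" "op f * u = 0"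
    then obtain u' where u: "T \<in> Ob C" "u' \<in> Hom C T X" "u = op u'" "op f * op u' = 0"
      by (elim opHomE) simp
    then obtain v where v: "v \<in> Hom C T N" "j \<cdot> v = u'" using lift by blast
    then have "op j * op v = u" using op_Comp[OF u(1) N XY(1) v(1) j] u by simp
    then show "\<exists>v\<in>opHom T N. op j * v = u" using opHomI[OF v(1) u(1) N] by blast
  qed (simp add: is_mono_iff[OF N XY(1) j])
next
  assume k: "R.rker X Y (op f) N (op j)"
  then have m: "is_mono C N X j" using is_mono_iff[OF N XY(1) j] by (simp add: R.rker_def)
  show "is_kernel C X Y f N j"
    unfolding is_kernel_def
  proof (intro conjI ballI impI f N j)
    show "f \<cdot> j = Zero C N Y"
      using k Comp_eq_iff[OF N XY j f Zero_hom[OF N XY(2)]] op_Zero[OF N XY(2)]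
      by (simp add: R.rker_def)
    fix T u assume T: "T \<in> Ob C" and u: "u \<in> Hom C T X" and fu: "f \<cdot> u = Zero C T Y"
    have "op f * op u = 0"
      using fu Comp_eq_iff[OF T XY u f Zero_hom[OF T XY(2)]] op_Zero[OF T XY(2)] by simp
    then obtain r where "r \<in> opHom T N" "op j * r = op u"
      using k opHomI[OF u T XY(1)] unfolding R.rker_def by blast
    then obtain v where v: "v \<in> Hom C T N" "op j * op v = op u" by (elim opHomE) simp
    then have "j \<cdot> v = u" using Comp_eq_iff[OF T N XY(1) v(1) j u] by simp
    with v(1) m T show "\<exists>!v. v \<in> Hom C T N \<and> j \<cdot> v = u" unfolding is_mono_def by metis
  qed
qed

lemma is_cokernel_iff:
  assumes XY: "X \<in> Ob C" "Y \<in> Ob C" and Q: "Q \<in> Ob C" and f: "f \<in> Hom C X Y" and p: "p \<in> Hom C Y Q"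
  shows "is_cokernel C X Y f Q p \<longleftrightarrow> R.rcok X Y (op f) Q (op p)"
proof
  assume k: "is_cokernel C X Y f Q p"
  have lift: "\<exists>!v. v \<in> Hom C Q T \<and> v \<cdot> p = u"
    if "T \<in> Ob C" "u \<in> Hom C Y T" "op u * op f = 0" for T u
    using k that Comp_eq_iff[OF XY that(1) f that(2) Zero_hom[OF XY(1) that(1)]] op_Zero[OF XY(1) that(1)]
    unfolding is_cokernel_def by simp
  have pf: "op p * op f = 0"
    using k Comp_eq_iff[OF XY Q f p Zero_hom[OF XY(1) Q]] op_Zero[OF XY(1) Q]
    by (simp add: is_cokernel_def)
  have "is_epi C Y Q p"
    unfolding is_epi_def
  proof (intro conjI ballI impI p)
    fix T g h assume T: "T \<in> Ob C" and g: "g \<in> Hom C Q T" and h: "h \<in> Hom C Q T"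
      and eq: "g \<cdot> p = h \<cdot> p"
    have "op (g \<cdot> p) * op f = 0"
      using pf by (simp add: op_Comp[OF XY(2) Q T p g] mult.assoc)
    from lift[OF T Comp_hom[OF XY(2) Q T p g] this] show "g = h" using g h eq by metis
  qed
  then show "R.rcok X Y (op f) Q (op p)"
    unfolding R.rcok_def
  proof (intro conjI allI ballI impI pf opHomI f XY)
    fix T u assume "u \<in> opHom Y T" "u * op f = 0"
    then obtain u' where u: "T \<in> Ob C" "u' \<in> Hom C Y T" "u = op u'" "op u' * op f = 0"
      by (elim opHomE) simp
    then obtain v where v: "v \<in> Hom C Q T" "v \<cdot> p = u'" using lift by blast
    then have "op v * op p = u" using op_Comp[OF XY(2) Q u(1) p v(1)] u by simp
    then show "\<exists>v\<in>opHom Q T. v * op p = u" using opHomI[OF v(1) Q u(1)] by blast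
  qed (simp add: is_epi_iff[OF XY(2) Q p])
next
  assume k: "R.rcok X Y (op f) Q (op p)"
  then have m: "is_epi C Y Q p" using is_epi_iff[OF XY(2) Q p] by (simp add: R.rcok_def)
  show "is_cokernel C X Y f Q p"
    unfolding is_cokernel_def
  proof (intro conjI ballI impI f Q p)
    show "p \<cdot> f = Zero C X Q"
      using k Comp_eq_iff[OF XY Q f p Zero_hom[OF XY(1) Q]] op_Zero[OF XY(1) Q]
      by (simp add: R.rcok_def)
    fix T u assume T: "T \<in> Ob C" and u: "u \<in> Hom C Y T" and fu: "u \<cdot> f = Zero C X T"
    have "op u * op f = 0"
      using fu Comp_eq_iff[OF XY T f u Zero_hom[OF XY(1) T]] op_Zero[OF XY(1) T] by simp
    then obtain r where "r \<in> opHom Q T" "r * op p = op u"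
      using k opHomI[OF u XY(2) T] unfolding R.rcok_def by blast
    then obtain v where v: "v \<in> Hom C Q T" "op v * op p = op u" by (elim opHomE) simp
    then have "v \<cdot> p = u" using Comp_eq_iff[OF XY(2) Q T p v(1) u] by simp
    with v(1) m T show "\<exists>!v. v \<in> Hom C Q T \<and> v \<cdot> p = u" unfolding is_epi_def by metis
  qed
qed

sublocale R: ring_abelian_category "Ob C" opHom "\<lambda>X. op (Id C X)" "{P. projective_obj C P}"
proof
  fix X Y f assume "f \<in> opHom X Y"
  then obtain f' where f: "X \<in> Ob C" "Y \<in> Ob C" "f' \<in> Hom C X Y" "f = op f'" by (elim opHomE)
  obtain N j where "is_kernel C X Y f' N j" using ex_kernel[OF f(1-3)] by blast
  then show "\<exists>N j. R.rker X Y f N j"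
    using is_kernel_iff[OF f(1,2) _ f(3), of N j] f(4) unfolding is_kernel_def by blast
  obtain Q p where "is_cokernel C X Y f' Q p" using ex_cokernel[OF f(1-3)] by blast
  then show "\<exists>Q p. R.rcok X Y f Q p"
    using is_cokernel_iff[OF f(1,2) _ f(3), of Q p] f(4) unfolding is_cokernel_def by blast
next
  fix X Y f assume m: "R.rmono X Y f"
  then have "f \<in> opHom X Y" by (simp add: R.rmono_def)
  then obtain f' where f: "X \<in> Ob C" "Y \<in> Ob C" "f' \<in> Hom C X Y" "f = op f'" by (elim opHomE)
  then have "is_mono C X Y f'" using m is_mono_iff by blast
  then obtain Z g where g: "Z \<in> Ob C" "is_kernel C Y Z g X f'" using mono_is_kernel f by blast
  then show "\<exists>Z g. R.rker Y Z g X f"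
    using is_kernel_iff[OF f(2) g(1) f(1) _ f(3), of g] f(4) unfolding is_kernel_def by blast
next
  fix P X Y p f assume P: "P \<in> {P. projective_obj C P}" and p: "R.repi X Y p" and f: "f \<in> opHom P Y"
  from p have "p \<in> opHom X Y" by (simp add: R.repi_def)
  then obtain p' where p': "X \<in> Ob C" "Y \<in> Ob C" "p' \<in> Hom C X Y" "p = op p'" by (elim opHomE)
  obtain f' where f': "P \<in> Ob C" "f' \<in> Hom C P Y" "f = op f'" using f by (elim opHomE)
  have "is_epi C X Y p'" using p p' is_epi_iff by blast
  then obtain g where g: "g \<in> Hom C P X" "p' \<cdot> g = f'"
    using P p' f' unfolding projective_obj_def by blast
  then have "p * op g = f" using op_Comp[OF f'(1) p'(1,2) g(1) p'(3)] p' f' by simp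
  then show "\<exists>g\<in>opHom P X. p * g = f" using opHomI[OF g(1) f'(1) p'(1)] by blast
next
  fix X assume X: "X \<in> Ob C"
  then obtain P e where P: "projective_obj C P" "is_epi C P X e"
    using enough_projectives unfolding enough_projectives_def by blast
  then have "R.repi P X (op e)"
    using is_epi_iff[OF _ X, of P e] by (simp add: projective_obj_def is_epi_def)
  then show "\<exists>P\<in>{P. projective_obj C P}. \<exists>p. R.repi P X p" using P by blast
qed

section \<open>Transfer of complexes, chain maps, homotopies and quasi-isomorphisms\<close>

definition opc :: "('o, 'm) cplx \<Rightarrow> ('o, ('o, 'm) group_family endomorphism) cplx"
  where "opc X = \<lparr>cob = cob X, cdiff = (\<lambda>i. op (cdiff X i))\<rparr>"

lemma opc_sel [simp]: "cob (opc X) = cob X" "cdiff (opc X) i = op (cdiff X i)"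
  by (simp_all add: opc_def)

lemma bounded_cplxD:
  assumes "bounded_cplx C X"
  shows "cob X i \<in> Ob C" "cdiff X i \<in> Hom C (cob X i) (cob X (i + 1))"
    "cdiff X (i - 1) \<in> Hom C (cob X (i - 1)) (cob X i)"
proof -
  have h: "\<And>i. cdiff X i \<in> Hom C (cob X i) (cob X (i + 1))" using assms by (simp add: bounded_cplx_def)
  then show "cdiff X i \<in> Hom C (cob X i) (cob X (i + 1))" .
  show "cob X i \<in> Ob C" using assms by (simp add: bounded_cplx_def)
  show "cdiff X (i - 1) \<in> Hom C (cob X (i - 1)) (cob X i)" using h[of "i - 1"] by simp
qed

lemma bounded_cplx_iff:
  "bounded_cplx C X \<longleftrightarrow>
    (\<forall>i. cob X i \<in> Ob C \<and> cdiff X i \<in> Hom C (cob X i) (cob X (i + 1))) \<and> R.cx (opc X)"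
proof (cases "\<forall>i. cob X i \<in> Ob C \<and> cdiff X i \<in> Hom C (cob X i) (cob X (i + 1))")
  case True
  then have X: "\<And>i. cob X i \<in> Ob C" "\<And>i. cdiff X i \<in> Hom C (cob X i) (cob X (i + 1))" by blast+
  \<comment> \<open>The definition of a complex names the target in degree i + 2, while the
    differential in degree i + 1 is typed with i + 1 + 1.\<close>
  have "cdiff X (i + 1) \<in> Hom C (cob X (i + 1)) (cob X (i + 2))" for i
    using X(2)[of "i + 1"] by (simp only: add.assoc one_add_one)
  then have "cdiff X (i + 1) \<cdot> cdiff X i = Zero C (cob X i) (cob X (i + 2)) \<longleftrightarrow>
      op (cdiff X (i + 1)) * op (cdiff X i) = 0" for i
    using Comp_eq_iff[OF X(1)[of i] X(1)[of "i + 1"] X(1)[of "i + 2"] X(2) _ Zero_hom[OF X(1) X(1)],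
        of "cdiff X (i + 1)"]
      op_Zero[OF X(1)[of i] X(1)[of "i + 2"]] by simp
  with X show ?thesis
    by (auto simp: bounded_cplx_def R.cx_def zero_obj_iff opHomI)
next
  case False
  then show ?thesis by (auto simp: bounded_cplx_def)
qed

lemma cx_opc: "bounded_cplx C X \<Longrightarrow> R.cx (opc X)"
  by (simp add: bounded_cplx_iff)

text \<open>Denominators are constructed in the ring as shifted cones; this brings them back to
  complexes over \<open>C\<close>.\<close>

lemma cx_lift:
  assumes "R.cx Z"
  obtains X where "bounded_cplx C X" "opc X = Z"
proof -
  have "\<exists>f. f \<in> Hom C (cob Z i) (cob Z (i + 1)) \<and> cdiff Z i = op f" for i
    using R.cxD(2)[OF assms, of i] by (elim opHomE) blast
  then obtain d where d: "\<And>i. d i \<in> Hom C (cob Z i) (cob Z (i + 1))" "\<And>i. cdiff Z i = op (d i)"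
    by metis
  have "opc \<lparr>cob = cob Z, cdiff = d\<rparr> = Z" by (simp add: opc_def d(2)[symmetric])
  moreover from this have "bounded_cplx C \<lparr>cob = cob Z, cdiff = d\<rparr>"
    using assms d(1) R.cxD(1)[OF assms] by (simp add: bounded_cplx_iff)
  ultimately show ?thesis using that by blast
qed

lemma opc_shift:
  assumes "bounded_cplx C X"
  shows "opc (cplx_shift C n X) = R.shift n (opc X)"
  using Scale_one[OF bounded_cplxD(1,1,2)[OF assms]]
    op_minus[OF bounded_cplxD(1,1,2)[OF assms]]
  by (auto simp: opc_def cplx_shift_def R.shift_def fun_eq_iff)

lemma bounded_cplx_shift:
  assumes "bounded_cplx C X"
  shows "bounded_cplx C (cplx_shift C n X)"
proof -
  have "cdiff X (i + n) \<in> Hom C (cob X (i + n)) (cob X (i + 1 + n))" for i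
    using bounded_cplxD(2)[OF assms, of "i + n"] by (simp only: add.assoc add.commute[of n])
  note d = Scale_hom[OF bounded_cplxD(1)[OF assms] bounded_cplxD(1)[OF assms] this]
  have "R.cx (opc (cplx_shift C n X))"
    unfolding opc_shift[OF assms] by (rule R.cx_shift[OF cx_opc[OF assms]])
  moreover have "\<forall>i. cob (cplx_shift C n X) i \<in> Ob C \<and>
      cdiff (cplx_shift C n X) i \<in> Hom C (cob (cplx_shift C n X) i) (cob (cplx_shift C n X) (i + 1))"
    using d bounded_cplxD(1)[OF assms] by (simp add: cplx_shift_def)
  ultimately show ?thesis unfolding bounded_cplx_iff by blast
qed

lemma cplx_shift_shift:
  assumes "bounded_cplx C X"
  shows "cplx_shift C n (cplx_shift C (- n) X) = X"
proof -
  note D = bounded_cplxD(1,1,2)[OF assms]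
  have "Scale C (-1) (Scale C (-1) (cdiff X i)) = cdiff X i" for i
    using Scale_mult[OF D, of "-1" "-1"] Scale_one[OF D] by simp
  then show ?thesis
    using Scale_one[OF D] by (simp add: cplx_shift_def)
qed

lemma chain_map_iff:
  assumes X: "bounded_cplx C X" and Y: "bounded_cplx C Y"
  shows "chain_map C X Y f \<longleftrightarrow>
    (\<forall>i. f i \<in> Hom C (cob X i) (cob Y i)) \<and> R.cmap (opc X) (opc Y) (\<lambda>i. op (f i))"
proof (cases "\<forall>i. f i \<in> Hom C (cob X i) (cob Y i)")
  case True
  then have f: "\<And>i. f i \<in> Hom C (cob X i) (cob Y i)" by blast
  note DX = bounded_cplxD(1,2)[OF X] and DY = bounded_cplxD(1,2)[OF Y]
  have "cdiff Y i \<cdot> f i = f (i + 1) \<cdot> cdiff X i \<longleftrightarrow>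
      op (cdiff Y i) * op (f i) = op (f (i + 1)) * op (cdiff X i)" for i
    using Comp_eq_iff[OF DX(1) DY(1) DY(1) f DY(2) Comp_hom[OF DX(1) DX(1) DY(1) DX(2) f]]
    by (simp add: op_Comp[OF DX(1) DX(1) DY(1) DX(2) f])
  with f show ?thesis by (simp add: chain_map_def R.cmap_def opHomI DX DY)
next
  case False
  then show ?thesis by (auto simp: chain_map_def)
qed

lemma chain_map_hom: "chain_map C X Y f \<Longrightarrow> f i \<in> Hom C (cob X i) (cob Y i)"
  by (simp add: chain_map_def)

lemma cmap_op:
  "\<lbrakk>bounded_cplx C X; bounded_cplx C Y; chain_map C X Y f\<rbrakk> \<Longrightarrow> R.cmap (opc X) (opc Y) (\<lambda>i. op (f i))"
  by (simp add: chain_map_iff)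

lemma cmap_lift:
  assumes X: "bounded_cplx C X" and Y: "bounded_cplx C Y" and g: "R.cmap (opc X) (opc Y) g"
  obtains f where "chain_map C X Y f" "g = (\<lambda>i. op (f i))"
proof -
  have "\<exists>f. f \<in> Hom C (cob X i) (cob Y i) \<and> g i = op f" for i
    using R.cmapD(1)[OF g, of i] unfolding opc_sel by (elim opHomE) blast
  then obtain f where "\<And>i. f i \<in> Hom C (cob X i) (cob Y i)" "\<And>i. g i = op (f i)" by metis
  then have "g = (\<lambda>i. op (f i))" by (simp add: fun_eq_iff)
  moreover from this have "chain_map C X Y f"
    using g \<open>\<And>i. f i \<in> Hom C (cob X i) (cob Y i)\<close> by (simp add: chain_map_iff[OF X Y])
  ultimately show ?thesis using that by blast
qed

text \<open>The two conventions differ by one: in \<open>homotopic\<close> the component s i starts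
  in degree i of X, in \<open>htpy\<close> in degree i + 1.\<close>

lemma homotopic_iff:
  assumes X: "bounded_cplx C X" and Y: "bounded_cplx C Y"
    and f: "chain_map C X Y f" and g: "chain_map C X Y g"
  shows "homotopic C X Y f g \<longleftrightarrow> R.htpy (opc X) (opc Y) (\<lambda>i. op (f i)) (\<lambda>i. op (g i))"
proof -
  note DX = bounded_cplxD[OF X] and DY = bounded_cplxD[OF Y]
  have eq: "f i = g i \<oplus> ((cdiff Y (i - 1) \<cdot> s) \<oplus> (s' \<cdot> cdiff X i)) \<longleftrightarrow>
      op (f i) = op (g i) + (op (cdiff Y (i - 1)) * op s + op s' * op (cdiff X i))"
    if s: "s \<in> Hom C (cob X i) (cob Y (i - 1))" and s': "s' \<in> Hom C (cob X (i + 1)) (cob Y i)"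
    for i s s'
  proof -
    note a = Comp_hom[OF DX(1) DY(1) DY(1) s DY(3)] and b = Comp_hom[OF DX(1) DX(1) DY(1) DX(2) s']
    note gi = chain_map_hom[OF g, of i]
    note ab = Plus_hom[OF DX(1) DY(1) a b]
    have "op (g i \<oplus> ((cdiff Y (i - 1) \<cdot> s) \<oplus> (s' \<cdot> cdiff X i))) =
        op (g i) + (op (cdiff Y (i - 1)) * op s + op s' * op (cdiff X i))"
      by (simp add: op_Plus[OF DX(1) DY(1) gi ab] op_Plus[OF DX(1) DY(1) a b]
          op_Comp[OF DX(1) DY(1) DY(1) s DY(3)] op_Comp[OF DX(1) DX(1) DY(1) DX(2) s'])
    then show ?thesis
      using op_eq_iff[OF DX(1) DY(1) chain_map_hom[OF f, of i] Plus_hom[OF DX(1) DY(1) gi ab]] by simp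
  qed
  show ?thesis
  proof
    assume "homotopic C X Y f g"
    then obtain s where s: "\<And>i. s i \<in> Hom C (cob X i) (cob Y (i - 1))"
      "\<And>i. f i = g i \<oplus> ((cdiff Y (i - 1) \<cdot> s i) \<oplus> (s (i + 1) \<cdot> cdiff X i))"
      unfolding homotopic_def by blast
    have s1: "s (i + 1) \<in> Hom C (cob X (i + 1)) (cob Y i)" for i using s(1)[of "i + 1"] by simp
    have "op (f i) = op (g i) + (op (cdiff Y (i - 1)) * op (s i) + op (s (i + 1)) * op (cdiff X i))" for i
      using eq[OF s(1) s1] s(2) by blast
    from this[of "_ + 1"] show "R.htpy (opc X) (opc Y) (\<lambda>i. op (f i)) (\<lambda>i. op (g i))"
      unfolding R.htpy_def
      by (intro exI[of _ "\<lambda>i. op (s (i + 1))"]) (auto intro!: opHomI s1 DX DY)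
  next
    assume "R.htpy (opc X) (opc Y) (\<lambda>i. op (f i)) (\<lambda>i. op (g i))"
    then obtain r where r: "\<And>i. r i \<in> opHom (cob X (i + 1)) (cob Y i)"
      "\<And>i. op (f (i + 1)) = op (g (i + 1)) + (op (cdiff Y i) * r i + r (i + 1) * op (cdiff X (i + 1)))"
      unfolding R.htpy_def by auto
    have "\<exists>s. s \<in> Hom C (cob X (i + 1)) (cob Y i) \<and> r i = op s" for i
      using r(1)[of i] by (elim opHomE) blast
    then obtain s where s: "\<And>i. s i \<in> Hom C (cob X (i + 1)) (cob Y i)" "\<And>i. r i = op (s i)" by metis
    have s1: "s (i - 1) \<in> Hom C (cob X i) (cob Y (i - 1))" for i using s(1)[of "i - 1"] by simp
    have "f i = g i \<oplus> ((cdiff Y (i - 1) \<cdot> s (i - 1)) \<oplus> (s i \<cdot> cdiff X i))" for i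
      using eq[OF s1 s(1)] r(2)[of "i - 1"] s(2) by simp
    then show "homotopic C X Y f g"
      unfolding homotopic_def by (intro exI[of _ "\<lambda>i. s (i - 1)"]) (simp add: s1)
  qed
qed

lemma cohomology_iff:
  assumes X: "bounded_cplx C X" and N: "N \<in> Ob C" and L: "L \<in> Ob C"
    and j: "j \<in> Hom C N (cob X (i + 1))" and p: "p \<in> Hom C N L"
  shows "cohomology C X (i + 1) N j L p \<longleftrightarrow> (\<exists>b. R.rcoh (opc X) i N (op j) b L (op p))"
proof -
  note DX = bounded_cplxD[OF X]
  have ker: "is_kernel C (cob X (i + 1)) (cob X (i + 1 + 1)) (cdiff X (i + 1)) N j \<longleftrightarrow>
      R.rker (cob X (i + 1)) (cob X (i + 1 + 1)) (op (cdiff X (i + 1))) N (op j)"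
    by (rule is_kernel_iff[OF DX(1) DX(1) N DX(2) j])
  have cok: "b \<in> Hom C (cob X i) N \<and> j \<cdot> b = cdiff X i \<and> is_cokernel C (cob X i) N b L p \<longleftrightarrow>
      b \<in> Hom C (cob X i) N \<and> op j * op b = op (cdiff X i) \<and> R.rcok (cob X i) N (op b) L (op p)" for b
    using is_cokernel_iff[OF DX(1) N L _ p] Comp_eq_iff[OF DX(1) N DX(1) _ j DX(2)] by blast
  have "(\<exists>b. b \<in> Hom C (cob X i) N \<and> j \<cdot> b = cdiff X i \<and> is_cokernel C (cob X i) N b L p) \<longleftrightarrow>
      (\<exists>b\<in>opHom (cob X i) N. op j * b = op (cdiff X i) \<and> R.rcok (cob X i) N b L (op p))"
    unfolding cok using opHomI[OF _ DX(1) N] by (metis opHomE)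
  with ker show ?thesis by (auto simp: cohomology_def R.rcoh_def)
qed

lemma is_iso_iff:
  assumes XY: "X \<in> Ob C" "Y \<in> Ob C" and f: "f \<in> Hom C X Y"
  shows "is_iso C X Y f \<longleftrightarrow> (\<exists>g\<in>opHom Y X. g * op f = op (Id C X) \<and> op f * g = op (Id C Y))"
proof -
  have "g \<cdot> f = Id C X \<and> f \<cdot> g = Id C Y \<longleftrightarrow> op g * op f = op (Id C X) \<and> op f * op g = op (Id C Y)"
    if "g \<in> Hom C Y X" for g
    using Comp_eq_iff[OF XY XY(1) f that Id_hom[OF XY(1)]] Comp_eq_iff[OF XY(2,1) XY(2) that f Id_hom[OF XY(2)]]
    by simp
  then show ?thesis unfolding is_iso_def using f opHomI[OF _ XY(2,1)] by (metis opHomE)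
qed

text \<open>Here the test on maps from projectives is shown to agree with isomorphism on cohomology
  objects.\<close>

lemma quasi_iso_map_iff:
  assumes X: "bounded_cplx C X" and Y: "bounded_cplx C Y"
  shows "quasi_iso_map C X Y f \<longleftrightarrow> chain_map C X Y f \<and> R.qis (opc X) (opc Y) (\<lambda>i. op (f i))"
proof (cases "chain_map C X Y f")
  case True
  note cf = cmap_op[OF X Y True]
  note DX = bounded_cplxD[OF X] and DY = bounded_cplxD[OF Y]
  have square: "z \<in> Hom C N N' \<and> j' \<cdot> z = f (i + 1) \<cdot> j \<and> h \<in> Hom C L L' \<and> h \<cdot> p = p' \<cdot> z \<longleftrightarrow>
      z \<in> Hom C N N' \<and> op j' * op z = op (f (i + 1)) * op j \<and> h \<in> Hom C L L' \<and> op h * op p = op p' * op z"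
    if Ob: "N \<in> Ob C" "L \<in> Ob C" "N' \<in> Ob C" "L' \<in> Ob C" and j: "j \<in> Hom C N (cob X (i + 1))"
      and p: "p \<in> Hom C N L" and j': "j' \<in> Hom C N' (cob Y (i + 1))" and p': "p' \<in> Hom C N' L'"
    for i N j L p N' j' L' p' z h
    using Comp_eq_iff[OF Ob(1,3) DY(1) _ j' Comp_hom[OF Ob(1) DX(1) DY(1) j chain_map_hom[OF True]], of z]
      op_Comp[OF Ob(1) DX(1) DY(1) j chain_map_hom[OF True]]
      Comp_eq_iff[OF Ob(1,2,4) p _ Comp_hom[OF Ob(1,3,4) _ p'], of h z] op_Comp[OF Ob(1,3,4) _ p', of z]
    by auto
  show ?thesis
  proof
    assume q: "quasi_iso_map C X Y f"
    have "R.qis (opc X) (opc Y) (\<lambda>i. op (f i))"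
    proof (rule R.coh_iso_imp_qis[OF cx_opc[OF X] cx_opc[OF Y] cf])
      fix i N j b L p N' j' b' L' p' z h
      assume c: "R.rcoh (opc X) i N j b L p" and c': "R.rcoh (opc Y) i N' j' b' L' p'"
        and z: "z \<in> opHom N N'" "j' * z = op (f (i + 1)) * j" and h: "h \<in> opHom L L'" "h * p = p' * z"
      obtain j1 where j: "N \<in> Ob C" "j1 \<in> Hom C N (cob X (i + 1))" "j = op j1"
        using R.rcohD(1)[OF c] by (auto elim: opHomE)
      obtain p1 where p: "L \<in> Ob C" "p1 \<in> Hom C N L" "p = op p1"
        using R.rcohD(3)[OF c] by (auto elim: opHomE)
      obtain j2 where j': "N' \<in> Ob C" "j2 \<in> Hom C N' (cob Y (i + 1))" "j' = op j2"
        using R.rcohD(1)[OF c'] by (auto elim: opHomE)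
      obtain p2 where p': "L' \<in> Ob C" "p2 \<in> Hom C N' L'" "p' = op p2"
        using R.rcohD(3)[OF c'] by (auto elim: opHomE)
      obtain z1 where z1: "z1 \<in> Hom C N N'" "z = op z1" using z(1) by (auto elim: opHomE)
      obtain h1 where h1: "h1 \<in> Hom C L L'" "h = op h1" using h(1) by (auto elim: opHomE)
      have "cohomology C X (i + 1) N j1 L p1"
        using cohomology_iff[OF X j(1) p(1) j(2) p(2)] c j(3) p(3) by blast
      moreover have "cohomology C Y (i + 1) N' j2 L' p2"
        using cohomology_iff[OF Y j'(1) p'(1) j'(2) p'(2)] c' j'(3) p'(3) by blast
      moreover have "z1 \<in> Hom C N N' \<and> j2 \<cdot> z1 = f (i + 1) \<cdot> j1 \<and> h1 \<in> Hom C L L' \<and> h1 \<cdot> p1 = p2 \<cdot> z1"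
        using square[OF j(1) p(1) j'(1) p'(1) j(2) p(2) j'(2) p'(2), of z1 h1] z(2) h(2) j(3) p(3) j'(3) p'(3) z1 h1
        by simp
      ultimately have "is_iso C L L' h1" using q unfolding quasi_iso_map_def by blast
      then show "\<exists>g\<in>opHom L' L. g * h = op (Id C L) \<and> h * g = op (Id C L')"
        using is_iso_iff[OF p(1) p'(1) h1(1)] h1(2) by simp
    qed
    with True show "chain_map C X Y f \<and> R.qis (opc X) (opc Y) (\<lambda>i. op (f i))" by simp
  next
    assume "chain_map C X Y f \<and> R.qis (opc X) (opc Y) (\<lambda>i. op (f i))"
    then have q: "R.qis (opc X) (opc Y) (\<lambda>i. op (f i))" by simp
    show "quasi_iso_map C X Y f"
      unfolding quasi_iso_map_def
    proof (intro conjI allI impI True)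
      fix k :: int and N j L p N' j' L' p' z h
      define i where "i = k - 1"
      have k: "k = i + 1" by (simp add: i_def)
      assume *: "cohomology C X k N j L p \<and> cohomology C Y k N' j' L' p' \<and>
        z \<in> Hom C N N' \<and> j' \<cdot> z = f k \<cdot> j \<and> h \<in> Hom C L L' \<and> h \<cdot> p = p' \<cdot> z"
      then have c: "cohomology C X (i + 1) N j L p" and c': "cohomology C Y (i + 1) N' j' L' p'"
        by (simp_all add: k)
      have j: "N \<in> Ob C" "j \<in> Hom C N (cob X (i + 1))" "N' \<in> Ob C" "j' \<in> Hom C N' (cob Y (i + 1))"
        and p: "L \<in> Ob C" "p \<in> Hom C N L" "L' \<in> Ob C" "p' \<in> Hom C N' L'"
        using c c' by (auto simp: cohomology_def is_kernel_def is_cokernel_def)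
      obtain b where b: "R.rcoh (opc X) i N (op j) b L (op p)"
        using c cohomology_iff[OF X j(1) p(1) j(2) p(2)] by blast
      obtain b' where b': "R.rcoh (opc Y) i N' (op j') b' L' (op p')"
        using c' cohomology_iff[OF Y j(3) p(3) j(4) p(4)] by blast
      have sq: "z \<in> Hom C N N' \<and> op j' * op z = op (f (i + 1)) * op j \<and> h \<in> Hom C L L' \<and>
          op h * op p = op p' * op z"
        using square[OF j(1) p(1) j(3) p(3) j(2) p(2) j(4) p(4), of z h] * k by simp
      then show "is_iso C L L' h"
        using R.qis_imp_coh_iso[OF q b b', of "op z" "op h"] is_iso_iff[OF p(1,3), of h] opHomI j p by blast
    qed
  qed
next
  case False
  then show ?thesis by (simp add: quasi_iso_map_def)
qed

end

section \<open>Calculus of right fractions\<close>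

locale right_fractions =
  fixes K :: "('o, 'm, 'k, 'z) lincat_scheme" (structure) and W :: "'m set"
  assumes K_Id: "X \<in> Ob K \<Longrightarrow> Id K X \<in> Hom K X X"
    and K_Comp: "\<lbrakk>X \<in> Ob K; Y \<in> Ob K; Z \<in> Ob K; f \<in> Hom K X Y; g \<in> Hom K Y Z\<rbrakk>
      \<Longrightarrow> g \<cdot> f \<in> Hom K X Z"
    and K_Comp_Id: "\<lbrakk>X \<in> Ob K; Y \<in> Ob K; f \<in> Hom K X Y\<rbrakk> \<Longrightarrow> f \<cdot> Id K X = f"
    and K_Id_Comp: "\<lbrakk>X \<in> Ob K; Y \<in> Ob K; f \<in> Hom K X Y\<rbrakk> \<Longrightarrow> Id K Y \<cdot> f = f"
    and K_assoc: "\<lbrakk>X \<in> Ob K; Y \<in> Ob K; Z \<in> Ob K; V \<in> Ob K;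
        f \<in> Hom K X Y; g \<in> Hom K Y Z; h \<in> Hom K Z V\<rbrakk> \<Longrightarrow> (h \<cdot> g) \<cdot> f = h \<cdot> (g \<cdot> f)"
    and W_Id: "X \<in> Ob K \<Longrightarrow> Id K X \<in> W"
    and W_Comp: "\<lbrakk>X \<in> Ob K; Y \<in> Ob K; Z \<in> Ob K; f \<in> Hom K X Y; g \<in> Hom K Y Z; f \<in> W; g \<in> W\<rbrakk>
      \<Longrightarrow> g \<cdot> f \<in> W"
    and ore: "\<lbrakk>X \<in> Ob K; Y \<in> Ob K; Z \<in> Ob K; f \<in> Hom K X Y; s \<in> Hom K Z Y; s \<in> W\<rbrakk>
      \<Longrightarrow> \<exists>U\<in>Ob K. \<exists>t\<in>Hom K U X \<inter> W. \<exists>v\<in>Hom K U Z. f \<cdot> t = s \<cdot> v"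
    and cancel: "\<lbrakk>X \<in> Ob K; Y \<in> Ob K; Z \<in> Ob K; f \<in> Hom K X Y; g \<in> Hom K X Y; s \<in> Hom K Y Z; s \<in> W;
        s \<cdot> f = s \<cdot> g\<rbrakk> \<Longrightarrow> \<exists>U\<in>Ob K. \<exists>t\<in>Hom K U X \<inter> W. f \<cdot> t = g \<cdot> t"
begin

definition hom :: "'o \<Rightarrow> 'o \<Rightarrow> 'm \<Rightarrow> bool"
  where "hom X Y f \<longleftrightarrow> X \<in> Ob K \<and> Y \<in> Ob K \<and> f \<in> Hom K X Y"

lemma hom_comp: "\<lbrakk>hom X Y f; hom Y Z g\<rbrakk> \<Longrightarrow> hom X Z (g \<cdot> f)"
  using K_Comp by (auto simp: hom_def)

lemma assoc: "\<lbrakk>hom X Y f; hom Y Z g; hom Z V h\<rbrakk> \<Longrightarrow> (h \<cdot> g) \<cdot> f = h \<cdot> (g \<cdot> f)"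
  using K_assoc by (auto simp: hom_def)

lemma W_comp: "\<lbrakk>hom X Y f; hom Y Z g; f \<in> W; g \<in> W\<rbrakk> \<Longrightarrow> g \<cdot> f \<in> W"
  using W_Comp by (auto simp: hom_def)

lemma square_comp:
  assumes "hom U Z u" "hom Z X s" "hom U Z' u'" "hom Z' X s'" "hom T U a" "s \<cdot> u = s' \<cdot> u'"
  shows "s \<cdot> (u \<cdot> a) = s' \<cdot> (u' \<cdot> a)"
  using assoc[OF assms(5,1,2)] assoc[OF assms(5,3,4)] assms(6) by simp

lemma cancelE:
  assumes "hom X Y f" "hom X Y g" "hom Y Z s" "s \<in> W" "s \<cdot> f = s \<cdot> g"
  obtains U t where "hom U X t" "t \<in> W" "f \<cdot> t = g \<cdot> t"
  using assms cancel[of X Y Z f g s] by (auto simp: hom_def)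

lemma oreE:
  assumes "hom X Y f" "hom Z Y s" "s \<in> W"
  obtains U t v where "hom U X t" "t \<in> W" "hom U Z v" "f \<cdot> t = s \<cdot> v"
  using assms ore[of X Y Z f s] by (auto simp: hom_def)

text \<open>Only s q, and not q, is known to lie in \<open>W\<close>. So the Ore condition is
  applied to s p against s q, and s is then removed by \<open>cancel\<close>.\<close>

lemma ore_lift:
  assumes s: "hom Z X s" "s \<in> W" and p: "hom U Z p" and q: "hom V Z q" "s \<cdot> q \<in> W"
  obtains T t r where "hom T U t" "t \<in> W" "hom T V r" "p \<cdot> t = q \<cdot> r"
proof -
  obtain T t r where t: "hom T U t" "t \<in> W" "hom T V r" "(s \<cdot> p) \<cdot> t = (s \<cdot> q) \<cdot> r"
    using oreE[OF hom_comp[OF p s(1)] hom_comp[OF q(1) s(1)] q(2)] by blast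
  then have "s \<cdot> (p \<cdot> t) = s \<cdot> (q \<cdot> r)"
    using assoc[OF t(1) p s(1)] assoc[OF t(3) q(1) s(1)] by simp
  then obtain T' t' where t': "hom T' T t'" "t' \<in> W" "(p \<cdot> t) \<cdot> t' = (q \<cdot> r) \<cdot> t'"
    using cancelE[OF hom_comp[OF t(1) p] hom_comp[OF t(3) q(1)] s] by blast
  show ?thesis
  proof (rule that)
    show "hom T' U (t \<cdot> t')" by (rule hom_comp[OF t'(1) t(1)])
    show "t \<cdot> t' \<in> W" by (rule W_comp[OF t'(1) t(1) t'(2) t(2)])
    show "hom T' V (r \<cdot> t')" by (rule hom_comp[OF t'(1) t(3)])
    show "p \<cdot> (t \<cdot> t') = q \<cdot> (r \<cdot> t')"
      using t'(3) assoc[OF t'(1) t(1) p] assoc[OF t'(1) t(3) q(1)] by simp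
  qed
qed

lemma roofs_iff: "X \<in> Ob K \<Longrightarrow> Y \<in> Ob K \<Longrightarrow>
    (Z, s, f) \<in> roofs K W X Y \<longleftrightarrow> hom Z X s \<and> s \<in> W \<and> hom Z Y f"
  by (auto simp: roofs_def hom_def)

lemma roof_equiv_iff:
  assumes "hom Z X s" "hom Z' X s'"
  shows "roof_equiv K W (Z, s, f) (Z', s', f') \<longleftrightarrow>
    (\<exists>U u u'. hom U Z u \<and> hom U Z' u' \<and> s \<cdot> u \<in> W \<and> s \<cdot> u = s' \<cdot> u' \<and> f \<cdot> u = f' \<cdot> u')"
  using assms by (auto simp: roof_equiv_def hom_def)

lemma roof_equiv_refl:
  assumes "hom Z X s" "s \<in> W" "hom Z Y f"
  shows "roof_equiv K W (Z, s, f) (Z, s, f)"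
  unfolding roof_equiv_iff[OF assms(1,1)] using assms K_Id[of Z] K_Comp_Id[of Z X s]
  by (auto simp: hom_def intro!: exI[of _ Z] exI[of _ "Id K Z"])

lemma roof_equiv_sym: "roof_equiv K W r r' \<Longrightarrow> roof_equiv K W r' r"
  by (cases r; cases r') (auto simp: roof_equiv_def, metis)

text \<open>The two dominating objects U and V are matched over the middle roof by
  \<open>ore_lift\<close>; the new denominator is s1 u1 followed by a map of
  \<open>W\<close>.\<close>

lemma roof_equiv_trans:
  assumes s1: "hom Z1 X s1" "hom Z1 Y f1" and s2: "hom Z2 X s2" "s2 \<in> W" "hom Z2 Y f2"
    and s3: "hom Z3 X s3" "hom Z3 Y f3"
    and eq12: "roof_equiv K W (Z1, s1, f1) (Z2, s2, f2)" and eq23: "roof_equiv K W (Z2, s2, f2) (Z3, s3, f3)"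
  shows "roof_equiv K W (Z1, s1, f1) (Z3, s3, f3)"
proof -
  obtain U u1 u2 where u: "hom U Z1 u1" "hom U Z2 u2" "s1 \<cdot> u1 \<in> W" "s1 \<cdot> u1 = s2 \<cdot> u2" "f1 \<cdot> u1 = f2 \<cdot> u2"
    using eq12 unfolding roof_equiv_iff[OF s1(1) s2(1)] by blast
  obtain V v2 v3 where v: "hom V Z2 v2" "hom V Z3 v3" "s2 \<cdot> v2 \<in> W" "s2 \<cdot> v2 = s3 \<cdot> v3" "f2 \<cdot> v2 = f3 \<cdot> v3"
    using eq23 unfolding roof_equiv_iff[OF s2(1) s3(1)] by blast
  obtain T t r where t: "hom T U t" "t \<in> W" "hom T V r" "u2 \<cdot> t = v2 \<cdot> r"
    using ore_lift[OF s2(1,2) u(2) v(1,3)] by blast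
  have "s1 \<cdot> (u1 \<cdot> t) = (s1 \<cdot> u1) \<cdot> t" by (rule assoc[OF t(1) u(1) s1(1), symmetric])
  then have "s1 \<cdot> (u1 \<cdot> t) \<in> W" using W_comp[OF t(1) hom_comp[OF u(1) s1(1)] t(2) u(3)] by simp
  moreover have "s1 \<cdot> (u1 \<cdot> t) = s3 \<cdot> (v3 \<cdot> r)"
    using square_comp[OF u(1) s1(1) u(2) s2(1) t(1) u(4)] t(4)
      square_comp[OF v(1) s2(1) v(2) s3(1) t(3) v(4)] by simp
  moreover have "f1 \<cdot> (u1 \<cdot> t) = f3 \<cdot> (v3 \<cdot> r)"
    using square_comp[OF u(1) s1(2) u(2) s2(3) t(1) u(5)] t(4)
      square_comp[OF v(1) s2(3) v(2) s3(2) t(3) v(5)] by simp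
  ultimately show ?thesis
    unfolding roof_equiv_iff[OF s1(1) s3(1)] using hom_comp[OF t(1) u(1)] hom_comp[OF t(3) v(2)] by blast
qed

lemma roof_class_eq_iff:
  assumes "hom Z X s" "s \<in> W" "hom Z Y f" "hom Z' X s'" "s' \<in> W" "hom Z' Y f'"
  shows "roof_class K W X Y (Z, s, f) = roof_class K W X Y (Z', s', f') \<longleftrightarrow>
    roof_equiv K W (Z, s, f) (Z', s', f')"
proof
  have Ob: "X \<in> Ob K" "Y \<in> Ob K" using assms by (auto simp: hom_def)
  { assume "roof_class K W X Y (Z, s, f) = roof_class K W X Y (Z', s', f')"
    moreover have "(Z', s', f') \<in> fst (snd (roof_class K W X Y (Z', s', f')))"
      using roof_equiv_refl[OF assms(4-6)] assms(4-6) by (simp add: roof_class_def roofs_iff[OF Ob])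
    ultimately show "roof_equiv K W (Z, s, f) (Z', s', f')"
      by (auto simp: roof_class_def) }
  assume eq: "roof_equiv K W (Z, s, f) (Z', s', f')"
  have "roof_equiv K W (Z, s, f) (Z'', s'', f'') \<longleftrightarrow> roof_equiv K W (Z', s', f') (Z'', s'', f'')"
    if "(Z'', s'', f'') \<in> roofs K W X Y" for Z'' s'' f''
  proof -
    have r: "hom Z'' X s''" "s'' \<in> W" "hom Z'' Y f''" using that by (simp_all add: roofs_iff[OF Ob])
    show ?thesis
      using roof_equiv_trans[OF assms(1,3,4,5,6) r(1,3) eq]
        roof_equiv_trans[OF assms(4,6,1,2,3) r(1,3) roof_equiv_sym[OF eq]] by blast
  qed
  then show "roof_class K W X Y (Z, s, f) = roof_class K W X Y (Z', s', f')"
    unfolding roof_class_def by auto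
qed

text \<open>This makes composition independent both of the representing roofs and of the Ore squares
  that connect them.\<close>

lemma comp_well_defined:
  assumes r1: "hom Z1 X s1" "s1 \<in> W" "hom Z1 Y f1" and r2: "hom Z2 X s2" "s2 \<in> W" "hom Z2 Y f2"
    and q1: "hom Z1' Y s1'" "s1' \<in> W" "hom Z1' V f1'" and q2: "hom Z2' Y s2'" "s2' \<in> W" "hom Z2' V f2'"
    and r: "roof_equiv K W (Z1, s1, f1) (Z2, s2, f2)" and q: "roof_equiv K W (Z1', s1', f1') (Z2', s2', f2')"
    and u1: "hom U1 Z1 u1" "u1 \<in> W" "hom U1 Z1' v1" "f1 \<cdot> u1 = s1' \<cdot> v1"
    and u2: "hom U2 Z2 u2" "u2 \<in> W" "hom U2 Z2' v2" "f2 \<cdot> u2 = s2' \<cdot> v2"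
  shows "roof_equiv K W (U1, s1 \<cdot> u1, f1' \<cdot> v1) (U2, s2 \<cdot> u2, f2' \<cdot> v2)"
proof -
  obtain A a1 a2 where a: "hom A Z1 a1" "hom A Z2 a2" "s1 \<cdot> a1 \<in> W" "s1 \<cdot> a1 = s2 \<cdot> a2" "f1 \<cdot> a1 = f2 \<cdot> a2"
    using r unfolding roof_equiv_iff[OF r1(1) r2(1)] by blast
  obtain B b1 b2 where b: "hom B Z1' b1" "hom B Z2' b2" "s1' \<cdot> b1 \<in> W" "s1' \<cdot> b1 = s2' \<cdot> b2"
    "f1' \<cdot> b1 = f2' \<cdot> b2"
    using q unfolding roof_equiv_iff[OF q1(1) q2(1)] by blast
  \<comment> \<open>A dominates the two first roofs. T1, and then T2, refine A so as to map
    compatibly to U1 and to U2.\<close>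
  obtain T1 p1 x1 where 1: "hom T1 A p1" "p1 \<in> W" "hom T1 U1 x1" "a1 \<cdot> p1 = u1 \<cdot> x1"
    using ore_lift[OF r1(1,2) a(1) u1(1) W_comp[OF u1(1) r1(1) u1(2) r1(2)]] by blast
  obtain T2 t2 x2 where 2: "hom T2 T1 t2" "t2 \<in> W" "hom T2 U2 x2" "(a2 \<cdot> p1) \<cdot> t2 = u2 \<cdot> x2"
    using ore_lift[OF r2(1,2) hom_comp[OF 1(1) a(2)] u2(1) W_comp[OF u2(1) r2(1) u2(2) r2(2)]] by blast
  define p where "p = p1 \<cdot> t2"
  define y1 where "y1 = x1 \<cdot> t2"
  have p: "hom T2 A p" "p \<in> W" unfolding p_def by (rule hom_comp[OF 2(1) 1(1)], rule W_comp[OF 2(1) 1(1) 2(2) 1(2)])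
  have y1: "hom T2 U1 y1" unfolding y1_def by (rule hom_comp[OF 2(1) 1(3)])
  have ap1: "a1 \<cdot> p = u1 \<cdot> y1" unfolding p_def y1_def by (rule square_comp[OF 1(1) a(1) 1(3) u1(1) 2(1) 1(4)])
  have ap2: "a2 \<cdot> p = u2 \<cdot> x2" unfolding p_def using assoc[OF 2(1) 1(1) a(2)] 2(4) by simp
  \<comment> \<open>B dominates the two second roofs; T3 matches v1 with the leg of B towards
    \<open>Z1'\<close>.\<close>
  obtain T3 t3 l where 3: "hom T3 T2 t3" "t3 \<in> W" "hom T3 B l" "(v1 \<cdot> y1) \<cdot> t3 = b1 \<cdot> l"
    using ore_lift[OF q1(1,2) hom_comp[OF y1 u1(3)] b(1,3)] by blast
  note y1t = hom_comp[OF 3(1) y1] and x2t = hom_comp[OF 3(1) 2(3)] and pt = hom_comp[OF 3(1) p(1)]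
  have v1: "v1 \<cdot> (y1 \<cdot> t3) = b1 \<cdot> l" using assoc[OF 3(1) y1 u1(3)] 3(4) by simp
  \<comment> \<open>The legs towards \<open>Z2'\<close> need not agree yet. Going around all the
    squares shows that they agree after s2', and one more refinement T cancels s2'.\<close>
  have "s2' \<cdot> (v2 \<cdot> (x2 \<cdot> t3)) = f2 \<cdot> (u2 \<cdot> (x2 \<cdot> t3))"
    by (rule square_comp[OF u2(1) r2(3) u2(3) q2(1) x2t u2(4), symmetric])
  also have "u2 \<cdot> (x2 \<cdot> t3) = a2 \<cdot> (p \<cdot> t3)"
    by (rule square_comp[OF p(1) a(2) 2(3) u2(1) 3(1) ap2, symmetric])
  also have "f2 \<cdot> (a2 \<cdot> (p \<cdot> t3)) = f1 \<cdot> (a1 \<cdot> (p \<cdot> t3))"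
    by (rule square_comp[OF a(1) r1(3) a(2) r2(3) pt a(5), symmetric])
  also have "a1 \<cdot> (p \<cdot> t3) = u1 \<cdot> (y1 \<cdot> t3)"
    by (rule square_comp[OF p(1) a(1) y1 u1(1) 3(1) ap1])
  also have "f1 \<cdot> (u1 \<cdot> (y1 \<cdot> t3)) = s1' \<cdot> (v1 \<cdot> (y1 \<cdot> t3))"
    by (rule square_comp[OF u1(1) r1(3) u1(3) q1(1) y1t u1(4)])
  also have "\<dots> = s2' \<cdot> (b2 \<cdot> l)"
    unfolding v1 by (rule square_comp[OF b(1) q1(1) b(2) q2(1) 3(3) b(4)])
  finally obtain T t where 4: "hom T T3 t" "t \<in> W" "(v2 \<cdot> (x2 \<cdot> t3)) \<cdot> t = (b2 \<cdot> l) \<cdot> t"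
    using cancelE[OF hom_comp[OF x2t u2(3)] hom_comp[OF 3(3) b(2)] q2(1,2)] by blast
  define z1 z2 m where "z1 = (y1 \<cdot> t3) \<cdot> t" and "z2 = (x2 \<cdot> t3) \<cdot> t" and "m = (p \<cdot> t3) \<cdot> t"
  have z: "hom T U1 z1" "hom T U2 z2" and m: "hom T A m" "m \<in> W"
    unfolding z1_def z2_def m_def
    by (rule hom_comp[OF 4(1) y1t], rule hom_comp[OF 4(1) x2t], rule hom_comp[OF 4(1) pt],
        rule W_comp[OF 4(1) pt 4(2) W_comp[OF 3(1) p(1) 3(2) p(2)]])
  have m1: "a1 \<cdot> m = u1 \<cdot> z1" unfolding m_def z1_def
    by (rule square_comp[OF pt a(1) y1t u1(1) 4(1) square_comp[OF p(1) a(1) y1 u1(1) 3(1) ap1]])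
  have m2: "a2 \<cdot> m = u2 \<cdot> z2" unfolding m_def z2_def
    by (rule square_comp[OF pt a(2) x2t u2(1) 4(1) square_comp[OF p(1) a(2) 2(3) u2(1) 3(1) ap2]])
  have n1: "v1 \<cdot> z1 = b1 \<cdot> (l \<cdot> t)" unfolding z1_def by (rule square_comp[OF y1t u1(3) 3(3) b(1) 4(1) v1])
  have n2: "v2 \<cdot> z2 = b2 \<cdot> (l \<cdot> t)"
    unfolding z2_def using 4(3) assoc[OF 4(1) x2t u2(3)] assoc[OF 4(1) 3(3) b(2)] by simp
  \<comment> \<open>The common denominator is in \<open>W\<close> since it also factors through A,
    where s1 a1 and m are in \<open>W\<close>.\<close>
  have "s1 \<cdot> (u1 \<cdot> z1) = (s1 \<cdot> a1) \<cdot> m" using m1 assoc[OF m(1) a(1) r1(1)] by simp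
  then have s: "(s1 \<cdot> u1) \<cdot> z1 = (s1 \<cdot> a1) \<cdot> m" using assoc[OF z(1) u1(1) r1(1)] by simp
  have "(s2 \<cdot> u2) \<cdot> z2 = s2 \<cdot> (a2 \<cdot> m)" using m2 assoc[OF z(2) u2(1) r2(1)] by simp
  also have "\<dots> = s1 \<cdot> (a1 \<cdot> m)" by (rule square_comp[OF a(1) r1(1) a(2) r2(1) m(1) a(4), symmetric])
  also have "\<dots> = (s1 \<cdot> u1) \<cdot> z1" using m1 assoc[OF z(1) u1(1) r1(1)] by simp
  finally have "(s1 \<cdot> u1) \<cdot> z1 = (s2 \<cdot> u2) \<cdot> z2" ..
  moreover have "(s1 \<cdot> u1) \<cdot> z1 \<in> W"
    unfolding s by (rule W_comp[OF m(1) hom_comp[OF a(1) r1(1)] m(2) a(3)])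
  moreover have "(f1' \<cdot> v1) \<cdot> z1 = (f2' \<cdot> v2) \<cdot> z2"
    using assoc[OF z(1) u1(3) q1(3)] assoc[OF z(2) u2(3) q2(3)] n1 n2
      square_comp[OF b(1) q1(3) b(2) q2(3) hom_comp[OF 4(1) 3(3)] b(5)] by simp
  ultimately show ?thesis
    unfolding roof_equiv_iff[OF hom_comp[OF u1(1) r1(1)] hom_comp[OF u2(1) r2(1)]] using z by blast
qed

text \<open>Evaluates the definite description in \<open>loc_comp\<close>: any choice of
  representatives and Ore square gives the same class by \<open>comp_well_defined\<close>.\<close>

lemma loc_comp_eq:
  assumes r: "hom Z X s" "s \<in> W" "hom Z Y f" and q: "hom Z' Y s'" "s' \<in> W" "hom Z' V f'"
    and u: "hom U Z u" "u \<in> W" "hom U Z' v" "f \<cdot> u = s' \<cdot> v"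
  shows "loc_comp K W (roof_class K W Y V (Z', s', f')) (roof_class K W X Y (Z, s, f)) =
    roof_class K W X V (U, s \<cdot> u, f' \<cdot> v)"
proof -
  have Ob: "X \<in> Ob K" "Y \<in> Ob K" "V \<in> Ob K" using r q by (auto simp: hom_def)
  have mem: "(Z1, s1, f1) \<in> fst (snd (roof_class K W X' Y' (Z0, s0, f0))) \<longleftrightarrow>
      hom Z1 X' s1 \<and> s1 \<in> W \<and> hom Z1 Y' f1 \<and> roof_equiv K W (Z0, s0, f0) (Z1, s1, f1)"
    if "X' \<in> Ob K" "Y' \<in> Ob K" for Z1 s1 f1 X' Y' Z0 s0 f0
    using that by (auto simp: roof_class_def roofs_iff)
  show ?thesis
    unfolding loc_comp_def mem[OF Ob(1,2)] mem[OF Ob(2,3)]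
  proof (rule the_equality)
    show "\<exists>Z1 s1 f1 Z1' s1' f1'.
        (hom Z1 X s1 \<and> s1 \<in> W \<and> hom Z1 Y f1 \<and> roof_equiv K W (Z, s, f) (Z1, s1, f1)) \<and>
        (hom Z1' Y s1' \<and> s1' \<in> W \<and> hom Z1' V f1' \<and> roof_equiv K W (Z', s', f') (Z1', s1', f1')) \<and>
        (\<exists>U1\<in>Ob K. \<exists>u1\<in>Hom K U1 Z1 \<inter> W. \<exists>v1\<in>Hom K U1 Z1'. f1 \<cdot> u1 = s1' \<cdot> v1 \<and>
          roof_class K W X V (U, s \<cdot> u, f' \<cdot> v) =
          roof_class K W (fst (roof_class K W X Y (Z, s, f))) (snd (snd (roof_class K W Y V (Z', s', f'))))
            (U1, s1 \<cdot> u1, f1' \<cdot> v1))"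
      using r q u roof_equiv_refl[OF r] roof_equiv_refl[OF q]
      by (intro exI[of _ Z] exI[of _ s] exI[of _ f] exI[of _ Z'] exI[of _ s'] exI[of _ f'] conjI)
        (auto simp: hom_def roof_class_def)
  next
    fix c assume "\<exists>Z1 s1 f1 Z1' s1' f1'.
        (hom Z1 X s1 \<and> s1 \<in> W \<and> hom Z1 Y f1 \<and> roof_equiv K W (Z, s, f) (Z1, s1, f1)) \<and>
        (hom Z1' Y s1' \<and> s1' \<in> W \<and> hom Z1' V f1' \<and> roof_equiv K W (Z', s', f') (Z1', s1', f1')) \<and>
        (\<exists>U1\<in>Ob K. \<exists>u1\<in>Hom K U1 Z1 \<inter> W. \<exists>v1\<in>Hom K U1 Z1'. f1 \<cdot> u1 = s1' \<cdot> v1 \<and>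
          c = roof_class K W (fst (roof_class K W X Y (Z, s, f))) (snd (snd (roof_class K W Y V (Z', s', f'))))
            (U1, s1 \<cdot> u1, f1' \<cdot> v1))"
    then obtain Z1 s1 f1 Z1' s1' f1' U1 u1 v1 where
      r1: "hom Z1 X s1" "s1 \<in> W" "hom Z1 Y f1" "roof_equiv K W (Z, s, f) (Z1, s1, f1)" and
      q1: "hom Z1' Y s1'" "s1' \<in> W" "hom Z1' V f1'" "roof_equiv K W (Z', s', f') (Z1', s1', f1')" and
      U1: "U1 \<in> Ob K" "u1 \<in> Hom K U1 Z1" "u1 \<in> W" "v1 \<in> Hom K U1 Z1'" "f1 \<cdot> u1 = s1' \<cdot> v1" and
      c: "c = roof_class K W X V (U1, s1 \<cdot> u1, f1' \<cdot> v1)"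
      by (auto simp: roof_class_def)
    have u1: "hom U1 Z1 u1" "u1 \<in> W" "hom U1 Z1' v1" "f1 \<cdot> u1 = s1' \<cdot> v1"
      using U1 r1 q1 by (auto simp: hom_def)
    have "roof_equiv K W (U, s \<cdot> u, f' \<cdot> v) (U1, s1 \<cdot> u1, f1' \<cdot> v1)"
      by (rule comp_well_defined[OF r r1(1-3) q q1(1-3) r1(4) q1(4) u u1])
    then show "c = roof_class K W X V (U, s \<cdot> u, f' \<cdot> v)"
      unfolding c
      using roof_class_eq_iff[OF hom_comp[OF u(1) r(1)] W_comp[OF u(1) r(1) u(2) r(2)] hom_comp[OF u(3) q(3)]
          hom_comp[OF u1(1) r1(1)] W_comp[OF u1(1) r1(1) u1(2) r1(2)] hom_comp[OF u1(3) q1(3)]] by simp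
  qed
qed

lemma hom_Id: "X \<in> Ob K \<Longrightarrow> hom X X (Id K X)"
  by (simp add: hom_def K_Id)

lemma comp_Id: "hom X Y f \<Longrightarrow> f \<cdot> Id K X = f" "hom X Y f \<Longrightarrow> Id K Y \<cdot> f = f"
  by (auto simp: hom_def K_Comp_Id K_Id_Comp)

lemma roof_inverse:
  assumes s: "hom Z X s" "s \<in> W" and f: "hom Z Y f" "f \<in> W"
  shows "loc_comp K W (roof_class K W Y X (Z, f, s)) (roof_class K W X Y (Z, s, f)) =
    roof_class K W X X (X, Id K X, Id K X)"
proof -
  have Ob: "X \<in> Ob K" "Z \<in> Ob K" using s by (auto simp: hom_def)
  have "loc_comp K W (roof_class K W Y X (Z, f, s)) (roof_class K W X Y (Z, s, f)) =
      roof_class K W X X (Z, s \<cdot> Id K Z, s \<cdot> Id K Z)"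
    by (rule loc_comp_eq[OF s f(1) f s(1) hom_Id[OF Ob(2)] W_Id[OF Ob(2)] hom_Id[OF Ob(2)] refl])
  also have "\<dots> = roof_class K W X X (Z, s, s)" by (simp add: comp_Id[OF s(1)])
  also have "\<dots> = roof_class K W X X (X, Id K X, Id K X)"
    unfolding roof_class_eq_iff[OF s(1,2,1) hom_Id[OF Ob(1)] W_Id[OF Ob(1)] hom_Id[OF Ob(1)]]
      roof_equiv_iff[OF s(1) hom_Id[OF Ob(1)]]
    by (rule exI[of _ Z], rule exI[of _ "Id K Z"], rule exI[of _ s])
      (simp add: hom_Id[OF Ob(2)] s comp_Id[OF s(1)])
  finally show ?thesis .
qed

lemma loc_comp_field: "Comp (localization K W) = loc_comp K W"
  by (simp add: localization_def)

lemma isomorphic_localization: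
  assumes s: "hom Z X s" "s \<in> W" and f: "hom Z Y f" "f \<in> W"
  shows "isomorphic (localization K W) X Y"
proof -
  have Ob: "X \<in> Ob K" "Y \<in> Ob K" using s f by (auto simp: hom_def)
  have "roof_class K W X Y (Z, s, f) \<in> Hom (localization K W) X Y"
    "roof_class K W Y X (Z, f, s) \<in> Hom (localization K W) Y X"
    using s f by (simp_all add: localization_def roofs_iff Ob)
  moreover have "loc_comp K W (roof_class K W Y X (Z, f, s)) (roof_class K W X Y (Z, s, f)) =
      Id (localization K W) X"
    "loc_comp K W (roof_class K W X Y (Z, s, f)) (roof_class K W Y X (Z, f, s)) =
      Id (localization K W) Y"
    using roof_inverse[OF s f] roof_inverse[OF f s] by (simp_all add: localization_def)
  ultimately show ?thesis
    unfolding isomorphic_def is_iso_def loc_comp_field by blast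
qed

text \<open>Unpacks an equation with the identity into maps of the homotopy category, in the form
  that the saturation argument consumes.\<close>

lemma loc_comp_eq_IdE:
  assumes r: "hom Z X s" "s \<in> W" "hom Z Y f" and q: "hom Z' Y s'" "s' \<in> W" "hom Z' X g"
    and eq: "loc_comp K W (roof_class K W Y X (Z', s', g)) (roof_class K W X Y (Z, s, f)) =
      roof_class K W X X (X, Id K X, Id K X)"
  obtains U u v V a where "hom U Z u" "u \<in> W" "hom U Z' v" "f \<cdot> u = s' \<cdot> v" "hom V U a"
    "(s \<cdot> u) \<cdot> a \<in> W" "g \<cdot> (v \<cdot> a) \<in> W"
proof -
  have X: "X \<in> Ob K" using r by (auto simp: hom_def)
  obtain U u v where u: "hom U Z u" "u \<in> W" "hom U Z' v" "f \<cdot> u = s' \<cdot> v"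
    using oreE[OF r(3) q(1,2)] by blast
  note su = hom_comp[OF u(1) r(1)] W_comp[OF u(1) r(1) u(2) r(2)]
  have "roof_equiv K W (U, s \<cdot> u, g \<cdot> v) (X, Id K X, Id K X)"
    using roof_class_eq_iff[OF su hom_comp[OF u(3) q(3)] hom_Id[OF X] W_Id[OF X] hom_Id[OF X]] eq
      loc_comp_eq[OF r q u] by simp
  then obtain V a b where a: "hom V U a" "hom V X b" "(s \<cdot> u) \<cdot> a \<in> W" "(s \<cdot> u) \<cdot> a = Id K X \<cdot> b"
    "(g \<cdot> v) \<cdot> a = Id K X \<cdot> b"
    unfolding roof_equiv_iff[OF su(1) hom_Id[OF X]] by blast
  then have "g \<cdot> (v \<cdot> a) \<in> W" using assoc[OF a(1) u(3) q(3)] by simp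
  with that u a show ?thesis by blast
qed

end

section \<open>Homotopy and derived categories\<close>

lemma Kb_sel [simp]:
  "Ob (Kb A) = {X. bounded_cplx A X}" "Hom (Kb A) = (\<lambda>X Y. hclass A X Y ` {f. chain_map A X Y f})"
  "Id (Kb A) = (\<lambda>X. hclass A X X (\<lambda>i. Id A (cob X i)))" "Comp (Kb A) = Comp (Kb_lin A)"
  "Zero (Kb A) = (\<lambda>X Y. hclass A X Y (\<lambda>i. Zero A (cob X i) (cob Y i)))"
  "ShO (Kb A) = cplx_shift A"
  by (simp_all add: Kb_def lincat.defs tricat.defs Kb_lin_def)

lemma Db_sel [simp]:
  "Ob (Db A) = {X. bounded_cplx A X}" "Hom (Db A) = Hom (localization (Kb A) (quasi_isos A))"
  "Id (Db A) = Id (localization (Kb A) (quasi_isos A))"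
  "Comp (Db A) = Comp (localization (Kb A) (quasi_isos A))"
  "Zero (Db A) = Zero (localization (Kb A) (quasi_isos A))" "ShO (Db A) = cplx_shift A"
  by (simp_all add: Db_def lincat.defs tricat.defs Db_lin_def localization_def)

context enough_projectives_category
begin

text \<open>The homotopy class of a chain map given in the ring. As \<open>op\<close> is injective
  on each Hom set, such a map has only one preimage f to choose.\<close>

definition km :: "('o, 'm) cplx \<Rightarrow> ('o, 'm) cplx \<Rightarrow> (int \<Rightarrow> ('o, 'm) group_family endomorphism) \<Rightarrow> ('o, 'm) kmor"
  where "km X Y r = hclass C X Y (SOME f. chain_map C X Y f \<and> r = (\<lambda>i. op (f i)))"

lemma hclass_eq_iff:
  assumes X: "bounded_cplx C X" and Y: "bounded_cplx C Y"
    and f: "chain_map C X Y f" and g: "chain_map C X Y g"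
  shows "hclass C X Y f = hclass C X Y g \<longleftrightarrow> R.htpy (opc X) (opc Y) (\<lambda>i. op (f i)) (\<lambda>i. op (g i))"
proof
  note iff = homotopic_iff[OF X Y]
  note refl = R.htpy_refl[OF cx_opc[OF X] cx_opc[OF Y]]
  { assume "hclass C X Y f = hclass C X Y g"
    moreover have "g \<in> fst (snd (hclass C X Y g))" using g by (simp add: hclass_def iff refl)
    ultimately have "homotopic C X Y f g" by (auto simp: hclass_def)
    then show "R.htpy (opc X) (opc Y) (\<lambda>i. op (f i)) (\<lambda>i. op (g i))" using f g by (simp add: iff) }
  assume h: "R.htpy (opc X) (opc Y) (\<lambda>i. op (f i)) (\<lambda>i. op (g i))"
  have "homotopic C X Y f k \<longleftrightarrow> homotopic C X Y g k" if "chain_map C X Y k" for k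
    unfolding iff[OF f that] iff[OF g that] using R.htpy_trans[OF h] R.htpy_trans[OF R.htpy_sym[OF h]] by blast
  then show "hclass C X Y f = hclass C X Y g" by (auto simp: hclass_def)
qed

lemma hclass_km:
  assumes X: "bounded_cplx C X" and Y: "bounded_cplx C Y" and f: "chain_map C X Y f"
  shows "hclass C X Y f = km X Y (\<lambda>i. op (f i))"
proof -
  define g where "g = (SOME g. chain_map C X Y g \<and> (\<lambda>i. op (f i)) = (\<lambda>i. op (g i)))"
  have "\<exists>g. chain_map C X Y g \<and> (\<lambda>i. op (f i)) = (\<lambda>i. op (g i))" using f by blast
  from someI_ex[OF this] have g: "chain_map C X Y g" "(\<lambda>i. op (f i)) = (\<lambda>i. op (g i))"
    unfolding g_def by blast+
  have "hclass C X Y f = hclass C X Y g"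
    unfolding hclass_eq_iff[OF X Y f g(1)] g(2) by (rule R.htpy_refl[OF cx_opc[OF X] cx_opc[OF Y]])
  then show ?thesis unfolding km_def g_def .
qed

lemma km_cases:
  assumes X: "bounded_cplx C X" and Y: "bounded_cplx C Y" and r: "R.cmap (opc X) (opc Y) r"
  obtains f where "chain_map C X Y f" "r = (\<lambda>i. op (f i))" "km X Y r = hclass C X Y f"
proof -
  obtain f where f: "chain_map C X Y f" "r = (\<lambda>i. op (f i))" using cmap_lift[OF X Y r] .
  show ?thesis by (rule that[OF f]) (simp add: hclass_km[OF X Y f(1)] f(2))
qed

lemma hom_Kb_iff:
  assumes X: "bounded_cplx C X" and Y: "bounded_cplx C Y"
  shows "a \<in> Hom (Kb C) X Y \<longleftrightarrow> (\<exists>r. R.cmap (opc X) (opc Y) r \<and> a = km X Y r)"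
proof
  assume "a \<in> Hom (Kb C) X Y"
  then obtain f where "chain_map C X Y f" "a = hclass C X Y f" by auto
  then show "\<exists>r. R.cmap (opc X) (opc Y) r \<and> a = km X Y r"
    using cmap_op[OF X Y] hclass_km[OF X Y] by blast
next
  assume "\<exists>r. R.cmap (opc X) (opc Y) r \<and> a = km X Y r"
  then show "a \<in> Hom (Kb C) X Y" by (auto elim: km_cases[OF X Y])
qed

lemma km_eq_iff:
  assumes X: "bounded_cplx C X" and Y: "bounded_cplx C Y"
    and "R.cmap (opc X) (opc Y) r" "R.cmap (opc X) (opc Y) r'"
  shows "km X Y r = km X Y r' \<longleftrightarrow> R.htpy (opc X) (opc Y) r r'"
proof -
  obtain f where f: "chain_map C X Y f" "r = (\<lambda>i. op (f i))" "km X Y r = hclass C X Y f"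
    using km_cases[OF X Y assms(3)] .
  obtain g where g: "chain_map C X Y g" "r' = (\<lambda>i. op (g i))" "km X Y r' = hclass C X Y g"
    using km_cases[OF X Y assms(4)] .
  show ?thesis using hclass_eq_iff[OF X Y f(1) g(1)] f(2,3) g(2,3) by simp
qed

lemma km_Comp:
  assumes X: "bounded_cplx C X" and Y: "bounded_cplx C Y" and Z: "bounded_cplx C Z"
    and r: "R.cmap (opc X) (opc Y) r" and q: "R.cmap (opc Y) (opc Z) q"
  shows "km Y Z q \<cdot>\<^bsub>Kb C\<^esub> km X Y r = km X Z (\<lambda>i. q i * r i)"
proof -
  obtain f where f: "chain_map C X Y f" "r = (\<lambda>i. op (f i))" "km X Y r = hclass C X Y f"
    using km_cases[OF X Y r] .
  obtain g where g: "chain_map C Y Z g" "q = (\<lambda>i. op (g i))" "km Y Z q = hclass C Y Z g"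
    using km_cases[OF Y Z q] .
  \<comment> \<open>\<open>Comp\<close> multiplies the representatives picked by
    \<open>hrep\<close>, which agree with the given ones only up to homotopy.\<close>
  have rep: "chain_map C X' Y' (hrep (hclass C X' Y' h)) \<and>
      R.htpy (opc X') (opc Y') (\<lambda>i. op (h i)) (\<lambda>i. op (hrep (hclass C X' Y' h) i))"
    if X': "bounded_cplx C X'" and Y': "bounded_cplx C Y'" and h: "chain_map C X' Y' h" for X' Y' h
  proof -
    have "h \<in> fst (snd (hclass C X' Y' h))"
      using h by (simp add: hclass_def homotopic_iff[OF X' Y'] R.htpy_refl[OF cx_opc[OF X'] cx_opc[OF Y']])
    then have "hrep (hclass C X' Y' h) \<in> fst (snd (hclass C X' Y' h))"
      unfolding hrep_def by (rule someI[of "\<lambda>k. k \<in> fst (snd (hclass C X' Y' h))"])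
    then have *: "chain_map C X' Y' (hrep (hclass C X' Y' h))" "homotopic C X' Y' h (hrep (hclass C X' Y' h))"
      by (simp_all add: hclass_def)
    then show ?thesis using homotopic_iff[OF X' Y' h *(1)] by blast
  qed
  let ?f = "hrep (hclass C X Y f)" and ?g = "hrep (hclass C Y Z g)"
  note rf = rep[OF X Y f(1)] and rg = rep[OF Y Z g(1)]
  have comp: "op (?g i \<cdot> ?f i) = op (?g i) * op (?f i)" "?g i \<cdot> ?f i \<in> Hom C (cob X i) (cob Z i)" for i
    using op_Comp[OF bounded_cplxD(1)[OF X] bounded_cplxD(1)[OF Y] bounded_cplxD(1)[OF Z]
        chain_map_hom[of X Y ?f i] chain_map_hom[of Y Z ?g i]]
      Comp_hom[OF bounded_cplxD(1)[OF X] bounded_cplxD(1)[OF Y] bounded_cplxD(1)[OF Z]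
        chain_map_hom[of X Y ?f i] chain_map_hom[of Y Z ?g i]] rf rg by blast+
  have c: "R.cmap (opc X) (opc Z) (\<lambda>i. op (?g i) * op (?f i))"
    using R.cmap_comp[OF cmap_op[OF X Y] cmap_op[OF Y Z]] rf rg by blast
  then have "chain_map C X Z (\<lambda>i. ?g i \<cdot> ?f i)" by (simp add: chain_map_iff[OF X Z] comp)
  then have "hclass C X Z (\<lambda>i. ?g i \<cdot> ?f i) = km X Z (\<lambda>i. op (?g i) * op (?f i))"
    using hclass_km[OF X Z] comp(1) by simp
  also have "\<dots> = km X Z (\<lambda>i. q i * r i)"
    unfolding km_eq_iff[OF X Z c R.cmap_comp[OF r q]]
  proof (rule R.htpy_trans)
    show "R.htpy (opc X) (opc Z) (\<lambda>i. op (?g i) * op (?f i)) (\<lambda>i. op (g i) * op (?f i))"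
      using R.htpy_comp_right[OF R.htpy_sym cmap_op[OF X Y]] rf rg by blast
    show "R.htpy (opc X) (opc Z) (\<lambda>i. op (g i) * op (?f i)) (\<lambda>i. q i * r i)"
      unfolding f(2) g(2) using R.htpy_comp_left[OF R.htpy_sym cmap_op[OF Y Z g(1)]] rf by blast
  qed
  finally show ?thesis unfolding f(3) g(3) by (simp add: Kb_lin_def hclass_def)
qed

lemma km_Id:
  assumes X: "bounded_cplx C X"
  shows "Id (Kb C) X = km X X (\<lambda>i. op (Id C (cob X i)))"
proof -
  have "chain_map C X X (\<lambda>i. Id C (cob X i))"
    using R.cmap_id[OF cx_opc[OF X]] Id_hom[OF bounded_cplxD(1)[OF X]] by (simp add: chain_map_iff[OF X X])
  then show ?thesis using hclass_km[OF X X] by simp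
qed

lemma km_Zero:
  assumes X: "bounded_cplx C X" and Y: "bounded_cplx C Y"
  shows "Zero (Kb C) X Y = km X Y (\<lambda>i. 0)"
proof -
  note z = Zero_hom[OF bounded_cplxD(1)[OF X] bounded_cplxD(1)[OF Y]]
    op_Zero[OF bounded_cplxD(1)[OF X] bounded_cplxD(1)[OF Y]]
  have "chain_map C X Y (\<lambda>i. Zero C (cob X i) (cob Y i))"
    using R.cmap_zero[OF cx_opc[OF X] cx_opc[OF Y]] by (simp add: chain_map_iff[OF X Y] z)
  then show ?thesis using hclass_km[OF X Y] by (simp add: z)
qed

text \<open>\<open>quasi_isos\<close> asks for some representative only; homotopy invariance extends
  the condition to all of them.\<close>

lemma km_quasi_iso_iff:
  assumes X: "bounded_cplx C X" and Y: "bounded_cplx C Y" and r: "R.cmap (opc X) (opc Y) r"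
  shows "km X Y r \<in> quasi_isos C \<longleftrightarrow> R.qis (opc X) (opc Y) r"
proof
  obtain f where f: "chain_map C X Y f" "r = (\<lambda>i. op (f i))" "km X Y r = hclass C X Y f"
    using km_cases[OF X Y r] .
  { assume "km X Y r \<in> quasi_isos C"
    then obtain g where g: "quasi_iso_map C X Y g" "hclass C X Y f = hclass C X Y g"
      unfolding f(3) quasi_isos_def by (auto simp: hclass_def)
    then have "chain_map C X Y g" "R.qis (opc X) (opc Y) (\<lambda>i. op (g i))"
      by (simp_all add: quasi_iso_map_iff[OF X Y])
    then show "R.qis (opc X) (opc Y) r"
      using R.qis_htpy R.htpy_sym r hclass_eq_iff[OF X Y f(1)] g(2) f(2) by blast }
  assume "R.qis (opc X) (opc Y) r"
  then have "quasi_iso_map C X Y f" using f by (simp add: quasi_iso_map_iff[OF X Y])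
  then show "km X Y r \<in> quasi_isos C" unfolding f(3) quasi_isos_def using X Y by blast
qed

lemma Kb_homE:
  assumes "X \<in> Ob (Kb C)" "Y \<in> Ob (Kb C)" "a \<in> Hom (Kb C) X Y"
  obtains r where "bounded_cplx C X" "bounded_cplx C Y" "R.cmap (opc X) (opc Y) r" "a = km X Y r"
  using assms hom_Kb_iff by auto

text \<open>The chain-level Ore and cancellation lemmas become equations here because homotopic maps
  have equal classes.\<close>

sublocale Q: right_fractions "Kb C" "quasi_isos C"
proof
  fix X assume "X \<in> Ob (Kb C)"
  then have X: "bounded_cplx C X" by simp
  note i = R.cmap_id[OF cx_opc[OF X], simplified]
  show "Id (Kb C) X \<in> Hom (Kb C) X X" using hom_Kb_iff[OF X X] km_Id[OF X] i by blast
  show "Id (Kb C) X \<in> quasi_isos C"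
    unfolding km_Id[OF X] km_quasi_iso_iff[OF X X i] using R.qis_id[OF cx_opc[OF X]] by simp
next
  fix X Y Z f g
  assume Ob: "X \<in> Ob (Kb C)" "Y \<in> Ob (Kb C)" "Z \<in> Ob (Kb C)"
    and f: "f \<in> Hom (Kb C) X Y" and g: "g \<in> Hom (Kb C) Y Z"
  obtain r where r: "bounded_cplx C X" "bounded_cplx C Y" "R.cmap (opc X) (opc Y) r" "f = km X Y r"
    using Kb_homE[OF Ob(1,2) f] .
  obtain q where q: "bounded_cplx C Z" "R.cmap (opc Y) (opc Z) q" "g = km Y Z q"
    using Kb_homE[OF Ob(2,3) g] .
  note c = km_Comp[OF r(1,2) q(1) r(3) q(2)] and rq = R.cmap_comp[OF r(3) q(2)]
  show "g \<cdot>\<^bsub>Kb C\<^esub> f \<in> Hom (Kb C) X Z" unfolding r(4) q(3) c hom_Kb_iff[OF r(1) q(1)] using rq by blast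
  show "g \<cdot>\<^bsub>Kb C\<^esub> f \<in> quasi_isos C" if "f \<in> quasi_isos C" "g \<in> quasi_isos C"
    using that R.qis_comp unfolding r(4) q(3) c
    by (simp add: km_quasi_iso_iff[OF r(1,2,3)] km_quasi_iso_iff[OF r(2) q(1,2)] km_quasi_iso_iff[OF r(1) q(1) rq])
next
  fix X Y f
  assume Ob: "X \<in> Ob (Kb C)" "Y \<in> Ob (Kb C)" and f: "f \<in> Hom (Kb C) X Y"
  obtain r where r: "bounded_cplx C X" "bounded_cplx C Y" "R.cmap (opc X) (opc Y) r" "f = km X Y r"
    using Kb_homE[OF Ob(1,2) f] .
  note iX = R.cmap_id[OF cx_opc[OF r(1)], simplified] and iY = R.cmap_id[OF cx_opc[OF r(2)], simplified]
  have "r i * op (Id C (cob X i)) = r i" "op (Id C (cob Y i)) * r i = r i" for i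
    using R.e_right R.e_left R.cmapD(1)[OF r(3), of i] by simp_all
  then show "f \<cdot>\<^bsub>Kb C\<^esub> Id (Kb C) X = f" "Id (Kb C) Y \<cdot>\<^bsub>Kb C\<^esub> f = f"
    unfolding r(4) km_Id[OF r(1)] km_Id[OF r(2)]
    by (simp_all only: km_Comp[OF r(1,1,2) iX r(3)] km_Comp[OF r(1,2,2,3) iY])
next
  fix X Y Z V f g h
  assume Ob: "X \<in> Ob (Kb C)" "Y \<in> Ob (Kb C)" "Z \<in> Ob (Kb C)" "V \<in> Ob (Kb C)"
    and f: "f \<in> Hom (Kb C) X Y" and g: "g \<in> Hom (Kb C) Y Z" and h: "h \<in> Hom (Kb C) Z V"
  obtain r where r: "bounded_cplx C X" "bounded_cplx C Y" "R.cmap (opc X) (opc Y) r" "f = km X Y r"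
    using Kb_homE[OF Ob(1,2) f] .
  obtain q where q: "bounded_cplx C Z" "R.cmap (opc Y) (opc Z) q" "g = km Y Z q"
    using Kb_homE[OF Ob(2,3) g] .
  obtain p where p: "bounded_cplx C V" "R.cmap (opc Z) (opc V) p" "h = km Z V p"
    using Kb_homE[OF Ob(3,4) h] .
  show "(h \<cdot>\<^bsub>Kb C\<^esub> g) \<cdot>\<^bsub>Kb C\<^esub> f = h \<cdot>\<^bsub>Kb C\<^esub> (g \<cdot>\<^bsub>Kb C\<^esub> f)"
    unfolding r(4) q(3) p(3)
    by (simp only: km_Comp[OF r(1,2) q(1) r(3) q(2)] km_Comp[OF r(2) q(1) p(1) q(2) p(2)]
        km_Comp[OF r(1) q(1) p(1) R.cmap_comp[OF r(3) q(2)] p(2)]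
        km_Comp[OF r(1,2) p(1) r(3) R.cmap_comp[OF q(2) p(2)]] mult.assoc)
next
  fix X Y Z f s
  assume Ob: "X \<in> Ob (Kb C)" "Y \<in> Ob (Kb C)" "Z \<in> Ob (Kb C)"
    and f: "f \<in> Hom (Kb C) X Y" and s: "s \<in> Hom (Kb C) Z Y" "s \<in> quasi_isos C"
  obtain r where r: "bounded_cplx C X" "bounded_cplx C Y" "R.cmap (opc X) (opc Y) r" "f = km X Y r"
    using Kb_homE[OF Ob(1,2) f] .
  obtain q where q: "bounded_cplx C Z" "R.cmap (opc Z) (opc Y) q" "s = km Z Y q"
    using Kb_homE[OF Ob(3,2) s(1)] .
  have qis: "R.qis (opc Z) (opc Y) q" using s(2) q km_quasi_iso_iff[OF q(1) r(2) q(2)] by simp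
  obtain U' t v where U': "R.cx U'" "R.qis U' (opc X) t" "R.cmap U' (opc Z) v"
    "R.htpy U' (opc Y) (\<lambda>i. r i * t i) (\<lambda>i. q i * v i)"
    using R.qis_ore[OF cx_opc[OF r(1)] cx_opc[OF r(2)] cx_opc[OF q(1)] r(3) qis] by blast
  obtain U where U: "bounded_cplx C U" "opc U = U'" using cx_lift[OF U'(1)] .
  note t = U'(2-4)[folded U(2)]
  note ct = R.qisD(1)[OF t(1)]
  have "km U X t \<in> Hom (Kb C) U X" "km U X t \<in> quasi_isos C" "km U Z v \<in> Hom (Kb C) U Z"
    using hom_Kb_iff[OF U(1) r(1)] hom_Kb_iff[OF U(1) q(1)] km_quasi_iso_iff[OF U(1) r(1) ct] ct t by blast+
  moreover have "f \<cdot>\<^bsub>Kb C\<^esub> km U X t = s \<cdot>\<^bsub>Kb C\<^esub> km U Z v"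
    unfolding r(4) q(3) km_Comp[OF U(1) r(1,2) ct r(3)] km_Comp[OF U(1) q(1) r(2) t(2) q(2)]
      km_eq_iff[OF U(1) r(2) R.cmap_comp[OF ct r(3)] R.cmap_comp[OF t(2) q(2)]] by (rule t(3))
  ultimately show "\<exists>U\<in>Ob (Kb C). \<exists>t\<in>Hom (Kb C) U X \<inter> quasi_isos C. \<exists>v\<in>Hom (Kb C) U Z.
      f \<cdot>\<^bsub>Kb C\<^esub> t = s \<cdot>\<^bsub>Kb C\<^esub> v"
    using U(1) unfolding Kb_sel(1) mem_Collect_eq by blast
next
  fix X Y Z f g s
  assume Ob: "X \<in> Ob (Kb C)" "Y \<in> Ob (Kb C)" "Z \<in> Ob (Kb C)"
    and f: "f \<in> Hom (Kb C) X Y" and g: "g \<in> Hom (Kb C) X Y"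
    and s: "s \<in> Hom (Kb C) Y Z" "s \<in> quasi_isos C" and eq: "s \<cdot>\<^bsub>Kb C\<^esub> f = s \<cdot>\<^bsub>Kb C\<^esub> g"
  obtain r where r: "bounded_cplx C X" "bounded_cplx C Y" "R.cmap (opc X) (opc Y) r" "f = km X Y r"
    using Kb_homE[OF Ob(1,2) f] .
  obtain r' where r': "R.cmap (opc X) (opc Y) r'" "g = km X Y r'"
    using Kb_homE[OF Ob(1,2) g] .
  obtain q where q: "bounded_cplx C Z" "R.cmap (opc Y) (opc Z) q" "s = km Y Z q"
    using Kb_homE[OF Ob(2,3) s(1)] .
  have qis: "R.qis (opc Y) (opc Z) q" using s(2) q km_quasi_iso_iff[OF r(2) q(1,2)] by simp
  have "R.htpy (opc X) (opc Z) (\<lambda>i. q i * r i) (\<lambda>i. q i * r' i)"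
    using eq unfolding r(4) r'(2) q(3) km_Comp[OF r(1,2) q(1) r(3) q(2)] km_Comp[OF r(1,2) q(1) r'(1) q(2)]
      km_eq_iff[OF r(1) q(1) R.cmap_comp[OF r(3) q(2)] R.cmap_comp[OF r'(1) q(2)]] .
  then obtain U' t where U': "R.cx U'" "R.qis U' (opc X) t"
    "R.htpy U' (opc Y) (\<lambda>i. r i * t i) (\<lambda>i. r' i * t i)"
    using R.qis_cancel[OF cx_opc[OF r(1)] cx_opc[OF r(2)] cx_opc[OF q(1)] r(3) r'(1) qis] by blast
  obtain U where U: "bounded_cplx C U" "opc U = U'" using cx_lift[OF U'(1)] .
  note t = U'(2-3)[folded U(2)]
  note ct = R.qisD(1)[OF t(1)]
  have "km U X t \<in> Hom (Kb C) U X" "km U X t \<in> quasi_isos C"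
    using hom_Kb_iff[OF U(1) r(1)] km_quasi_iso_iff[OF U(1) r(1) ct] ct t by blast+
  moreover have "f \<cdot>\<^bsub>Kb C\<^esub> km U X t = g \<cdot>\<^bsub>Kb C\<^esub> km U X t"
    unfolding r(4) r'(2) km_Comp[OF U(1) r(1,2) ct r(3)] km_Comp[OF U(1) r(1,2) ct r'(1)]
      km_eq_iff[OF U(1) r(2) R.cmap_comp[OF ct r(3)] R.cmap_comp[OF ct r'(1)]] by (rule t(2))
  ultimately show "\<exists>U\<in>Ob (Kb C). \<exists>t\<in>Hom (Kb C) U X \<inter> quasi_isos C. f \<cdot>\<^bsub>Kb C\<^esub> t = g \<cdot>\<^bsub>Kb C\<^esub> t"
    using U(1) unfolding Kb_sel(1) mem_Collect_eq by blast
qed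

lemma Q_hom_iff: "Q.hom X Y a \<longleftrightarrow>
    bounded_cplx C X \<and> bounded_cplx C Y \<and> (\<exists>r. R.cmap (opc X) (opc Y) r \<and> a = km X Y r)"
  unfolding Q.hom_def using hom_Kb_iff[of X Y a] by auto

lemma Q_homI:
  "\<lbrakk>bounded_cplx C X; bounded_cplx C Y; R.cmap (opc X) (opc Y) r\<rbrakk> \<Longrightarrow> Q.hom X Y (km X Y r)"
  by (auto simp: Q_hom_iff)

section \<open>Isomorphism in the derived category\<close>

definition dequiv :: "('o, 'm) cplx \<Rightarrow> ('o, 'm) cplx \<Rightarrow> bool"
  where "dequiv X Y \<longleftrightarrow> bounded_cplx C X \<and> bounded_cplx C Y \<and>
    (\<exists>Z s s'. bounded_cplx C Z \<and> R.qis (opc Z) (opc X) s \<and> R.qis (opc Z) (opc Y) s')"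

lemma dequiv_of_qis:
  assumes "bounded_cplx C X" "bounded_cplx C Y" "R.qis (opc X) (opc Y) s"
  shows "dequiv X Y"
  unfolding dequiv_def using assms R.qis_id[OF cx_opc[OF assms(1)]] by blast

lemma dequiv_sym: "dequiv X Y \<Longrightarrow> dequiv Y X"
  unfolding dequiv_def by blast

text \<open>The roofs are joined by an Ore square with f t homotopic to s' v. Here f t and s' are
  quasi-isomorphisms, and hence so is v.\<close>

lemma dequiv_trans:
  assumes "dequiv X Y" "dequiv Y V"
  shows "dequiv X V"
proof -
  obtain Z s f where Z: "bounded_cplx C Z" "R.qis (opc Z) (opc X) s" "R.qis (opc Z) (opc Y) f"
    using assms(1) unfolding dequiv_def by blast
  obtain Z' s' f' where Z': "bounded_cplx C Z'" "R.qis (opc Z') (opc Y) s'" "R.qis (opc Z') (opc V) f'"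
    using assms(2) unfolding dequiv_def by blast
  have B: "bounded_cplx C X" "bounded_cplx C Y" "bounded_cplx C V" using assms by (auto simp: dequiv_def)
  obtain U' t v where U': "R.cx U'" "R.qis U' (opc Z) t" "R.cmap U' (opc Z') v"
    "R.htpy U' (opc Y) (\<lambda>i. f i * t i) (\<lambda>i. s' i * v i)"
    using R.qis_ore[OF cx_opc[OF Z(1)] cx_opc[OF B(2)] cx_opc[OF Z'(1)] R.qisD(1)[OF Z(3)] Z'(2)] by blast
  obtain U where U: "bounded_cplx C U" "opc U = U'" using cx_lift[OF U'(1)] .
  note s'v = R.qis_htpy[OF R.qis_comp[OF U'(2) Z(3)] U'(4) R.cmap_comp[OF U'(3) R.qisD(1)[OF Z'(2)]]]
  have "R.qis U' (opc Z') v"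
    unfolding R.qis_def
    using U'(3) R.hinj_of_comp[OF R.qisD(1)[OF Z'(2)] R.qisD(2)[OF s'v]]
      R.hsurj_cancel_left[OF U'(3) R.qisD(1)[OF Z'(2)] R.qisD(3)[OF s'v] R.qisD(2)[OF Z'(2)]] by blast
  then show ?thesis
    unfolding dequiv_def
    using B U R.qis_comp[OF U'(2) Z(2)] R.qis_comp[OF _ Z'(3)] by blast
qed

lemma dequiv_shift:
  assumes "dequiv X Y"
  shows "dequiv (cplx_shift C n X) (cplx_shift C n Y)"
proof -
  obtain Z s f where Z: "bounded_cplx C Z" "R.qis (opc Z) (opc X) s" "R.qis (opc Z) (opc Y) f"
    "bounded_cplx C X" "bounded_cplx C Y"
    using assms unfolding dequiv_def by blast
  show ?thesis
    unfolding dequiv_def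
    using Z(1,4,5)[THEN bounded_cplx_shift] R.qis_shift[OF Z(2), of n] R.qis_shift[OF Z(3), of n]
      Z(1,4,5)[THEN opc_shift] by metis
qed

text \<open>A roof with two quasi-isomorphic legs is inverted by exchanging the legs. Conversely, an
  isomorphism and its inverse are given by two roofs, and saturation applied to both composites
  makes f a quasi-isomorphism.\<close>

lemma isomorphic_Db_iff:
  assumes X: "bounded_cplx C X" and Y: "bounded_cplx C Y"
  shows "isomorphic (Db C) X Y \<longleftrightarrow> dequiv X Y"
proof
  assume "dequiv X Y"
  then obtain Z s f where Z: "bounded_cplx C Z" "R.qis (opc Z) (opc X) s" "R.qis (opc Z) (opc Y) f"
    unfolding dequiv_def by blast
  have "isomorphic (localization (Kb C) (quasi_isos C)) X Y"
    by (rule Q.isomorphic_localization[of Z _ "km Z X s" _ "km Z Y f"])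
      (use Z X Y R.qisD(1) Q_homI km_quasi_iso_iff in auto)
  then show "isomorphic (Db C) X Y" by (simp add: isomorphic_def is_iso_def)
next
  assume "isomorphic (Db C) X Y"
  then have "isomorphic (localization (Kb C) (quasi_isos C)) X Y" by (simp add: isomorphic_def is_iso_def)
  then obtain a b where a: "a \<in> roof_class (Kb C) (quasi_isos C) X Y ` roofs (Kb C) (quasi_isos C) X Y"
    "b \<in> roof_class (Kb C) (quasi_isos C) Y X ` roofs (Kb C) (quasi_isos C) Y X"
    and ab: "loc_comp (Kb C) (quasi_isos C) b a = roof_class (Kb C) (quasi_isos C) X X (X, Id (Kb C) X, Id (Kb C) X)"
    "loc_comp (Kb C) (quasi_isos C) a b = roof_class (Kb C) (quasi_isos C) Y Y (Y, Id (Kb C) Y, Id (Kb C) Y)"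
    unfolding isomorphic_def is_iso_def localization_def by (simp del: Kb_sel) blast
  have Ob: "X \<in> Ob (Kb C)" "Y \<in> Ob (Kb C)" using X Y by simp_all
  obtain Z s f where Z: "Q.hom Z X s" "s \<in> quasi_isos C" "Q.hom Z Y f"
    "a = roof_class (Kb C) (quasi_isos C) X Y (Z, s, f)"
    using a(1) Q.roofs_iff[OF Ob] by auto
  obtain Z' s' g where Z': "Q.hom Z' Y s'" "s' \<in> quasi_isos C" "Q.hom Z' X g"
    "b = roof_class (Kb C) (quasi_isos C) Y X (Z', s', g)"
    using a(2) Q.roofs_iff[OF Ob(2,1)] by auto
  obtain U u v V c where u: "Q.hom U Z u" "u \<in> quasi_isos C" "Q.hom U Z' v"
    "f \<cdot>\<^bsub>Kb C\<^esub> u = s' \<cdot>\<^bsub>Kb C\<^esub> v" "Q.hom V U c"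
    "(s \<cdot>\<^bsub>Kb C\<^esub> u) \<cdot>\<^bsub>Kb C\<^esub> c \<in> quasi_isos C" "g \<cdot>\<^bsub>Kb C\<^esub> (v \<cdot>\<^bsub>Kb C\<^esub> c) \<in> quasi_isos C"
    using Q.loc_comp_eq_IdE[OF Z(1-3) Z'(1-3) ab(1)[unfolded Z(4) Z'(4)]] .
  obtain U' v' V' c' where u': "Q.hom U' Z v'" "Q.hom V' U' c'" "f \<cdot>\<^bsub>Kb C\<^esub> (v' \<cdot>\<^bsub>Kb C\<^esub> c') \<in> quasi_isos C"
    using Q.loc_comp_eq_IdE[OF Z'(1-3) Z(1-3) ab(2)[unfolded Z(4) Z'(4)]] .
  obtain rs rf rs' rg ru rv rc rv' rc' where B: "bounded_cplx C Z" "bounded_cplx C Z'" "bounded_cplx C U"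
      "bounded_cplx C V" "bounded_cplx C U'" "bounded_cplx C V'"
    and r: "R.cmap (opc Z) (opc X) rs" "s = km Z X rs" "R.cmap (opc Z) (opc Y) rf" "f = km Z Y rf"
      "R.cmap (opc Z') (opc Y) rs'" "s' = km Z' Y rs'" "R.cmap (opc Z') (opc X) rg" "g = km Z' X rg"
      "R.cmap (opc U) (opc Z) ru" "u = km U Z ru" "R.cmap (opc U) (opc Z') rv" "v = km U Z' rv"
      "R.cmap (opc V) (opc U) rc" "c = km V U rc" "R.cmap (opc U') (opc Z) rv'" "v' = km U' Z rv'"
      "R.cmap (opc V') (opc U') rc'" "c' = km V' U' rc'"
    using Z(1,3) Z'(1,3) u(1,3,5) u'(1,2) unfolding Q_hom_iff by blast
  have qs: "R.qis (opc Z) (opc X) rs" and qs': "R.qis (opc Z') (opc Y) rs'" and qu: "R.qis (opc U) (opc Z) ru"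
    using Z(2) Z'(2) u(2) r km_quasi_iso_iff B X Y by blast+
  note su = R.cmap_comp[OF r(9) r(1)]
  have "R.qis (opc V) (opc X) (\<lambda>i. rs i * ru i * rc i)"
    using u(6) unfolding r(2,10,14) km_Comp[OF B(3,1) X r(9,1)] km_Comp[OF B(4,3) X r(13) su]
      km_quasi_iso_iff[OF B(4) X R.cmap_comp[OF r(13) su]] .
  \<comment> \<open>s u and s u c are quasi-isomorphisms, so c is surjective on cohomology;
    saturation carries injectivity back across c.\<close>
  then have hc: "R.hsurj (opc V) (opc U) rc"
    using R.hsurj_cancel_left[OF r(13) su] R.qisD R.qis_comp[OF qu qs] by blast
  note vc = R.cmap_comp[OF r(13) r(11)] and vc' = R.cmap_comp[OF r(17) r(15)]
  have gvc: "R.qis (opc V) (opc X) (\<lambda>i. rg i * (rv i * rc i))"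
    using u(7) unfolding r(8,12,14) km_Comp[OF B(4,3,2) r(13,11)] km_Comp[OF B(4,2) X vc r(7)]
      km_quasi_iso_iff[OF B(4) X R.cmap_comp[OF vc r(7)]] .
  have fvc: "R.qis (opc V') (opc Y) (\<lambda>i. rf i * (rv' i * rc' i))"
    using u'(3) unfolding r(4,16,18) km_Comp[OF B(6,5,1) r(17,15)] km_Comp[OF B(6,1) Y vc' r(3)]
      km_quasi_iso_iff[OF B(6) Y R.cmap_comp[OF vc' r(3)]] .
  have sq: "R.htpy (opc U) (opc Y) (\<lambda>i. rf i * ru i) (\<lambda>i. rs' i * rv i)"
    using u(4) unfolding r(4,6,10,12) km_Comp[OF B(3,1) Y r(9,3)] km_Comp[OF B(3,2) Y r(11,5)]
      km_eq_iff[OF B(3) Y R.cmap_comp[OF r(9,3)] R.cmap_comp[OF r(11,5)]] .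
  have "R.qis (opc Z) (opc Y) rf"
    by (rule R.qis_of_inverse_roof[OF qs r(3) qs' r(7) qu r(11) sq r(13) R.qisD(2)[OF gvc] hc r(15,17)
          R.qisD(3)[OF fvc]])
  then show "dequiv X Y" unfolding dequiv_def using X Y B(1) qs by blast
qed

section \<open>Bounded complexes of projectives\<close>

text \<open>The delicate clause is the vanishing of the outer terms, since
  \<open>is_zero_obj\<close> quantifies over fewer objects in \<open>Proj C\<close>. It is decided
  by \<open>Id C P\<close> alone, which is the same in both categories.\<close>

lemma bounded_cplx_Proj_iff:
  "bounded_cplx (Proj C) X \<longleftrightarrow> bounded_cplx C X \<and> (\<forall>i. projective_obj C (cob X i))"
proof -
  have z: "is_zero_obj (Proj C) P \<longleftrightarrow> is_zero_obj C P" if P: "projective_obj C P" for P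
  proof
    have POb: "P \<in> Ob C" using P by (simp add: projective_obj_def)
    { assume "is_zero_obj (Proj C) P"
      then have "Hom C P P = {Zero C P P}" using P by (auto simp: is_zero_obj_def Proj_def full_subcat_def)
      then have "Id C P = Zero C P P" using Id_hom[OF POb] by blast
      then show "is_zero_obj C P" using zero_obj_iff[OF POb] op_Zero[OF POb POb] by simp }
    assume "is_zero_obj C P"
    then show "is_zero_obj (Proj C) P" using P by (auto simp: is_zero_obj_def Proj_def full_subcat_def)
  qed
  have f: "Ob (Proj C) = {P. projective_obj C P}" "Hom (Proj C) = Hom C" "Comp (Proj C) = Comp C"
    "Zero (Proj C) = Zero C"
    by (auto simp: Proj_def full_subcat_def projective_obj_def)
  show ?thesis
  proof (cases "\<forall>i. projective_obj C (cob X i)")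
    case True
    then have "\<And>i. cob X i \<in> Ob C" by (simp add: projective_obj_def)
    with True z show ?thesis by (simp add: bounded_cplx_def f)
  next
    case False
    then show ?thesis by (auto simp: bounded_cplx_def f)
  qed
qed

lemma Kb_Proj_sel:
  "Ob (KbProj C) = {X. bounded_cplx C X \<and> (\<forall>i. projective_obj C (cob X i))}"
  "Hom (KbProj C) = Hom (Kb C)" "Comp (KbProj C) = Comp (Kb C)" "Id (KbProj C) = Id (Kb C)"
  "ShO (KbProj C) = cplx_shift C"
proof -
  have h: "hclass (Proj C) = hclass C" "chain_map (Proj C) = chain_map C"
    by (auto simp: fun_eq_iff hclass_def chain_map_def homotopic_def Proj_def full_subcat_def)
  show "Ob (KbProj C) = {X. bounded_cplx C X \<and> (\<forall>i. projective_obj C (cob X i))}"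
    by (simp add: KbProj_def bounded_cplx_Proj_iff)
  show "Hom (KbProj C) = Hom (Kb C)" by (simp add: KbProj_def h)
  show "Comp (KbProj C) = Comp (Kb C)"
    by (simp add: KbProj_def Kb_lin_def h) (simp add: Proj_def full_subcat_def)
  show "Id (KbProj C) = Id (Kb C)"
    by (simp add: KbProj_def h) (simp add: Proj_def full_subcat_def)
  show "ShO (KbProj C) = cplx_shift C"
    by (simp add: KbProj_def cplx_shift_def fun_eq_iff) (simp add: Proj_def full_subcat_def)
qed

lemma KbProj_ObD:
  assumes "P \<in> Ob (KbProj C)"
  shows "bounded_cplx C P" "R.cx (opc P)" "cob (opc P) i \<in> {P. projective_obj C P}"
  using assms cx_opc by (auto simp: Kb_Proj_sel)

lemma isomorphic_Kb_E:
  assumes X: "bounded_cplx C X" and Y: "bounded_cplx C Y" and "isomorphic (Kb C) X Y"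
  obtains u v where "R.cmap (opc X) (opc Y) u" "R.cmap (opc Y) (opc X) v"
    "R.htpy (opc X) (opc X) (\<lambda>i. v i * u i) (\<lambda>i. op (Id C (cob (opc X) i)))"
    "R.htpy (opc Y) (opc Y) (\<lambda>i. u i * v i) (\<lambda>i. op (Id C (cob (opc Y) i)))"
proof -
  obtain a b where ab: "a \<in> Hom (Kb C) X Y" "b \<in> Hom (Kb C) Y X"
    "b \<cdot>\<^bsub>Kb C\<^esub> a = Id (Kb C) X" "a \<cdot>\<^bsub>Kb C\<^esub> b = Id (Kb C) Y"
    using assms(3) unfolding isomorphic_def is_iso_def by blast
  obtain u where u: "R.cmap (opc X) (opc Y) u" "a = km X Y u" using ab(1) hom_Kb_iff[OF X Y] by blast
  obtain v where v: "R.cmap (opc Y) (opc X) v" "b = km Y X v" using ab(2) hom_Kb_iff[OF Y X] by blast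
  note iX = R.cmap_id[OF cx_opc[OF X]] and iY = R.cmap_id[OF cx_opc[OF Y]]
  have "km X X (\<lambda>i. v i * u i) = km X X (\<lambda>i. op (Id C (cob (opc X) i)))"
    using ab(3) unfolding u(2) v(2) km_Comp[OF X Y X u(1) v(1)] km_Id[OF X] opc_sel .
  moreover have "km Y Y (\<lambda>i. u i * v i) = km Y Y (\<lambda>i. op (Id C (cob (opc Y) i)))"
    using ab(4) unfolding u(2) v(2) km_Comp[OF Y X Y v(1) u(1)] km_Id[OF Y] opc_sel .
  ultimately show ?thesis
    using that[OF u(1) v(1)] km_eq_iff[OF X X R.cmap_comp[OF u(1) v(1)] iX]
      km_eq_iff[OF Y Y R.cmap_comp[OF v(1) u(1)] iY] by blast
qed

lemma dequiv_of_isomorphic_Kb: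
  assumes X: "bounded_cplx C X" and Y: "bounded_cplx C Y" and "isomorphic (Kb C) X Y"
  shows "dequiv X Y"
proof -
  obtain u v where uv: "R.cmap (opc X) (opc Y) u" "R.cmap (opc Y) (opc X) v"
    "R.htpy (opc X) (opc X) (\<lambda>i. v i * u i) (\<lambda>i. op (Id C (cob (opc X) i)))"
    "R.htpy (opc Y) (opc Y) (\<lambda>i. u i * v i) (\<lambda>i. op (Id C (cob (opc Y) i)))"
    using isomorphic_Kb_E[OF assms] .
  show ?thesis by (rule dequiv_of_qis[OF X Y R.qis_of_htpy_inverse[OF cx_opc[OF X] cx_opc[OF Y] uv]])
qed

lemma no_maps_isomorphic_source:
  assumes X: "bounded_cplx C X" and Y: "bounded_cplx C Y" and "isomorphic (Kb C) X Y"
    and "R.no_maps (opc Y) V"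
  shows "R.no_maps (opc X) V"
proof -
  obtain u v where uv: "R.cmap (opc X) (opc Y) u" "R.cmap (opc Y) (opc X) v"
    "R.htpy (opc X) (opc X) (\<lambda>i. v i * u i) (\<lambda>i. op (Id C (cob (opc X) i)))"
    using isomorphic_Kb_E[OF X Y assms(3)] .
  show ?thesis by (rule R.no_maps_retract_source[OF uv assms(4)])
qed

lemma isomorphic_Kb_sym: "isomorphic (Kb C) X Y \<Longrightarrow> isomorphic (Kb C) Y X"
  unfolding isomorphic_def is_iso_def by blast

lemma no_maps_dequiv:
  assumes P: "P \<in> Ob (KbProj C)" and "dequiv X Y"
  shows "R.no_maps (opc P) (opc X) \<longleftrightarrow> R.no_maps (opc P) (opc Y)"
proof -
  obtain Z s f where Z: "bounded_cplx C Z" "R.qis (opc Z) (opc X) s" "R.qis (opc Z) (opc Y) f"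
    "bounded_cplx C X" "bounded_cplx C Y"
    using assms(2) unfolding dequiv_def by blast
  show ?thesis
    using R.no_maps_qis_iff[OF KbProj_ObD(2,3)[OF P] cx_opc[OF Z(1)] cx_opc[OF Z(4)] Z(2)]
      R.no_maps_qis_iff[OF KbProj_ObD(2,3)[OF P] cx_opc[OF Z(1)] cx_opc[OF Z(5)] Z(3)] by simp
qed

text \<open>For a roof (Z, s, f) out of P the denominator s has a section v, so the roof equals the
  fraction of f v over the identity. Conversely, a map that is zero in \<open>Db C\<close> is null
  after a quasi-isomorphism onto P, which splits.\<close>

lemma hom_Db_zero_iff:
  assumes P: "P \<in> Ob (KbProj C)" and Y: "bounded_cplx C Y"
  shows "Hom (Db C) P Y = {Zero (Db C) P Y} \<longleftrightarrow> R.no_maps (opc P) (opc Y)"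
    and "is_singleton (Hom (Db C) P Y) \<longleftrightarrow> R.no_maps (opc P) (opc Y)"
proof -
  note P' = KbProj_ObD[OF P]
  let ?W = "quasi_isos C"
  have Ob: "P \<in> Ob (Kb C)" "Y \<in> Ob (Kb C)" using P' Y by simp_all
  note I = Q.hom_Id[OF Ob(1)] Q.W_Id[OF Ob(1)]
  note z = R.cmap_zero[OF P'(2) cx_opc[OF Y]] and i = R.cmap_id[OF P'(2)]
  have zero: "Q.hom P Y (Zero (Kb C) P Y)" unfolding km_Zero[OF P'(1) Y] by (rule Q_homI[OF P'(1) Y z])
  have Zero: "Zero (Db C) P Y = roof_class (Kb C) ?W P Y (P, Id (Kb C) P, Zero (Kb C) P Y)"
    unfolding Db_sel(5) by (simp only: localization_def lincat.simps)
  have Hom: "Hom (Db C) P Y = roof_class (Kb C) ?W P Y ` roofs (Kb C) ?W P Y"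
    unfolding Db_sel(2) by (simp only: localization_def lincat.simps)
  have mem: "Zero (Db C) P Y \<in> Hom (Db C) P Y"
    unfolding Zero Hom using Q.roofs_iff[OF Ob] I zero by blast
  have "Hom (Db C) P Y = {Zero (Db C) P Y}" if no: "R.no_maps (opc P) (opc Y)"
  proof -
    have "roof_class (Kb C) ?W P Y (Z, s, f) = Zero (Db C) P Y"
      if h: "Q.hom Z P s" "s \<in> ?W" "Q.hom Z Y f" for Z s f
    proof -
      obtain rs rf where B: "bounded_cplx C Z" and rs: "R.cmap (opc Z) (opc P) rs" "s = km Z P rs"
        and rf: "R.cmap (opc Z) (opc Y) rf" "f = km Z Y rf"
        using h unfolding Q_hom_iff by blast
      have "R.qis (opc Z) (opc P) rs" using h(2) rs km_quasi_iso_iff[OF B P'(1)] by blast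
      then obtain v where v: "R.cmap (opc P) (opc Z) v"
        "R.htpy (opc P) (opc P) (\<lambda>i. op (Id C (cob (opc P) i))) (\<lambda>i. rs i * v i)"
        using R.qis_section[OF cx_opc[OF B] P'(2,3)] by blast
      note hv = Q_homI[OF P'(1) B v(1)]
      have sv: "s \<cdot>\<^bsub>Kb C\<^esub> km P Z v = Id (Kb C) P"
        unfolding rs(2) km_Comp[OF P'(1) B P'(1) v(1) rs(1)] km_Id[OF P'(1)]
        using km_eq_iff[OF P'(1) P'(1) R.cmap_comp[OF v(1) rs(1)] i] R.htpy_sym[OF v(2)] by simp
      have fv: "f \<cdot>\<^bsub>Kb C\<^esub> km P Z v = Zero (Kb C) P Y"
        unfolding rf(2) km_Comp[OF P'(1) B Y v(1) rf(1)] km_Zero[OF P'(1) Y]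
          km_eq_iff[OF P'(1) Y R.cmap_comp[OF v(1) rf(1)] z]
        using no R.cmap_comp[OF v(1) rf(1)] by (simp add: R.no_maps_def)
      show ?thesis
        unfolding Zero Q.roof_class_eq_iff[OF h I zero] Q.roof_equiv_iff[OF h(1) I(1)]
        by (intro exI[of _ P] exI[of _ "km P Z v"] exI[of _ "Id (Kb C) P"])
          (simp only: hv I sv fv Q.comp_Id(1)[OF I(1)] Q.comp_Id(1)[OF zero] simp_thms)
    qed
    then have "Hom (Db C) P Y \<subseteq> {Zero (Db C) P Y}"
      unfolding Hom using Q.roofs_iff[OF Ob] by auto
    with mem show ?thesis by blast
  qed
  moreover have "R.no_maps (opc P) (opc Y)" if single: "is_singleton (Hom (Db C) P Y)"
    unfolding R.no_maps_def
  proof (intro allI impI)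
    fix x assume x: "R.cmap (opc P) (opc Y) x"
    note hx = Q_homI[OF P'(1) Y x]
    have "roof_class (Kb C) ?W P Y (P, Id (Kb C) P, km P Y x) \<in> Hom (Db C) P Y"
      unfolding Hom using Q.roofs_iff[OF Ob] I hx by blast
    then have "roof_class (Kb C) ?W P Y (P, Id (Kb C) P, km P Y x) = Zero (Db C) P Y"
      using mem single by (auto simp: is_singleton_def)
    then have "roof_equiv (Kb C) ?W (P, Id (Kb C) P, km P Y x) (P, Id (Kb C) P, Zero (Kb C) P Y)"
      unfolding Zero Q.roof_class_eq_iff[OF I hx I zero] .
    then obtain U t t' where t: "Q.hom U P t" "Q.hom U P t'" "Id (Kb C) P \<cdot>\<^bsub>Kb C\<^esub> t \<in> ?W"
      "km P Y x \<cdot>\<^bsub>Kb C\<^esub> t = Zero (Kb C) P Y \<cdot>\<^bsub>Kb C\<^esub> t'"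
      unfolding Q.roof_equiv_iff[OF I(1) I(1)] by blast
    obtain r r' where U: "bounded_cplx C U" and r: "R.cmap (opc U) (opc P) r" "t = km U P r"
      and r': "R.cmap (opc U) (opc P) r'" "t' = km U P r'"
      using t(1,2) unfolding Q_hom_iff by blast
    have "R.qis (opc U) (opc P) r"
      using t(3) Q.comp_Id(2)[OF t(1)] r km_quasi_iso_iff[OF U P'(1)] by simp
    moreover have "R.htpy (opc U) (opc Y) (\<lambda>i. x i * r i) (\<lambda>i. 0)"
      using t(4) km_eq_iff[OF U Y R.cmap_comp[OF r(1) x] R.cmap_comp[OF r'(1) z]]
      unfolding r(2) r'(2) km_Zero[OF P'(1) Y] km_Comp[OF U P'(1) Y r(1) x] km_Comp[OF U P'(1) Y r'(1) z]
      by simp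
    ultimately show "R.htpy (opc P) (opc Y) x (\<lambda>i. 0)"
      by (rule R.null_of_qis_null[OF cx_opc[OF U] P'(2,3) cx_opc[OF Y] _ x])
  qed
  ultimately show "Hom (Db C) P Y = {Zero (Db C) P Y} \<longleftrightarrow> R.no_maps (opc P) (opc Y)"
    "is_singleton (Hom (Db C) P Y) \<longleftrightarrow> R.no_maps (opc P) (opc Y)"
    unfolding is_singleton_def by blast+
qed

section \<open>Triangles as mapping cones\<close>

abbreviation cone_of :: "('o, 'm) cplx \<Rightarrow> ('o, 'm) cplx \<Rightarrow> ('o, 'm) cplx \<Rightarrow> bool"
  where "cone_of X Y Z \<equiv> bounded_cplx C X \<and> bounded_cplx C Y \<and> bounded_cplx C Z \<and>
    (\<exists>f \<alpha> \<iota> \<pi> \<beta>. ring_cone (Ob C) opHom (\<lambda>X. op (Id C X)) {P. projective_obj C P}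
      (opc X) (opc Y) (opc Z) f \<alpha> \<iota> \<pi> \<beta>)"

lemma standard_triangle_cone_of:
  assumes "standard_triangle C X Y Z a b c"
  shows "cone_of X Y Z"
proof -
  have B: "bounded_cplx C X" "bounded_cplx C Y" "bounded_cplx C Z"
    using assms by (simp_all add: standard_triangle_def)
  obtain f \<iota> \<pi> where f: "chain_map C X Y f" and "mapping_cone C X Y f Z \<iota> \<pi>"
    using assms unfolding standard_triangle_def by blast
  then obtain \<alpha> \<beta> where
    bp: "\<And>i. is_biproduct C (cob X (i + 1)) (cob Y i) (cob Z i) (\<alpha> i) (\<iota> i) (\<pi> i) (\<beta> i)"
    and d: "\<And>i. cdiff Z i = (\<alpha> (i + 1) \<cdot> Scale C (-1) (cdiff X (i + 1)) \<cdot> \<pi> i) \<oplus>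
        ((\<iota> (i + 1) \<cdot> f (i + 1) \<cdot> \<pi> i) \<oplus> (\<iota> (i + 1) \<cdot> cdiff Y i \<cdot> \<beta> i))"
    unfolding mapping_cone_def by blast
  note DX = bounded_cplxD[OF B(1)] and DY = bounded_cplxD[OF B(2)] and DZ = bounded_cplxD[OF B(3)]
  note fh = chain_map_hom[OF f]
  have h: "\<alpha> i \<in> Hom C (cob X (i + 1)) (cob Z i)" "\<iota> i \<in> Hom C (cob Y i) (cob Z i)"
    "\<pi> i \<in> Hom C (cob Z i) (cob X (i + 1))" "\<beta> i \<in> Hom C (cob Z i) (cob Y i)" for i
    using bp[of i] by (auto simp: is_biproduct_def)
  have eqs: "op (\<pi> i) * op (\<alpha> i) = op (Id C (cob X (i + 1)))" "op (\<beta> i) * op (\<iota> i) = op (Id C (cob Y i))"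
    "op (\<pi> i) * op (\<iota> i) = 0" "op (\<beta> i) * op (\<alpha> i) = 0"
    "op (\<alpha> i) * op (\<pi> i) + op (\<iota> i) * op (\<beta> i) = op (Id C (cob Z i))" for i
    using bp[of i] op_Plus[OF DZ(1) DZ(1) Comp_hom[OF DZ(1) DX(1) DZ(1) h(3) h(1)]
        Comp_hom[OF DZ(1) DY(1) DZ(1) h(4) h(2)], of i]
    by (simp_all add: is_biproduct_def op_Zero[OF DX(1) DY(1)] op_Zero[OF DY(1) DX(1)]
        op_Comp[OF DX(1) DZ(1) DX(1) h(1) h(3), symmetric] op_Comp[OF DY(1) DZ(1) DY(1) h(2) h(4), symmetric]
        op_Comp[OF DY(1) DZ(1) DX(1) h(2) h(3), symmetric] op_Comp[OF DX(1) DZ(1) DY(1) h(1) h(4), symmetric]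
        op_Comp[OF DZ(1) DX(1) DZ(1) h(3) h(1), symmetric] op_Comp[OF DZ(1) DY(1) DZ(1) h(4) h(2), symmetric])
  have dz: "op (cdiff Z i) = op (\<alpha> (i + 1)) * (- op (cdiff X (i + 1)) * op (\<pi> i)) +
      (op (\<iota> (i + 1)) * (op (f (i + 1)) * op (\<pi> i)) + op (\<iota> (i + 1)) * (op (cdiff Y i) * op (\<beta> i)))" for i
  proof -
    note m = Scale_hom[OF DX(1) DX(1) DX(2)]
    note a1 = Comp_hom[OF DZ(1) DX(1) DX(1) h(3) m] and b1 = Comp_hom[OF DZ(1) DX(1) DY(1) h(3) fh]
      and c1 = Comp_hom[OF DZ(1) DY(1) DY(1) h(4) DY(2)]
    note a2 = Comp_hom[OF DZ(1) DX(1) DZ(1) a1 h(1)] and b2 = Comp_hom[OF DZ(1) DY(1) DZ(1) b1 h(2)]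
      and c2 = Comp_hom[OF DZ(1) DY(1) DZ(1) c1 h(2)]
    show ?thesis
      unfolding d[of i] op_Plus[OF DZ(1) DZ(1) a2 Plus_hom[OF DZ(1) DZ(1) b2 c2]]
        op_Plus[OF DZ(1) DZ(1) b2 c2] op_Comp[OF DZ(1) DX(1) DZ(1) a1 h(1)]
        op_Comp[OF DZ(1) DX(1) DX(1) h(3) m] op_Comp[OF DZ(1) DY(1) DZ(1) b1 h(2)]
        op_Comp[OF DZ(1) DX(1) DY(1) h(3) fh] op_Comp[OF DZ(1) DY(1) DZ(1) c1 h(2)]
        op_Comp[OF DZ(1) DY(1) DY(1) h(4) DY(2)] op_minus[OF DX(1) DX(1) DX(2)] ..
  qed
  have "ring_cone (Ob C) opHom (\<lambda>X. op (Id C X)) {P. projective_obj C P} (opc X) (opc Y) (opc Z)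
      (\<lambda>i. op (f i)) (\<lambda>i. op (\<alpha> i)) (\<lambda>i. op (\<iota> i)) (\<lambda>i. op (\<pi> i)) (\<lambda>i. op (\<beta> i))"
    by unfold_locales
      (simp_all only: opc_sel cx_opc B cmap_op[OF B(1,2) f] opHomI[OF h(1) DX(1) DZ(1)]
        opHomI[OF h(2) DY(1) DZ(1)] opHomI[OF h(3) DZ(1) DX(1)] opHomI[OF h(4) DZ(1) DY(1)] eqs dz)
  with B show ?thesis by blast
qed

lemma Kb_triangleE:
  assumes "Tri (Kb C) X Y Z f g h"
  obtains X' Y' Z' where "cone_of X' Y' Z'" "bounded_cplx C X" "bounded_cplx C Y" "bounded_cplx C Z"
    "isomorphic (Kb C) X X'" "isomorphic (Kb C) Y Y'" "isomorphic (Kb C) Z Z'"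
proof -
  have "iso_triangle (Kb_lin C) (cplx_shift C 1) (kmor_shift C 1) (standard_triangle C) X Y Z f g h"
    using assms by (simp add: Kb_def lincat.defs tricat.defs)
  then obtain X' Y' Z' f' g' h' a b c where B: "X \<in> Ob (Kb_lin C)" "Y \<in> Ob (Kb_lin C)" "Z \<in> Ob (Kb_lin C)"
    and st: "standard_triangle C X' Y' Z' f' g' h'"
    and iso: "is_iso (Kb_lin C) X X' a" "is_iso (Kb_lin C) Y Y' b" "is_iso (Kb_lin C) Z Z' c"
    unfolding iso_triangle_def by blast
  have "is_iso (Kb C) = is_iso (Kb_lin C)"
    by (simp add: is_iso_def fun_eq_iff) (simp add: Kb_lin_def)
  with iso have "isomorphic (Kb C) X X'" "isomorphic (Kb C) Y Y'" "isomorphic (Kb C) Z Z'"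
    unfolding isomorphic_def by (metis (no_types))+
  moreover have "bounded_cplx C X" "bounded_cplx C Y" "bounded_cplx C Z"
    using B by (simp_all add: Kb_lin_def)
  ultimately show ?thesis using that[OF standard_triangle_cone_of[OF st]] by blast
qed

text \<open>Of a triangle only its objects are kept, up to roofs; the map of the cone serves as its
  first morphism. Vanishing of Hom is all that is transported along this comparison.\<close>

lemma Db_triangleE:
  assumes "Tri (Db C) X Y Z f g h"
  obtains X' Y' Z' where "cone_of X' Y' Z'" "dequiv X X'" "dequiv Y Y'" "dequiv Z Z'"
proof -
  have "iso_triangle (Db_lin C) (cplx_shift C 1) (dmor_shift C 1)
      (\<lambda>X Y Z f g h. \<exists>f' g' h'. Tri (Kb C) X Y Z f' g' h' \<and> f = Qloc C f' \<and> g = Qloc C g' \<and> h = Qloc C h')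
      X Y Z f g h"
    using assms by (simp add: Db_def lincat.defs tricat.defs)
  then obtain X1 Y1 Z1 f1 g1 h1 a b c where
    B: "X \<in> Ob (Db_lin C)" "Y \<in> Ob (Db_lin C)" "Z \<in> Ob (Db_lin C)"
    and tri: "Tri (Kb C) X1 Y1 Z1 f1 g1 h1"
    and iso: "is_iso (Db_lin C) X X1 a" "is_iso (Db_lin C) Y Y1 b" "is_iso (Db_lin C) Z Z1 c"
    unfolding iso_triangle_def by blast
  obtain X' Y' Z' where 1: "cone_of X' Y' Z'" "bounded_cplx C X1" "bounded_cplx C Y1" "bounded_cplx C Z1"
    "isomorphic (Kb C) X1 X'" "isomorphic (Kb C) Y1 Y'" "isomorphic (Kb C) Z1 Z'"
    using Kb_triangleE[OF tri] .
  have "is_iso (Db C) = is_iso (Db_lin C)"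
    by (simp add: is_iso_def fun_eq_iff Db_lin_def)
  with iso have "isomorphic (Db C) X X1" "isomorphic (Db C) Y Y1" "isomorphic (Db C) Z Z1"
    unfolding isomorphic_def by (metis (no_types))+
  moreover have "bounded_cplx C X" "bounded_cplx C Y" "bounded_cplx C Z"
    using B by (simp_all add: Db_lin_def localization_def)
  ultimately have "dequiv X X1" "dequiv Y Y1" "dequiv Z Z1"
    using isomorphic_Db_iff 1(2-4) by blast+
  moreover have "dequiv X1 X'" "dequiv Y1 Y'" "dequiv Z1 Z'"
    using dequiv_of_isomorphic_Kb 1 by blast+
  ultimately show ?thesis using that[OF 1(1)] dequiv_trans by blast
qed

text \<open>Hom sets, composition and sums in \<open>Proj C\<close> are those of \<open>C\<close>,
  so its biproducts and cones remain such in \<open>C\<close>.\<close>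

lemma KbProj_triangle:
  assumes "Tri (KbProj C) X Y Z f g h"
  shows "Tri (Kb C) X Y Z f g h"
proof -
  have h: "hclass (Proj C) = hclass C" "chain_map (Proj C) = chain_map C" "cplx_shift (Proj C) = cplx_shift C"
    by (auto simp: fun_eq_iff hclass_def chain_map_def homotopic_def cplx_shift_def Proj_def full_subcat_def)
  have "Ob (Proj C) \<subseteq> Ob C" "Hom (Proj C) = Hom C" "Comp (Proj C) = Comp C" "Plus (Proj C) = Plus C"
    "Id (Proj C) = Id C" "Zero (Proj C) = Zero C" "Scale (Proj C) = Scale C"
    by (auto simp: Proj_def full_subcat_def)
  then have cone: "mapping_cone (Proj C) X Y f Z \<iota> \<pi> \<Longrightarrow> mapping_cone C X Y f Z \<iota> \<pi>" for X Y f Z \<iota> \<pi>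
    unfolding mapping_cone_def is_biproduct_def by (elim exE) (rule exI, rule exI, auto)
  have st: "standard_triangle (Proj C) X Y Z a b c \<Longrightarrow> standard_triangle C X Y Z a b c" for X Y Z a b c
    unfolding standard_triangle_def h bounded_cplx_Proj_iff using cone by blast
  have k: "Hom (Kb_lin (Proj C)) = Hom (Kb_lin C)" "Comp (Kb_lin (Proj C)) = Comp (Kb_lin C)"
    "Id (Kb_lin (Proj C)) = Id (Kb_lin C)" "Ob (Kb_lin (Proj C)) \<subseteq> Ob (Kb_lin C)"
    using Kb_Proj_sel(2-4) by (auto simp: KbProj_def Kb_lin_def bounded_cplx_Proj_iff h)
  have iso: "is_iso (Kb_lin (Proj C)) = is_iso (Kb_lin C)"
    unfolding is_iso_def k by simp
  have s: "kmor_shift (Proj C) = kmor_shift C" by (simp add: fun_eq_iff kmor_shift_def h)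
  have "iso_triangle (Kb_lin (Proj C)) (cplx_shift C 1) (kmor_shift C 1) (standard_triangle (Proj C)) X Y Z f g h"
    using assms by (simp add: KbProj_def Kb_def lincat.defs tricat.defs h s)
  then have "iso_triangle (Kb_lin C) (cplx_shift C 1) (kmor_shift C 1) (standard_triangle C) X Y Z f g h"
    unfolding iso_triangle_def iso k using st k(4) by blast
  then show ?thesis by (simp add: Kb_def lincat.defs tricat.defs)
qed

lemma isomorphic_KbProj: "isomorphic (KbProj C) = isomorphic (Kb C)"
  by (simp only: isomorphic_def is_iso_def fun_eq_iff Kb_Proj_sel simp_thms)

section \<open>Recovering the t-structure from the weight structure\<close>

lemma mem_hom_orthogonal_iff:
  assumes "S \<subseteq> Ob (Db C)"
  shows "X \<in> hom_orthogonal_to C S \<longleftrightarrow> X \<in> Ob (KbProj C) \<and> (\<forall>Y\<in>S. R.no_maps (opc X) (opc Y))"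
  using assms hom_Db_zero_iff(1)[of X] unfolding hom_orthogonal_to_def Db_sel(1) by blast

lemma corresponding_weight_structure_iff:
  assumes t: "t_structure (Db C) t"
  shows "Q \<in> le_part (corresponding_weight_structure C t) \<longleftrightarrow> Q \<in> Ob (KbProj C) \<and>
      (\<forall>Y\<in>ge_part t. R.no_maps (opc Q) (opc (cplx_shift C (- 1) Y)))"
    and "Q \<in> ge_part (corresponding_weight_structure C t) \<longleftrightarrow> Q \<in> Ob (KbProj C) \<and>
      (\<forall>Y\<in>le_part t. R.no_maps (opc Q) (opc (cplx_shift C 1 Y)))"
proof -
  have "t_gt0 (Db C) t \<subseteq> Ob (Db C)" "t_lt0 (Db C) t \<subseteq> Ob (Db C)"
    using t bounded_cplx_shift by (auto simp: t_structure_def t_gt0_def t_lt0_def)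
  from this[THEN mem_hom_orthogonal_iff] show
    "Q \<in> le_part (corresponding_weight_structure C t) \<longleftrightarrow> Q \<in> Ob (KbProj C) \<and>
      (\<forall>Y\<in>ge_part t. R.no_maps (opc Q) (opc (cplx_shift C (- 1) Y)))"
    "Q \<in> ge_part (corresponding_weight_structure C t) \<longleftrightarrow> Q \<in> Ob (KbProj C) \<and>
      (\<forall>Y\<in>le_part t. R.no_maps (opc Q) (opc (cplx_shift C 1 Y)))"
    by (simp_all add: corresponding_weight_structure_def t_gt0_def t_lt0_def)
qed

lemma KbProj_shift: "cplx_shift C n X \<in> Ob (KbProj C)" if "X \<in> Ob (KbProj C)"
  using that bounded_cplx_shift[of X n] by (simp add: Kb_Proj_sel) (simp add: cplx_shift_def)

lemma acyclic_of_weight_structure: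
  assumes w: "weight_structure (KbProj C) w" and T: "bounded_cplx C T"
    and ge: "\<And>Q. Q \<in> ge_part w \<Longrightarrow> R.no_maps (opc (cplx_shift C (- 1) Q)) (opc T)"
    and le: "\<And>Q. Q \<in> le_part w \<Longrightarrow> R.no_maps (opc Q) (opc T)"
  shows "R.acyclic (opc T)"
proof (rule R.acyclic_of_no_maps[OF cx_opc[OF T]])
  fix P' assume P': "R.cx P'" "\<And>i. cob P' i \<in> {P. projective_obj C P}"
  obtain P where P: "bounded_cplx C P" "opc P = P'" using cx_lift[OF P'(1)] .
  have "P \<in> Ob (KbProj C)" using P P'(2) by (auto simp: Kb_Proj_sel)
  then obtain L N f g h where L: "L \<in> cplx_shift C (- 1) ` ge_part w" and N: "N \<in> le_part w"
    and tri: "Tri (KbProj C) L P N f g h"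
    using w unfolding weight_structure_def Kb_Proj_sel(5) by meson
  obtain L' P1 N' where c: "cone_of L' P1 N'" and B: "bounded_cplx C L" "bounded_cplx C P" "bounded_cplx C N"
    and iso: "isomorphic (Kb C) L L'" "isomorphic (Kb C) P P1" "isomorphic (Kb C) N N'"
    using Kb_triangleE[OF KbProj_triangle[OF tri]] .
  obtain f \<alpha> \<iota> \<pi> \<beta> where rc: "ring_cone (Ob C) opHom (\<lambda>X. op (Id C X)) {P. projective_obj C P}
      (opc L') (opc P1) (opc N') f \<alpha> \<iota> \<pi> \<beta>" using c by blast
  \<comment> \<open>The decomposition is an honest cone only up to isomorphism, along which
    vanishing is transported.\<close>
  have "R.no_maps (opc L') (opc T)" "R.no_maps (opc N') (opc T)"
    using no_maps_isomorphic_source[OF _ _ isomorphic_Kb_sym] iso c B L N ge le by blast+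
  then have "R.no_maps (opc P1) (opc T)" by (rule ring_cone.no_maps_from_target[OF rc])
  then show "R.no_maps P' (opc T)"
    using no_maps_isomorphic_source[OF B(2) _ iso(2)] c P(2) by blast
qed

lemma t_structure_orthogonal:
  assumes t: "t_structure (Db C) t" and w: "weight_structure (KbProj C) w"
    and wt: "w = corresponding_weight_structure C t" and Y: "bounded_cplx C Y"
  shows "(\<And>Q. Q \<in> ge_part w \<Longrightarrow> R.no_maps (opc (cplx_shift C (- 1) Q)) (opc Y)) \<Longrightarrow> Y \<in> le_part t"
    and "(\<And>Q. Q \<in> le_part w \<Longrightarrow> R.no_maps (opc (cplx_shift C 1 Q)) (opc Y)) \<Longrightarrow> Y \<in> ge_part t"
proof -
  have sub: "X \<in> le_part t \<Longrightarrow> bounded_cplx C X" "X \<in> ge_part t \<Longrightarrow> bounded_cplx C X" for X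
    using t by (auto simp: t_structure_def)
  have gt: "t_gt0 (Db C) t = cplx_shift C (- 1) ` ge_part t" and lt: "t_lt0 (Db C) t = cplx_shift C 1 ` le_part t"
    by (simp_all add: t_gt0_def t_lt0_def)
  have stable: "X \<in> le_part t \<Longrightarrow> cplx_shift C 1 X \<in> le_part t"
    "X \<in> ge_part t \<Longrightarrow> cplx_shift C (- 1) X \<in> ge_part t" for X
    using t by (auto simp: t_structure_def)
  have closed: "dequiv X V \<Longrightarrow> X \<in> le_part t \<Longrightarrow> V \<in> le_part t"
    "dequiv X V \<Longrightarrow> X \<in> ge_part t \<Longrightarrow> V \<in> ge_part t" for X V
    using t isomorphic_Db_iff[of X V] by (auto simp: t_structure_def iso_closed_def dequiv_def)
  have trunc: "\<exists>L\<in>le_part t. \<exists>N\<in>t_gt0 (Db C) t. \<exists>f g h. Tri (Db C) L X N f g h"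
    if "bounded_cplx C X" for X
    using t that by (auto simp: t_structure_def)
  have le: "Q \<in> le_part w \<longleftrightarrow> Q \<in> Ob (KbProj C) \<and> (\<forall>Y\<in>t_gt0 (Db C) t. R.no_maps (opc Q) (opc Y))"
    and ge: "Q \<in> ge_part w \<longleftrightarrow> Q \<in> Ob (KbProj C) \<and> (\<forall>Y\<in>t_lt0 (Db C) t. R.no_maps (opc Q) (opc Y))" for Q
    by (simp_all add: wt corresponding_weight_structure_iff[OF t] gt lt)
  \<comment> \<open>Orthogonality of Q to the shifted aisle, shifted back: Q[-1] is orthogonal to
    the whole aisle.\<close>
  have ge_le: "R.no_maps (opc (cplx_shift C (- 1) Q)) (opc X)" if "Q \<in> ge_part w" "X \<in> le_part t" for Q X
  proof -
    have "R.no_maps (opc Q) (opc (cplx_shift C 1 X))" using that ge lt by blast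
    from R.no_maps_shift[OF this, of "- 1"] show ?thesis
      using that sub ge KbProj_ObD(1) by (simp add: opc_shift R.shift_shift R.shift_zero)
  qed
  { assume hyp: "\<And>Q. Q \<in> ge_part w \<Longrightarrow> R.no_maps (opc (cplx_shift C (- 1) Q)) (opc Y)"
    obtain L N f g h where L: "L \<in> le_part t" and N: "N \<in> t_gt0 (Db C) t" and tri: "Tri (Db C) L Y N f g h"
      using trunc[OF Y] by blast
    obtain L' Y' N' where c: "cone_of L' Y' N'" and eq: "dequiv L L'" "dequiv Y Y'" "dequiv N N'"
      using Db_triangleE[OF tri] .
    obtain f \<alpha> \<iota> \<pi> \<beta> where "ring_cone (Ob C) opHom (\<lambda>X. op (Id C X)) {P. projective_obj C P}
        (opc L') (opc Y') (opc N') f \<alpha> \<iota> \<pi> \<beta>" using c by blast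
    then interpret rc: ring_cone "Ob C" opHom "\<lambda>X. op (Id C X)" "{P. projective_obj C P}"
      "opc L'" "opc Y'" "opc N'" f \<alpha> \<iota> \<pi> \<beta> .
    have "R.acyclic (opc N')"
    proof (rule acyclic_of_weight_structure[OF w])
      show "bounded_cplx C N'" using c by simp
      fix Q assume Q: "Q \<in> ge_part w"
      then have Q1: "cplx_shift C (- 1) Q \<in> Ob (KbProj C)" using ge KbProj_shift by blast
      have "R.no_maps (opc (cplx_shift C (- 1) Q)) (opc Y')"
        using hyp[OF Q] no_maps_dequiv[OF Q1 eq(2)] by blast
      moreover have "R.no_maps (opc (cplx_shift C (- 1) Q)) (opc (cplx_shift C 1 L'))"
        using ge_le[OF Q stable(1)[OF L]] no_maps_dequiv[OF Q1 dequiv_shift[OF eq(1)]] by blast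
      then have "R.no_maps (opc (cplx_shift C (- 1) Q)) (R.shift 1 (opc L'))"
        using opc_shift c by simp
      ultimately show "R.no_maps (opc (cplx_shift C (- 1) Q)) (opc N')" by (rule rc.no_maps_to_cone)
    next
      fix Q assume "Q \<in> le_part w"
      then show "R.no_maps (opc Q) (opc N')" using le N no_maps_dequiv[OF _ eq(3)] by blast
    qed
    then have "R.qis (opc L') (opc Y') f"
      unfolding R.qis_def using rc.f rc.acyclic_imp_hinj rc.acyclic_imp_hsurj by blast
    then have "dequiv L' Y'" using c dequiv_of_qis by blast
    then show "Y \<in> le_part t"
      using closed(1)[OF _ L] dequiv_trans eq dequiv_sym by blast }
  { assume hyp: "\<And>Q. Q \<in> le_part w \<Longrightarrow> R.no_maps (opc (cplx_shift C 1 Q)) (opc Y)"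
    \<comment> \<open>The last term of a truncation triangle has the form M[-1] with M in the
      coaisle. For Y[-1] the expected outcome is L acyclic and Y[-1] equivalent to M[-1], whence Y
      is equivalent to M.\<close>
    let ?Y = "cplx_shift C (- 1) Y"
    obtain L N f g h where L: "L \<in> le_part t" and N: "N \<in> t_gt0 (Db C) t" and tri: "Tri (Db C) L ?Y N f g h"
      using trunc[OF bounded_cplx_shift[OF Y]] by blast
    obtain L' Y' N' where c: "cone_of L' Y' N'" and eq: "dequiv L L'" "dequiv ?Y Y'" "dequiv N N'"
      using Db_triangleE[OF tri] .
    obtain f \<alpha> \<iota> \<pi> \<beta> where "ring_cone (Ob C) opHom (\<lambda>X. op (Id C X)) {P. projective_obj C P}
        (opc L') (opc Y') (opc N') f \<alpha> \<iota> \<pi> \<beta>" using c by blast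
    then interpret rc: ring_cone "Ob C" opHom "\<lambda>X. op (Id C X)" "{P. projective_obj C P}"
      "opc L'" "opc Y'" "opc N'" f \<alpha> \<iota> \<pi> \<beta> .
    obtain M where M: "M \<in> ge_part t" "N = cplx_shift C (- 1) M" using N gt by blast
    have "R.acyclic (opc L')"
    proof (rule acyclic_of_weight_structure[OF w])
      show "bounded_cplx C L'" using c by simp
      fix Q assume Q: "Q \<in> ge_part w"
      then have Q1: "cplx_shift C (- 1) Q \<in> Ob (KbProj C)" using ge KbProj_shift by blast
      show "R.no_maps (opc (cplx_shift C (- 1) Q)) (opc L')"
        using ge_le[OF Q L] no_maps_dequiv[OF Q1 eq(1)] by blast
    next
      fix Q assume Q: "Q \<in> le_part w"
      then have Q0: "Q \<in> Ob (KbProj C)" using le by blast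
      have "R.no_maps (opc Q) (opc ?Y)"
        using R.no_maps_shift[OF hyp[OF Q], of "- 1"] KbProj_ObD(1)[OF Q0] Y
        by (simp add: opc_shift R.shift_shift R.shift_zero)
      then have "R.no_maps (opc Q) (opc Y')" using no_maps_dequiv[OF Q0 eq(2)] by blast
      \<comment> \<open>N[-1] is again positive, so Q has no maps to the fibre, the term preceding
        L' in the rotated triangle.\<close>
      moreover have "cplx_shift C (- 1) N \<in> t_gt0 (Db C) t" using M stable(2) gt by blast
      then have "R.no_maps (opc Q) (opc (cplx_shift C (- 1) N))" using Q le by blast
      then have "R.no_maps (opc Q) (opc (cplx_shift C (- 1) N'))"
        using no_maps_dequiv[OF Q0 dequiv_shift[OF eq(3)]] by blast
      then have "R.no_maps (opc Q) rc.fib" using opc_shift c by simp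
      ultimately show "R.no_maps (opc Q) (opc L')" by (rule rc.no_maps_to_source)
    qed
    then have "dequiv Y' N'" using c dequiv_of_qis rc.acyclic_source_imp_qis_\<iota> by blast
    then have "dequiv ?Y (cplx_shift C (- 1) M)" using dequiv_trans eq dequiv_sym M(2) by blast
    then have "dequiv (cplx_shift C 1 ?Y) (cplx_shift C 1 (cplx_shift C (- 1) M))" by (rule dequiv_shift)
    then have "dequiv Y M" using cplx_shift_shift Y sub(2)[OF M(1)] by simp
    then show "Y \<in> ge_part t" using closed(2)[OF dequiv_sym M(1)] by blast }
qed

end

section \<open>Exactness of pseudo-adjoint functors\<close>

lemma is_singleton_bij_betw: "bij_betw f S T \<Longrightarrow> is_singleton S \<longleftrightarrow> is_singleton T"
  by (simp add: is_singleton_altdef bij_betw_same_card)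

theorem corollary5p2:
  fixes A :: "('o, 'm, 'k::field) lincat" and B :: "('p, 'n, 'k) lincat"
    and t w :: "('o, 'm) cplx halves" and t' w' :: "('p, 'n) cplx halves"
    and F :: "(('p, 'n) cplx, ('p, 'n) kmor, ('o, 'm) cplx, ('o, 'm) kmor) catfun"
    and \<eta>F :: "('p, 'n) cplx \<Rightarrow> ('o, 'm) kmor"
    and G :: "(('o, 'm) cplx, ('o, 'm) dmor, ('p, 'n) cplx, ('p, 'n) dmor) catfun"
    and \<eta>G :: "('o, 'm) cplx \<Rightarrow> ('p, 'n) dmor"
  assumes "abelian_category A" "hom_finite A" "finite_length A" "enough_projectives A"
      "finitely_many_simples A"
    and "abelian_category B" "hom_finite B" "finite_length B" "enough_projectives B"
      "finitely_many_simples B"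
    and "bounded_t_structure (Db A) t" "finite_length (heart (Db A) t)"
    and "bounded_t_structure (Db B) t'" "finite_length (heart (Db B) t')"
    and "bounded_weight_structure (KbProj A) w" "w = corresponding_weight_structure A t"
    and "bounded_weight_structure (KbProj B) w'" "w' = corresponding_weight_structure B t'"
    and "triangulated_functor (KbProj B) (KbProj A) F \<eta>F"
    and "triangulated_functor (Db A) (Db B) G \<eta>G"
    and "right_pseudo_adjoint A B F G"
  shows "t_exact G t t' \<longleftrightarrow> weight_exact F w' w"
proof -
  interpret A: enough_projectives_category A
    using assms(1,4) by (simp add: enough_projectives_category_def enough_projectives_category_axioms_def)
  interpret B: enough_projectives_category B
    using assms(6,9) by (simp add: enough_projectives_category_def enough_projectives_category_axioms_def)
  have t: "t_structure (Db A) t" and t': "t_structure (Db B) t'"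
    and w: "weight_structure (KbProj A) w" and w': "weight_structure (KbProj B) w'"
    using assms(11,13,15,17) by (simp_all add: bounded_t_structure_def bounded_weight_structure_def)
  note wt = assms(16) and wt' = assms(18) and F = assms(19) and G = assms(20) and adj = assms(21)
  note w_iff = A.corresponding_weight_structure_iff[OF t, folded wt]
    and w'_iff = B.corresponding_weight_structure_iff[OF t', folded wt']
  have F_ob: "FOb F X \<in> Ob (KbProj A)" if "X \<in> Ob (KbProj B)" for X
    using F that by (simp add: triangulated_functor_def linear_functor_def)
  have G_ob: "bounded_cplx B (FOb G Y)" if "bounded_cplx A Y" for Y
    using G that by (simp add: triangulated_functor_def linear_functor_def)
  have F_shift: "isomorphic (Kb A) (FOb F (cplx_shift B 1 X)) (cplx_shift A 1 (FOb F X))"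
    if "X \<in> Ob (KbProj B)" for X
    using F that unfolding triangulated_functor_def A.Kb_Proj_sel(5) B.Kb_Proj_sel(5)
      A.isomorphic_KbProj[symmetric] isomorphic_def by blast
  have G_shift: "B.dequiv (FOb G (cplx_shift A 1 Y)) (cplx_shift B 1 (FOb G Y))"
    if "bounded_cplx A Y" for Y
  proof -
    have "isomorphic (Db B) (FOb G (cplx_shift A 1 Y)) (cplx_shift B 1 (FOb G Y))"
      using G that unfolding triangulated_functor_def Db_sel(1,6) isomorphic_def by blast
    then show ?thesis
      using B.isomorphic_Db_iff G_ob that A.bounded_cplx_shift B.bounded_cplx_shift by blast
  qed
  \<comment> \<open>A bijection of Hom sets preserves being a singleton, so vanishing is exchanged
    without following the zero map.\<close>
  have adj: "A.R.no_maps (A.opc (FOb F X)) (A.opc Y) \<longleftrightarrow> B.R.no_maps (B.opc X) (B.opc (FOb G Y))"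
    if X: "X \<in> Ob (KbProj B)" and Y: "bounded_cplx A Y" for X Y
  proof -
    obtain \<phi> where "bij_betw \<phi> (Hom (Db A) (FOb F X) Y) (Hom (Db B) X (FOb G Y))"
      using adj X Y unfolding right_pseudo_adjoint_def Db_sel(1) by blast
    then show ?thesis
      using is_singleton_bij_betw A.hom_Db_zero_iff(2)[OF F_ob[OF X] Y]
        B.hom_Db_zero_iff(2)[OF X G_ob[OF Y]] by blast
  qed
  have tb: "Y \<in> le_part t \<Longrightarrow> bounded_cplx A Y" "Y \<in> ge_part t \<Longrightarrow> bounded_cplx A Y" for Y
    using t by (auto simp: t_structure_def)
  show ?thesis
  proof
    assume "t_exact G t t'"
    then have le: "\<And>Y. Y \<in> le_part t \<Longrightarrow> FOb G Y \<in> le_part t'"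
      and ge: "\<And>Y. Y \<in> ge_part t \<Longrightarrow> FOb G Y \<in> ge_part t'"
      by (auto simp: t_exact_def)
    have closed: "V \<in> ge_part t'" if "B.dequiv X V" "X \<in> ge_part t'" for X V
      using t' B.isomorphic_Db_iff[of X V] that
      by (auto simp: t_structure_def iso_closed_def B.dequiv_def)
    have "FOb F X \<in> le_part w" if "X \<in> le_part w'" for X
      unfolding w_iff
    proof (intro conjI ballI)
      have X: "X \<in> Ob (KbProj B)" using that w'_iff by blast
      then show "FOb F X \<in> Ob (KbProj A)" by (rule F_ob)
      fix Y assume Y: "Y \<in> ge_part t"
      let ?Y = "cplx_shift A (- 1) Y"
      note bY = A.bounded_cplx_shift[OF tb(2)[OF Y], of "- 1"]
      \<comment> \<open>Compatibility with the shift is given for [1], so it is applied to Y[-1].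
        Then G(Y[-1])[1] lies in the coaisle of t', and shifting back makes G(Y[-1])
        positive.\<close>
      have "B.dequiv (FOb G Y) (cplx_shift B 1 (FOb G ?Y))"
        using G_shift[OF bY] A.cplx_shift_shift[OF tb(2)[OF Y], of 1] by simp
      then have "cplx_shift B 1 (FOb G ?Y) \<in> ge_part t'" using closed ge[OF Y] by blast
      then have "B.R.no_maps (B.opc X) (B.opc (cplx_shift B (- 1) (cplx_shift B 1 (FOb G ?Y))))"
        using that w'_iff by blast
      then show "A.R.no_maps (A.opc (FOb F X)) (A.opc ?Y)"
        using adj[OF X bY] B.cplx_shift_shift[OF G_ob[OF bY], of "- 1"] by simp
    qed
    moreover have "FOb F X \<in> ge_part w" if "X \<in> ge_part w'" for X
      unfolding w_iff
    proof (intro conjI ballI)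
      have X: "X \<in> Ob (KbProj B)" using that w'_iff by blast
      then show "FOb F X \<in> Ob (KbProj A)" by (rule F_ob)
      fix Y assume Y: "Y \<in> le_part t"
      note bY = A.bounded_cplx_shift[OF tb(1)[OF Y], of 1]
      have "B.R.no_maps (B.opc X) (B.opc (cplx_shift B 1 (FOb G Y)))"
        using that w'_iff le[OF Y] by blast
      then show "A.R.no_maps (A.opc (FOb F X)) (A.opc (cplx_shift A 1 Y))"
        using adj[OF X bY] B.no_maps_dequiv[OF X G_shift[OF tb(1)[OF Y]]] by blast
    qed
    ultimately show "weight_exact F w' w" by (auto simp: weight_exact_def)
  next
    assume "weight_exact F w' w"
    then have le: "\<And>X. X \<in> le_part w' \<Longrightarrow> FOb F X \<in> le_part w"
      and ge: "\<And>X. X \<in> ge_part w' \<Longrightarrow> FOb F X \<in> ge_part w"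
      by (auto simp: weight_exact_def)
    have "FOb G Y \<in> le_part t'" if Y: "Y \<in> le_part t" for Y
    proof (rule B.t_structure_orthogonal(1)[OF t' w' wt' G_ob[OF tb(1)[OF Y]]])
      fix Q assume Q: "Q \<in> ge_part w'"
      then have QOb: "Q \<in> Ob (KbProj B)" using w'_iff by blast
      \<comment> \<open>The criterion tests X = Q[-1], but the weight condition is known for F(Q);
        these meet because F(X)[1] is isomorphic to F(Q).\<close>
      let ?X = "cplx_shift B (- 1) Q"
      have X: "?X \<in> Ob (KbProj B)" by (rule B.KbProj_shift[OF QOb])
      note bF = A.KbProj_ObD(1)[OF F_ob]
      have "isomorphic (Kb A) (cplx_shift A 1 (FOb F ?X)) (FOb F Q)"
        using A.isomorphic_Kb_sym[OF F_shift[OF X]] B.cplx_shift_shift[OF B.KbProj_ObD(1)[OF QOb], of 1] by simp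
      moreover have "A.R.no_maps (A.opc (FOb F Q)) (A.opc (cplx_shift A 1 Y))"
        using ge[OF Q] w_iff Y by blast
      ultimately have "A.R.no_maps (A.opc (cplx_shift A 1 (FOb F ?X))) (A.opc (cplx_shift A 1 Y))"
        by (rule A.no_maps_isomorphic_source[OF A.bounded_cplx_shift[OF bF[OF X]] bF[OF QOb]])
      then have "A.R.no_maps (A.opc (FOb F ?X)) (A.opc Y)"
        unfolding A.opc_shift[OF bF[OF X]] A.opc_shift[OF tb(1)[OF Y]] A.R.no_maps_shift_iff .
      then show "B.R.no_maps (B.opc ?X) (B.opc (FOb G Y))" using adj[OF X tb(1)[OF Y]] by blast
    qed
    moreover have "FOb G Y \<in> ge_part t'" if Y: "Y \<in> ge_part t" for Y
    proof (rule B.t_structure_orthogonal(2)[OF t' w' wt' G_ob[OF tb(2)[OF Y]]])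
      fix Q assume Q: "Q \<in> le_part w'"
      then have QOb: "Q \<in> Ob (KbProj B)" using w'_iff by blast
      \<comment> \<open>Now the test object is Q[1], and F(Q[1]) is compared with F(Q)[1]
        directly.\<close>
      let ?X = "cplx_shift B 1 Q"
      have X: "?X \<in> Ob (KbProj B)" by (rule B.KbProj_shift[OF QOb])
      note bF = A.KbProj_ObD(1)[OF F_ob]
      have "A.R.no_maps (A.opc (FOb F Q)) (A.opc (cplx_shift A (- 1) Y))"
        using le[OF Q] w_iff Y by blast
      from A.R.no_maps_shift[OF this, of 1]
      have "A.R.no_maps (A.opc (cplx_shift A 1 (FOb F Q))) (A.opc Y)"
        by (simp add: A.opc_shift bF[OF QOb] tb(2)[OF Y] A.R.shift_shift A.R.shift_zero)
      then have "A.R.no_maps (A.opc (FOb F ?X)) (A.opc Y)"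
        by (rule A.no_maps_isomorphic_source[OF bF[OF X] A.bounded_cplx_shift[OF bF[OF QOb]] F_shift[OF QOb]])
      then show "B.R.no_maps (B.opc ?X) (B.opc (FOb G Y))" using adj[OF X tb(2)[OF Y]] by blast
    qed
    ultimately show "t_exact G t t'" by (auto simp: t_exact_def)
  qed
qed

end
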